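(* Let $n\ge2$, let $X_1,\ldots,X_n$ be real-valued random variables with distributions $F_1,\ldots,F_n\in\mathcal{D}\cap\mathcal{L}$ respectively, and let $\Theta_1,\ldots,\Theta_n$ be non-negative random variables, non-degenerate at zero. Suppose that: (i) there exist functions $b_i:[0,\infty)\to(0,\infty)$, $i=1,\ldots,n$, such that $b_i(x)\to\infty$ and $b_i(x)/x\to 0$ as $x\to\infty$, and, for all $1\le i\ne j\le n$, $$\mathbf{P}[\Theta_i>b_i(x_i)]=o\big(\mathbf{P}[\Theta_iX_i>x_i,\ \Theta_jX_j>x_j]\big)\quad\text{as } x_i\wedge x_j\to\infty;$$ (ii) for each $i=1,\ldots,n$ there exists a function $h_i:[0,\infty)\to(0,\infty)$ such that $$\mathbf{P}[X_i>x\mid\Theta_i=\theta]\sim h_i(\theta)\,\mathbf{P}[X_i>x]\quad\text{as }x\to\infty,\ \text{uniformly for }\theta\in s_{\Theta_i};$$ (iii) there exist measurable functions $g_{ij}:[0,\infty)^2\to(0,\infty)$, $1\le i\ne j\le n$, and constants $0<L\le U<\infty$ such that, for all $1\le i\neq j\le n$, as $x_i\wedge x_j\to\infty$, uniformly for $(\theta_i,\theta_j)\in s_{\Theta_i}\times s_{\Theta_j}$, $$\mathbf{P}[|X_i|>x_i,\ X_j>x_j\mid\Theta_i=\theta_i,\Theta_j=\theta_j]\sim g_{ij}(\theta_i,\theta_j)\,\mathbf{P}[|X_i|>x_i,\ X_j>x_j]$$ and $$L\,g_{ij}(\theta_i,\theta_j)\mathbf{P}[X_i>x_i,X_j>x_j]\lesssim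 \mathbf{P}[X_i>x_i,X_j>x_j\mid\Theta_i=\theta_i,\Theta_j=\theta_j]\lesssim U\,g_{ij}(\theta_i,\theta_j)\mathbf{P}[X_i>x_i,X_j>x_j].$$ Let $\psi(x,n)=\mathbf{P}\big[\max_{1\le k\le n}\sum_{i=1}^k\Theta_iX_i>x\big]$ be the finite-time ruin probability. (a) If either $X_1,\ldots,X_n$ are pTAI, or $X_1,\ldots,X_n$ are pQAI and $F_1,\ldots,F_n\in\mathcal{C}$, then $$\psi(x,n)\sim\sum_{i=1}^n\mathbf{P}[\Theta_iX_i>x]\quad\text{as }x\to\infty.$$ (b) If, in addition to (i)-(iii), $F_i\in\mathcal{R}_{-\alpha_i}$ with $\alpha_i>0$ and $\mathbf{E}[\Theta_i^{\rho_i}h_i(\Theta_i)]<\infty$ for some $\rho_i>\alpha_i$, for every $i=1,\ldots,n$, and if $X_1,\ldots,X_n$ are pTAI or pQAI, then $$\psi(x,n)\sim\sum_{i=1}^n\mathbf{E}[\Theta_i^{\alpha_i}h_i(\Theta_i)]\,\overline F_i(x)\quad\text{as }x\to\infty.$$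
   Context: For a distribution $F$, $\overline F(x)=1-F(x)$; throughout $\overline F_i(x)>0$ for all $x\ge0$ and all $i$. "Non-degenerate at zero" means not almost surely equal to $0$. $x\wedge y=\min\{x,y\}$, $x^+=\max\{x,0\}$, $x^-=-\min\{x,0\}$. In the risk model, $X_i$ is the net loss in period $i$, $\Theta_i$ the corresponding stochastic discount factor and $x$ the initial capital. $f=o(g)$ means $f/g\to0$; $f\sim g$ means $f/g\to1$; $f\lesssim g$ means $\limsup f/g\le1$. Uniformity of $\sim$ over $\theta$ means that the supremum over $\theta$ of $|f/g-1|$ tends to $0$; uniformity of $\lesssim$ means $\limsup$ of the supremum over $\theta$ of the ratio $f/g$ is $\le1$. Support: $s_{\Theta_i}=\{\theta\in\mathbb{R}:\mathbf{P}(\Theta_i\in[\theta-\delta,\theta+\delta])>0\text{ for any }\delta>0\}$. For an event $A$, $\mathbf{P}[A\mid\Theta_i=\theta_i,\Theta_j=\theta_j]$ is defined as $$\lim_{\delta\downarrow0}\frac{\mathbf{P}[A,\ \Theta_i\in[\theta_i-\delta,\theta_i+\delta],\ \Theta_j\in[\theta_j-\delta,\theta_j+\delta]]}{\mathbf{P}[\Theta_i\in[\theta_i-\delta,\theta_i+\delta],\ \Theta_j\in[\theta_j-\delta,\theta_j+\delta]]},$$ and $\mathbf{P}[A\mid\Theta_i=\theta]$ is defined analogously with a single weight. Distribution classes: $F\in\mathcal{D}$ if $\limsup_{x\to\infty}\overline F(bx)/\overline F(x)<\infty$ for any (equivalently, some) $b\in(0,1)$; $F\in\mathcal{L}$ if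 $\lim_{x\to\infty}\overline F(x-a)/\overline F(x)=1$ for any (equivalently, some) $a>0$; $F\in\mathcal{C}$ if $\lim_{v\uparrow1}\limsup_{x\to\infty}\overline F(vx)/\overline F(x)=1$; $F\in\mathcal{R}_{-\alpha}$ ($0<\alpha<\infty$) if $\lim_{x\to\infty}\overline F(bx)/\overline F(x)=b^{-\alpha}$ for every $b>0$. Real-valued random variables $Y_1,\ldots,Y_n$ are pTAI if for all $i\ne j$, $\lim_{x_i\wedge x_j\to\infty}\mathbf{P}[|Y_i|>x_i\mid Y_j>x_j]=0$. They are pQAI if for all $i\neq j$, $$\lim_{x\to\infty}\frac{\mathbf{P}[Y_i^+>x,\,Y_j^+>x]}{\mathbf{P}[Y_i>x]+\mathbf{P}[Y_j>x]}=\lim_{x\to\infty}\frac{\mathbf{P}[Y_i^->x,\,Y_j>x]}{\mathbf{P}[Y_i>x]+\mathbf{P}[Y_j>x]}=0.$$ *)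

theory Defs
  imports "HOL-Probability.Probability" "HOL-Library.Landau_Symbols"
begin

definition tail :: "(real \<Rightarrow> real) \<Rightarrow> real \<Rightarrow> real" where
  "tail F x = 1 - F x"

text \<open>The classes of distribution functions with dominatedly varying, long, consistently varying
  and regularly varying tails. They are meant for distributions whose tail is everywhere positive.\<close>

definition class_D :: "(real \<Rightarrow> real) set" where
  "class_D = {F. \<forall>b. 0 < b \<and> b < 1 \<longrightarrow>
     Limsup at_top (\<lambda>x. ereal (tail F (b * x) / tail F x)) < \<infinity>}"

definition class_L :: "(real \<Rightarrow> real) set" where
  "class_L = {F. \<forall>a>0. ((\<lambda>x. tail F (x - a) / tail F x) \<longlongrightarrow> 1) at_top}"

definition class_C :: "(real \<Rightarrow> real) set" where
  "class_C = {F. ((\<lambda>v. Limsup at_top (\<lambda>x. ereal (tail F (v * x) / tail F x))) \<longlongrightarrow> 1) (at_left 1)}"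

text \<open>\<^term>\<open>class_R \<alpha>\<close> is regular variation with index \<^term>\<open>- \<alpha>\<close>.\<close>

definition class_R :: "real \<Rightarrow> (real \<Rightarrow> real) set" where
  "class_R \<alpha> = {F. \<forall>b>0. ((\<lambda>x. tail F (b * x) / tail F x) \<longlongrightarrow> b powr (- \<alpha>)) at_top}"

text \<open>Pairwise (strong) tail asymptotic independence and pairwise quasi-asymptotic independence
  of a finite family. Throughout, a limit as the minimum of \<^term>\<open>x\<close> and \<^term>\<open>y\<close> tends to infinity is
  a limit along \<^term>\<open>at_top \<times>\<^sub>F at_top\<close>: both variables tend to infinity, in no prescribed relation.\<close>

definition pTAI :: "'a measure \<Rightarrow> nat set \<Rightarrow> (nat \<Rightarrow> 'a \<Rightarrow> real) \<Rightarrow> bool" where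
  "pTAI M I Y \<longleftrightarrow> (\<forall>i\<in>I. \<forall>j\<in>I. i \<noteq> j \<longrightarrow>
     ((\<lambda>(x, y). \<P>(\<omega> in M. \<bar>Y i \<omega>\<bar> > x \<bar> Y j \<omega> > y)) \<longlongrightarrow> 0) (at_top \<times>\<^sub>F at_top))"

definition pQAI :: "'a measure \<Rightarrow> nat set \<Rightarrow> (nat \<Rightarrow> 'a \<Rightarrow> real) \<Rightarrow> bool" where
  "pQAI M I Y \<longleftrightarrow> (\<forall>i\<in>I. \<forall>j\<in>I. i \<noteq> j \<longrightarrow>
     ((\<lambda>x. \<P>(\<omega> in M. max (Y i \<omega>) 0 > x \<and> max (Y j \<omega>) 0 > x) /
           (\<P>(\<omega> in M. Y i \<omega> > x) + \<P>(\<omega> in M. Y j \<omega> > x))) \<longlongrightarrow> 0) at_top \<and>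
     ((\<lambda>x. \<P>(\<omega> in M. - min (Y i \<omega>) 0 > x \<and> Y j \<omega> > x) /
           (\<P>(\<omega> in M. Y i \<omega> > x) + \<P>(\<omega> in M. Y j \<omega> > x))) \<longlongrightarrow> 0) at_top)"

definition rv_support :: "'a measure \<Rightarrow> ('a \<Rightarrow> real) \<Rightarrow> real set" where
  "rv_support M Y = {y. \<forall>\<delta>>0. \<P>(\<omega> in M. Y \<omega> \<in> {y - \<delta>..y + \<delta>}) > 0}"

text \<open>Pointwise conditional probabilities as limits of elementary ones over shrinking windows
  \<^term>\<open>W \<delta>\<close>. The value \<^term>\<open>lim_cond_prob M A W\<close> is only meaningful if \<^term>\<open>lim_cond_prob_defined M A W\<close>:
  the quotients have positive denominators and the limit exists.\<close>

definition lim_cond_prob :: "'a measure \<Rightarrow> ('a \<Rightarrow> bool) \<Rightarrow> (real \<Rightarrow> 'a \<Rightarrow> bool) \<Rightarrow> real" where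
  "lim_cond_prob M A W = Lim (at_right 0) (\<lambda>\<delta>. \<P>(\<omega> in M. A \<omega> \<bar> W \<delta> \<omega>))"

definition lim_cond_prob_defined :: "'a measure \<Rightarrow> ('a \<Rightarrow> bool) \<Rightarrow> (real \<Rightarrow> 'a \<Rightarrow> bool) \<Rightarrow> bool" where
  "lim_cond_prob_defined M A W \<longleftrightarrow>
     (\<forall>\<delta>>0. \<P>(\<omega> in M. W \<delta> \<omega>) > 0) \<and>
     (\<exists>l. ((\<lambda>\<delta>. \<P>(\<omega> in M. A \<omega> \<bar> W \<delta> \<omega>)) \<longlongrightarrow> l) (at_right 0))"

definition window :: "('a \<Rightarrow> real) \<Rightarrow> real \<Rightarrow> real \<Rightarrow> 'a \<Rightarrow> bool" where
  "window Y y \<delta> \<omega> \<longleftrightarrow> Y \<omega> \<in> {y - \<delta>..y + \<delta>}"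

definition window2 :: "('a \<Rightarrow> real) \<Rightarrow> ('a \<Rightarrow> real) \<Rightarrow> real \<times> real \<Rightarrow> real \<Rightarrow> 'a \<Rightarrow> bool" where
  "window2 Y Z p \<delta> \<omega> \<longleftrightarrow> window Y (fst p) \<delta> \<omega> \<and> window Z (snd p) \<delta> \<omega>"

text \<open>Asymptotic equivalence along \<^term>\<open>F\<close>, uniformly over a parameter set \<^term>\<open>S\<close>. Since division by zero
  yields zero, it forces the denominators to be nonzero eventually.\<close>

definition unif_asymp_equiv :: "'b filter \<Rightarrow> 'c set \<Rightarrow> ('b \<Rightarrow> 'c \<Rightarrow> real) \<Rightarrow> ('b \<Rightarrow> 'c \<Rightarrow> real) \<Rightarrow> bool" where
  "unif_asymp_equiv F S f g \<longleftrightarrow> uniform_limit S (\<lambda>x s. f x s / g x s) (\<lambda>_. 1) F"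

text \<open>Uniform asymptotic domination of nonnegative functions. The quotient is taken in \<^typ>\<open>ereal\<close>,
  where a positive number divided by zero is \<^term>\<open>\<infinity> :: ereal\<close> (and zero divided by zero is zero);
  real division would make such quotients vanish and so count as small.\<close>

definition unif_lesssim :: "'b filter \<Rightarrow> 'c set \<Rightarrow> ('b \<Rightarrow> 'c \<Rightarrow> real) \<Rightarrow> ('b \<Rightarrow> 'c \<Rightarrow> real) \<Rightarrow> bool" where
  "unif_lesssim F S f g \<longleftrightarrow>
     Limsup F (\<lambda>x. SUP s\<in>S. ereal (f x s) / ereal (g x s)) \<le> 1"

definition ruin_prob :: "'a measure \<Rightarrow> (nat \<Rightarrow> 'a \<Rightarrow> real) \<Rightarrow> (nat \<Rightarrow> 'a \<Rightarrow> real) \<Rightarrow> real \<Rightarrow> nat \<Rightarrow> real" where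
  "ruin_prob M \<Theta> X x n =
     \<P>(\<omega> in M. Max ((\<lambda>k. \<Sum>i=1..k. \<Theta> i \<omega> * X i \<omega>) ` {1..n}) > x)"

end

theory Submission
  imports Defs
begin

text \<open>
  The weights are essentially bounded. In the smallness condition on \<open>P[\<Theta>\<^sub>i > b\<^sub>i x]\<close> the two
  thresholds tend to infinity independently of each other; fix a large \<open>x\<close> and let the other
  threshold \<open>y\<close> tend to infinity: the joint probability \<open>P[\<Theta>\<^sub>i X\<^sub>i > x, \<Theta>\<^sub>j X\<^sub>j > y]\<close> vanishes,
  hence \<open>P[\<Theta>\<^sub>i > b\<^sub>i x] = 0\<close> (\<open>weights_bounded\<close>). If \<open>0 \<le> \<Theta>\<^sub>i \<le> B\<close> for all \<open>i\<close>, then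
  \<open>\<bar>\<Theta>\<^sub>i X\<^sub>i\<bar> > u\<close> and \<open>\<Theta>\<^sub>j X\<^sub>j > v \<ge> 0\<close> imply \<open>\<bar>X\<^sub>i\<bar> > u / B\<close> and \<open>X\<^sub>j > v / B\<close>, so either
  form of asymptotic independence passes from the \<open>X\<^sub>i\<close> to the products \<open>\<Theta>\<^sub>i X\<^sub>i\<close>, provided that the
  tails of \<open>X\<^sub>i\<close> and \<open>\<Theta>\<^sub>i X\<^sub>i\<close> are of the same order (\<open>weighted_pair_small_of_TAI\<close>,
  \<open>weighted_pair_small_of_QAI\<close>).

  For a single pair, let \<open>G\<close> be the tail of \<open>X\<close>. The condition on the conditional tails says that
  \<open>P[X > x, \<Theta> \<in> A]\<close> is \<open>G x * E[h \<Theta>; \<Theta> \<in> A]\<close> up to a factor that tends to 1 uniformly in the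
  Borel set \<open>A\<close> (\<open>uniform_conditional_density\<close>). As conditional probabilities are limits over
  shrinking symmetric windows, this needs a differentiation theorem for arbitrary finite Borel measures
  on the line. It rests on the fact that a finite cover by intervals has a subcover in which
  no point is covered more than twice; the factor 2 that this costs is removed by a Hahn
  decomposition (\<open>measure_le_of_intervals\<close>).
  Approximating \<open>\<Theta>\<close> from below by a grid gives \<open>P[\<Theta> X > x] \<sim> E[h \<Theta> * G (x / \<Theta>); \<Theta> > 0]\<close>
  (\<open>product_tail\<close>). Since \<open>\<Theta>\<close> is bounded, \<open>\<Theta> X\<close> has a tail of the order of \<open>G\<close> and
  inherits from \<open>X\<close> a long or a consistently varying tail; if \<open>G\<close> is regularly
  varying with index \<open>- \<alpha>\<close>, dominated convergence yields
  \<open>P[\<Theta> X > x] \<sim> E[\<Theta> powr \<alpha> * h \<Theta>] * G x\<close> (\<open>T_regularly_varying\<close>).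

  Finally, a single big jump makes the maximal partial sum large (\<open>max_partial_sums_tail\<close>). For a
  margin \<open>d > 0\<close>, if a partial sum exceeds \<open>x\<close>, then one summand exceeds \<open>x - d\<close>, or one summand exceeds
  \<open>x / n\<close> while another one exceeds \<open>d / n\<close> in absolute value; conversely one summand above
  \<open>x + d\<close> with all others at most \<open>d / n\<close> in absolute value makes the full sum exceed \<open>x\<close>. Under
  tail asymptotic independence the margin is a large constant and long tails are used; under
  quasi-asymptotic independence it is a small multiple of \<open>x\<close> and consistent variation is used.
\<close>

section \<open>Differentiation of measures on the real line\<close>

text \<open>The one-dimensional covering lemma: in a subfamily of least cardinality that still covers
  \<open>K\<close>, no point lies in three intervals.\<close>

lemma minimal_interval_cover:
  fixes r :: "real \<Rightarrow> real"
  assumes "finite J" "K \<subseteq> (\<Union>t\<in>J. {t - r t..t + r t})"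
  obtains J' where "J' \<subseteq> J" "K \<subseteq> (\<Union>t\<in>J'. {t - r t..t + r t})"
    "\<And>x. card {t\<in>J'. x \<in> {t - r t..t + r t}} \<le> 2"
proof -
  define I where "I = (\<lambda>t. {t - r t..t + r t})"
  define P where "P = (\<lambda>J'. J' \<subseteq> J \<and> K \<subseteq> (\<Union>t\<in>J'. I t))"
  have "P J" using assms by (simp add: P_def I_def)
  then obtain J' where J': "P J'" and min: "\<And>J''. P J'' \<Longrightarrow> card J' \<le> card J''"
    by (metis (no_types, lifting) arg_min_natI arg_min_nat_le)
  have fin: "finite J'" using J' assms(1) finite_subset unfolding P_def by blast
  have "card {t\<in>J'. x \<in> I t} \<le> 2" for x
  proof (rule ccontr)
    define S where "S = {t\<in>J'. x \<in> I t}"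
    assume "\<not> card {t\<in>J'. x \<in> I t} \<le> 2"
    then have card: "card S > 2" by (simp add: S_def)
    have finS: "finite S" using fin by (simp add: S_def)
    have ne: "S \<noteq> {}" using card by auto
    define a where "a = arg_min_on (\<lambda>t. t - r t) S"
    define b where "b = arg_min_on (\<lambda>t. - (t + r t)) S"
    have a: "a \<in> S" "\<And>t. t \<in> S \<Longrightarrow> a - r a \<le> t - r t"
      using arg_min_if_finite[OF finS ne] arg_min_least[OF finS ne] unfolding a_def by auto
    have b: "b \<in> S" "\<And>t. t \<in> S \<Longrightarrow> t + r t \<le> b + r b"
      using arg_min_if_finite(1)[OF finS ne] arg_min_least[OF finS ne, of _ "\<lambda>t. - (t + r t)"]
      unfolding b_def by (auto simp: algebra_simps)
    have "\<not> S \<subseteq> {a, b}"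
      using card card_mono[of "{a, b}" S] card_insert_le_m1[of 2 "{b}" a] by auto
    then obtain s where s: "s \<in> S" "s \<noteq> a" "s \<noteq> b" by auto
    \<comment> \<open>All the intervals meet in \<open>x\<close>, so the leftmost and the rightmost one cover the third.\<close>
    have "I s \<subseteq> I a \<union> I b"
      proof
      fix y assume "y \<in> I s"
      then have "s - r s \<le> y" "y \<le> s + r s" by (auto simp: I_def)
      moreover have "a - r a \<le> s - r s" "s + r s \<le> b + r b" using a(2) b(2) s(1) by auto
      moreover have "x \<le> a + r a" "b - r b \<le> x" using a(1) b(1) by (auto simp: S_def I_def)
      ultimately have "a - r a \<le> y \<and> y \<le> a + r a \<or> b - r b \<le> y \<and> y \<le> b + r b" by linarith
      then show "y \<in> I a \<union> I b" by (simp add: I_def)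
    qed
    then have "P (J' - {s})"
      using J' a(1) b(1) s unfolding P_def S_def by blast
    from min[OF this] show False
      using fin s(1) card_Diff1_less[of J' s] unfolding S_def by auto
  qed
  with J' show thesis using that unfolding P_def I_def by blast
qed

lemma measure_cover_le:
  fixes \<mu> :: "real measure" and r :: "real \<Rightarrow> real"
  assumes "finite_measure \<mu>" "sets \<mu> = sets borel" "finite J" "open V"
    and "\<And>x. card {t\<in>J. x \<in> {t - r t..t + r t}} \<le> m"
    and "\<And>t. t \<in> J \<Longrightarrow> {t - r t..t + r t} \<subseteq> V"
  shows "(\<Sum>t\<in>J. measure \<mu> {t - r t..t + r t}) \<le> real m * measure \<mu> V"
proof -
  interpret finite_measure \<mu> by fact
  have [measurable_cong]: "sets \<mu> = sets borel" by fact
  have sp: "space \<mu> = UNIV" using assms(2) sets_eq_imp_space_eq by fastforce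
  have "(\<Sum>t\<in>J. measure \<mu> {t - r t..t + r t}) = (\<Sum>t\<in>J. \<integral>x. indicator {t - r t..t + r t} x \<partial>\<mu>)"
    by (simp add: sp)
  also have "\<dots> = (\<integral>x. (\<Sum>t\<in>J. indicator {t - r t..t + r t} x) \<partial>\<mu>)"
    by (subst Bochner_Integration.integral_sum) (auto simp: assms(2) emeasure_eq_measure)
  also have "\<dots> \<le> (\<integral>x. real m * indicator V x \<partial>\<mu>)"
  proof (rule integral_mono)
    show "integrable \<mu> (\<lambda>x. \<Sum>t\<in>J. indicator {t - r t..t + r t} x :: real)"
      by (intro Bochner_Integration.integrable_sum) (auto simp: assms(2) emeasure_eq_measure)
    show "integrable \<mu> (\<lambda>x. real m * indicator V x)"
      using assms(2,4) by (intro integrable_mult_right) (auto simp: emeasure_eq_measure)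
    fix x
    have "(\<Sum>t\<in>J. indicator {t - r t..t + r t} x :: real) = real (card {t\<in>J. x \<in> {t - r t..t + r t}})"
      using assms(3) by (simp add: indicator_def sum.If_cases Int_def)
    also have "\<dots> \<le> real m * indicator V x"
    proof (cases "x \<in> V")
      case True then show ?thesis using assms(5)[of x] by simp
    next
      case False
      then have "{t\<in>J. x \<in> {t - r t..t + r t}} = {}" using assms(6) by blast
      then show ?thesis by (metis card.empty of_nat_0 order.refl False indicator_simps(2) mult_zero_right)
    qed
    finally show "(\<Sum>t\<in>J. indicator {t - r t..t + r t} x) \<le> real m * indicator V x" .
  qed
  also have "\<dots> = real m * measure \<mu> V" using assms(2,4) by (simp add: sp)
  finally show ?thesis .
qed

text \<open>A crude comparison of two measures from arbitrarily small intervals around each point of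
  \<open>A\<close>. Choose such intervals inside an open neighbourhood of \<open>A\<close> and cover a compact subset of \<open>A\<close>
  with multiplicity at most 2; the multiplicity enters as the factor 2.\<close>

lemma measure_le_twice_of_intervals:
  fixes \<nu> \<mu> :: "real measure"
  assumes nu: "finite_measure \<nu>" "sets \<nu> = sets borel"
    and mu: "finite_measure \<mu>" "sets \<mu> = sets borel"
    and A: "A \<in> sets borel" and c: "0 \<le> c"
    and small: "\<And>t e. t \<in> A \<Longrightarrow> 0 < e \<Longrightarrow>
      \<exists>r. 0 < r \<and> r < e \<and> measure \<nu> {t - r..t + r} \<le> c * measure \<mu> {t - r..t + r}"
  shows "measure \<nu> A \<le> 2 * c * measure \<mu> A"
proof (rule field_le_epsilon)
  interpret nu: finite_measure \<nu> by fact
  interpret mu: finite_measure \<mu> by fact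
  fix e :: real assume e: "0 < e"
  have reg: "\<exists>K. K \<subseteq> A \<and> compact K \<and> measure \<nu> A < measure \<nu> K + e / 2"
  proof -
    have sup: "emeasure \<nu> A = (SUP K \<in> {K. K \<subseteq> A \<and> compact K}. emeasure \<nu> K)"
      by (rule inner_regular) (auto simp: nu A nu.emeasure_eq_measure)
    show ?thesis
    proof (cases "measure \<nu> A < e / 2")
      case True then show ?thesis by (intro exI[of _ "{}"]) auto
    next
      case False
      have "ennreal (measure \<nu> A - e / 2) < emeasure \<nu> A"
        using e False by (simp add: nu.emeasure_eq_measure ennreal_less_iff)
      also note sup
      finally obtain K where "K \<subseteq> A" "compact K" "ennreal (measure \<nu> A - e / 2) < emeasure \<nu> K"
        unfolding less_SUP_iff by auto
      then show ?thesis using False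
        by (intro exI[of _ K]) (auto simp: nu.emeasure_eq_measure ennreal_less_iff)
    qed
  qed
  then obtain K where K: "K \<subseteq> A" "compact K" "measure \<nu> A < measure \<nu> K + e / 2" by blast
  define e' where "e' = e / (4 * (c + 1))"
  have e': "e' > 0" "2 * c * e' \<le> e / 2" using e c by (auto simp: e'_def field_simps)
  obtain V where V: "A \<subseteq> V" "open V" "measure \<mu> V < measure \<mu> A + e'"
  proof -
    have "emeasure \<mu> A = (INF U \<in> {U. A \<subseteq> U \<and> open U}. emeasure \<mu> U)"
      by (rule outer_regular) (auto simp: mu A mu.emeasure_eq_measure)
    moreover have "emeasure \<mu> A < ennreal (measure \<mu> A + e')"
      using e' by (simp add: mu.emeasure_eq_measure ennreal_less_iff)
    ultimately have "(INF U \<in> {U. A \<subseteq> U \<and> open U}. emeasure \<mu> U) < ennreal (measure \<mu> A + e')"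
      by simp
    then obtain U where "A \<subseteq> U" "open U" "emeasure \<mu> U < ennreal (measure \<mu> A + e')"
      unfolding INF_less_iff by auto
    then show thesis using that by (auto simp: mu.emeasure_eq_measure ennreal_less_iff)
  qed
  have "\<exists>r>0. {t - r..t + r} \<subseteq> V \<and> measure \<nu> {t - r..t + r} \<le> c * measure \<mu> {t - r..t + r}"
    if "t \<in> K" for t
  proof -
    have tA: "t \<in> A" using that K(1) by auto
    then have "t \<in> V" using V(1) by auto
    then obtain d where d: "d > 0" "cball t d \<subseteq> V" using V(2) open_contains_cball by blast
    obtain r where "0 < r" "r < d" "measure \<nu> {t - r..t + r} \<le> c * measure \<mu> {t - r..t + r}"
      using small[OF tA d(1)] by (elim exE conjE)
    moreover have "{t - r..t + r} \<subseteq> cball t d" using \<open>r < d\<close> by (auto simp: dist_real_def)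
    ultimately show ?thesis using d by blast
  qed
  then have "\<forall>t\<in>K. \<exists>r. 0 < r \<and> {t - r..t + r} \<subseteq> V \<and>
      measure \<nu> {t - r..t + r} \<le> c * measure \<mu> {t - r..t + r}" by blast
  from bchoice[OF this] obtain r where r: "\<And>t. t \<in> K \<Longrightarrow> r t > 0" "\<And>t. t \<in> K \<Longrightarrow> {t - r t..t + r t} \<subseteq> V"
    "\<And>t. t \<in> K \<Longrightarrow> measure \<nu> {t - r t..t + r t} \<le> c * measure \<mu> {t - r t..t + r t}"
    by blast
  obtain J0 where J0: "J0 \<subseteq> K" "finite J0" "K \<subseteq> (\<Union>t\<in>J0. ball t (r t))"
  proof (rule compactE_image[OF K(2), of K "\<lambda>t. ball t (r t)"])
    show "K \<subseteq> (\<Union>t\<in>K. ball t (r t))" using r(1) by auto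
  qed auto
  have "ball t (r t) \<subseteq> {t - r t..t + r t}" for t by (auto simp: dist_real_def)
  then have "K \<subseteq> (\<Union>t\<in>J0. {t - r t..t + r t})" using J0(3) by blast
  from this obtain J where J: "J \<subseteq> J0" "K \<subseteq> (\<Union>t\<in>J. {t - r t..t + r t})"
    "\<And>x. card {t\<in>J. x \<in> {t - r t..t + r t}} \<le> 2"
    by (rule minimal_interval_cover[OF J0(2)]) (rule that)
  have JK: "J \<subseteq> K" and finJ: "finite J" using J J0 finite_subset by auto
  have "measure \<nu> K \<le> measure \<nu> (\<Union>t\<in>J. {t - r t..t + r t})"
    using J(2) finJ by (intro nu.finite_measure_mono) (auto simp: nu)
  also have "\<dots> \<le> (\<Sum>t\<in>J. measure \<nu> {t - r t..t + r t})"
    by (intro measure_UNION_le finJ) (auto simp: nu)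
  also have "\<dots> \<le> (\<Sum>t\<in>J. c * measure \<mu> {t - r t..t + r t})"
    using r(3) JK by (intro sum_mono) auto
  also have "\<dots> \<le> c * (real 2 * measure \<mu> V)"
    unfolding sum_distrib_left[symmetric]
    using J(3) r(2) JK c by (intro mult_left_mono measure_cover_le mu finJ V) auto
  also have "\<dots> \<le> c * (2 * (measure \<mu> A + e'))"
    using V(3) c by (intro mult_left_mono) auto
  finally show "measure \<nu> A \<le> 2 * c * measure \<mu> A + e"
    using K(3) e' by (simp add: algebra_simps)
qed

text \<open>The sharp comparison. It is applied to sets of points at which the quotient
  of the two measures over symmetric intervals is controlled, which makes it a differentiation theorem.\<close>

lemma measure_le_of_intervals:
  fixes \<nu> \<mu> :: "real measure"
  assumes nu: "finite_measure \<nu>" "sets \<nu> = sets borel"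
    and mu: "finite_measure \<mu>" "sets \<mu> = sets borel"
    and A: "A \<in> sets borel" and c: "0 \<le> c"
    and small: "\<And>t e. t \<in> A \<Longrightarrow> 0 < e \<Longrightarrow>
      \<exists>r. 0 < r \<and> r < e \<and> measure \<nu> {t - r..t + r} \<le> c * measure \<mu> {t - r..t + r}"
  shows "measure \<nu> A \<le> c * measure \<mu> A"
proof -
  interpret nu: finite_measure \<nu> by fact
  interpret mu: finite_measure \<mu> by fact
  have main: "measure \<nu> A \<le> c' * measure \<mu> A" if c': "c < c'" for c'
  proof -
    have c'0: "c' > 0" using c c' by simp
    define lam where "lam = scale_measure (ennreal c') \<mu>"
    have flam: "finite_measure lam" "sets lam = sets borel"
      by (auto simp: lam_def mu mu.emeasure_eq_measure ennreal_mult_eq_top_iff intro!: finite_measureI)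
    interpret lam: finite_measure lam by fact
    have meas_lam: "measure lam E = c' * measure \<mu> E" for E
      using c'0 by (simp add: lam_def measure_scale_measure)
    obtain Y where Y: "Y \<in> sets borel"
      and Y1: "\<And>E. E \<in> sets borel \<Longrightarrow> E \<subseteq> Y \<Longrightarrow> emeasure \<nu> E \<le> emeasure lam E"
      and Y2: "\<And>E. E \<in> sets borel \<Longrightarrow> E \<inter> Y = {} \<Longrightarrow> emeasure lam E \<le> emeasure \<nu> E"
      using finite_unsigned_Hahn_decomposition[OF flam(1) nu(1)] flam(2) nu(2) by auto
    define P where "P = A - Y"
    have P[measurable]: "P \<in> sets borel" using A Y by (simp add: P_def)
    have P_le: "c' * measure \<mu> E \<le> measure \<nu> E" if "E \<in> sets borel" "E \<subseteq> P" for E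
      using Y2[OF that(1)] that(2) unfolding P_def
      by (auto simp: lam.emeasure_eq_measure nu.emeasure_eq_measure meas_lam)
    \<comment> \<open>On \<open>P\<close> the measure \<open>\<nu>\<close> exceeds \<open>c' * \<mu>\<close>, although on small intervals it is at most \<open>c * \<mu>\<close>;
      hence these intervals have most of their mass outside \<open>P\<close>.\<close>
    have muP: "measure \<mu> P = 0"
    proof -
      define m1 where "m1 = density \<mu> (indicator P)"
      define m2 where "m2 = density \<mu> (indicator (- P))"
      have m: "finite_measure m1" "sets m1 = sets borel" "finite_measure m2" "sets m2 = sets borel"
        by (auto simp: m1_def m2_def mu intro!: mu.finite_measure_restricted)
      have mm: "measure m1 E = measure \<mu> (P \<inter> E)" "measure m2 E = measure \<mu> ((- P) \<inter> E)"
        if "E \<in> sets borel" for E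
        using that by (auto simp: m1_def m2_def measure_def emeasure_restricted mu)
      have "measure m1 P \<le> 2 * (c / (c' - c)) * measure m2 P"
      proof (rule measure_le_twice_of_intervals[OF m P])
        show "0 \<le> c / (c' - c)" using c c' by simp
        fix t e :: real assume "t \<in> P" "0 < e"
        then obtain r where r: "0 < r" "r < e" "measure \<nu> {t - r..t + r} \<le> c * measure \<mu> {t - r..t + r}"
          using small[of t e] unfolding P_def by auto
        let ?I = "{t - r..t + r}"
        have "c' * measure \<mu> (P \<inter> ?I) \<le> measure \<nu> (P \<inter> ?I)"
          by (intro P_le) auto
        also have "\<dots> \<le> measure \<nu> ?I" by (intro nu.finite_measure_mono) (auto simp: nu)
        also have "\<dots> \<le> c * measure \<mu> ?I" by fact
        also have "measure \<mu> ?I = measure \<mu> (P \<inter> ?I) + measure \<mu> ((- P) \<inter> ?I)"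
          by (subst mu.finite_measure_Union[symmetric]) (auto simp: mu intro!: arg_cong[where f = "measure \<mu>"])
        finally have "(c' - c) * measure \<mu> (P \<inter> ?I) \<le> c * measure \<mu> ((- P) \<inter> ?I)"
          by (simp add: algebra_simps)
        then have "measure m1 ?I \<le> c / (c' - c) * measure m2 ?I"
          using c' by (simp add: mm field_simps)
        then show "\<exists>r. 0 < r \<and> r < e \<and> measure m1 {t - r..t + r} \<le> c / (c' - c) * measure m2 {t - r..t + r}"
          using r by blast
      qed
      then show ?thesis by (simp add: mm measure_le_0_iff)
    qed
    have "measure \<nu> P \<le> 2 * c * measure \<mu> P"
      by (rule measure_le_twice_of_intervals[OF nu mu P c]) (use small in \<open>auto simp: P_def\<close>)
    then have nuP: "measure \<nu> P = 0" using muP by (simp add: measure_le_0_iff)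
    have "measure \<nu> A = measure \<nu> P + measure \<nu> (A \<inter> Y)"
      using A Y by (subst nu.finite_measure_Union[symmetric]) (auto simp: nu P_def intro!: arg_cong[where f = "measure \<nu>"])
    also have "\<dots> \<le> c' * measure \<mu> (A \<inter> Y)"
      using Y1[of "A \<inter> Y"] A Y nuP c'0
      by (auto simp: lam.emeasure_eq_measure nu.emeasure_eq_measure meas_lam)
    also have "\<dots> \<le> c' * measure \<mu> A"
      using c'0 A by (intro mult_left_mono mu.finite_measure_mono) (auto simp: mu)
    finally show ?thesis .
  qed
  show ?thesis
  proof (rule field_le_epsilon)
    fix e :: real assume "e > 0"
    have "measure \<nu> A \<le> (c + e / (measure \<mu> A + 1)) * measure \<mu> A"
      using \<open>e > 0\<close> by (intro main) (simp add: add_nonneg_pos)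
    also have "\<dots> = c * measure \<mu> A + e * (measure \<mu> A / (measure \<mu> A + 1))"
      by (simp add: algebra_simps)
    also have "\<dots> \<le> c * measure \<mu> A + e * 1"
    proof -
      have "m / (m + 1) \<le> 1" if "0 \<le> m" for m :: real using that by simp
      from this[OF measure_nonneg] show ?thesis
        using \<open>e > 0\<close> by (intro add_left_mono mult_left_mono) simp_all
    qed
    finally show "measure \<nu> A \<le> c * measure \<mu> A + e" by simp
  qed
qed

text \<open>If \<open>D\<close> is the symmetric derivative of \<open>\<nu>\<close> with respect to \<open>\<mu>\<close> on \<open>A\<close>, the comparison on the level
  sets \<open>B k\<close>, where \<open>D\<close> varies by at most \<open>1 / m\<close>, bounds \<open>\<nu> A\<close> by the integral of \<open>D\<close>.\<close>

lemma measure_le_integral_symmetric_derivative: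
  fixes \<nu> \<mu> :: "real measure" and D :: "real \<Rightarrow> real"
  assumes nu: "finite_measure \<nu>" "sets \<nu> = sets borel"
    and mu: "finite_measure \<mu>" "sets \<mu> = sets borel"
    and D[measurable]: "D \<in> borel_measurable borel" and D01: "\<And>t. 0 \<le> D t" "\<And>t. D t \<le> 1"
    and A[measurable]: "A \<in> sets borel"
    and pos: "\<And>t r. t \<in> A \<Longrightarrow> 0 < r \<Longrightarrow> 0 < measure \<mu> {t - r..t + r}"
    and lim: "\<And>t. t \<in> A \<Longrightarrow>
      ((\<lambda>r. measure \<nu> {t - r..t + r} / measure \<mu> {t - r..t + r}) \<longlongrightarrow> D t) (at_right 0)"
  shows "measure \<nu> A \<le> (\<integral>t. D t * indicator A t \<partial>\<mu>)"
proof (rule field_le_epsilon)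
  interpret nu: finite_measure \<nu> by fact
  interpret mu: finite_measure \<mu> by fact
  note [measurable_cong] = nu(2) mu(2)
  fix e :: real assume e: "0 < e"
  obtain m :: nat where m: "measure \<mu> A / e < real m" using reals_Archimedean2 by blast
  have m0: "m > 0" using m e measure_nonneg[of \<mu> A] by (cases m) (auto simp: divide_less_0_iff)
  define B where "B k = {t\<in>A. nat \<lfloor>D t * m\<rfloor> = k}" for k
  have B[measurable]: "B k \<in> sets borel" for k unfolding B_def by measurable
  have k_le: "nat \<lfloor>D t * m\<rfloor> \<le> m" for t
  proof -
    have "D t * m \<le> m" using mult_right_mono[OF D01(2)[of t], of m] by simp
    then have "\<lfloor>D t * m\<rfloor> \<le> int m" by linarith
    then show ?thesis by simp
  qed
  have level: "real k / real m \<le> D t" "D t < (real k + 1) / real m" if "t \<in> B k" for t k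
  proof -
    have "int k = \<lfloor>D t * m\<rfloor>" using that D01(1)[of t] by (auto simp: B_def)
    then have "real k \<le> D t * m" "D t * m < real k + 1" by linarith+
    then show "real k / real m \<le> D t" "D t < (real k + 1) / real m" using m0 by (auto simp: field_simps)
  qed
  have le: "measure \<nu> (B k) \<le> (real k + 1) / real m * measure \<mu> (B k)" for k
  proof (rule measure_le_of_intervals[OF nu mu B])
    fix t e :: real assume t: "t \<in> B k" and e: "0 < e"
    then have tA: "t \<in> A" by (simp add: B_def)
    have "\<forall>\<^sub>F r in at_right 0. measure \<nu> {t - r..t + r} / measure \<mu> {t - r..t + r} < (real k + 1) / real m"
      using order_tendstoD(2)[OF lim[OF tA] level(2)[OF t]] .
    moreover have "\<forall>\<^sub>F r in at_right 0. r \<in> {0<..<e}"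
      using e by (rule eventually_at_right_real)
    ultimately have "\<forall>\<^sub>F r in at_right 0. r \<in> {0<..<e} \<and>
        measure \<nu> {t - r..t + r} / measure \<mu> {t - r..t + r} < (real k + 1) / real m"
      by eventually_elim auto
    then obtain r where "r \<in> {0<..<e}"
        "measure \<nu> {t - r..t + r} / measure \<mu> {t - r..t + r} < (real k + 1) / real m"
      using eventually_happens' trivial_limit_at_right_real by blast
    then show "\<exists>r. 0 < r \<and> r < e \<and> measure \<nu> {t - r..t + r} \<le> (real k + 1) / real m * measure \<mu> {t - r..t + r}"
      using pos[OF tA, of r] by (intro exI[of _ r]) (auto simp: divide_less_eq)
  qed simp
  have A_eq: "A = (\<Union>k\<in>{..m}. B k)" using k_le by (auto simp: B_def)
  \<comment> \<open>As \<open>D\<close> is at most 1, the level sets with \<open>k \<le> m\<close> exhaust \<open>A\<close>.\<close>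
  have "measure \<nu> A = (\<Sum>k\<le>m. measure \<nu> (B k))"
    unfolding A_eq by (rule nu.finite_measure_finite_Union) (auto simp: disjoint_family_on_def B_def nu)
  also have "\<dots> \<le> (\<Sum>k\<le>m. (real k + 1) / real m * measure \<mu> (B k))" by (intro sum_mono le)
  also have "\<dots> = (\<Sum>k\<le>m. \<integral>t. (real k + 1) / real m * indicator (B k) t \<partial>\<mu>)"
    by (simp add: sets_eq_imp_space_eq[OF mu(2)])
  also have "\<dots> = (\<integral>t. (\<Sum>k\<le>m. (real k + 1) / real m * indicator (B k) t) \<partial>\<mu>)"
    by (rule Bochner_Integration.integral_sum[symmetric])
      (intro integrable_mult_right, auto simp: mu mu.emeasure_eq_measure)
  also have "\<dots> \<le> (\<integral>t. D t * indicator A t + 1 / m * indicator A t \<partial>\<mu>)"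
  proof (rule integral_mono)
    show "integrable \<mu> (\<lambda>t. \<Sum>k\<le>m. (real k + 1) / real m * indicator (B k) t)"
      by (intro Bochner_Integration.integrable_sum integrable_mult_right)
        (auto simp: mu mu.emeasure_eq_measure)
    have "norm (D t * indicator A t + 1 / m * indicator A t) \<le> 2" for t
    proof -
      have "1 / real m \<le> 1" using m0 by simp
      then have "D t + 1 / real m \<le> 2" using D01(2)[of t] by linarith
      then show ?thesis using D01(1)[of t] by (auto simp: indicator_def)
    qed
    then show "integrable \<mu> (\<lambda>t. D t * indicator A t + 1 / m * indicator A t)"
      by (intro mu.integrable_const_bound[where B=2]) auto
    fix t
    show "(\<Sum>k\<le>m. (real k + 1) / real m * indicator (B k) t) \<le> D t * indicator A t + 1 / m * indicator A t"
    proof (cases "t \<in> A")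
      case True
      define k where "k = nat \<lfloor>D t * m\<rfloor>"
      have "(\<Sum>j\<le>m. (real j + 1) / real m * indicator (B j) t) = (\<Sum>j\<le>m. if j = k then (real k + 1) / real m else 0 :: real)"
        by (rule sum.cong) (auto simp: B_def k_def True)
      also have "\<dots> = (real k + 1) / real m" using k_le[of t] by (simp add: k_def)
      also have "\<dots> \<le> D t + 1 / m"
        using level(1)[of t k] True m0 by (auto simp: B_def k_def add_divide_distrib)
      finally show ?thesis using True by simp
    qed (auto simp: B_def)
  qed
  also have "\<dots> = (\<integral>t. D t * indicator A t \<partial>\<mu>) + (\<integral>t. 1 / m * indicator A t \<partial>\<mu>)"
  proof (rule Bochner_Integration.integral_add)
    show "integrable \<mu> (\<lambda>t. D t * indicator A t)"
      using D01 by (intro mu.integrable_const_bound[where B=1]) (auto simp: indicator_def)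
  qed (auto simp: mu mu.emeasure_eq_measure)
  also have "(\<integral>t. 1 / m * indicator A t \<partial>\<mu>) = measure \<mu> A / m"
    by (simp add: sets_eq_imp_space_eq[OF mu(2)])
  also have "\<dots> \<le> e" using m m0 e by (simp add: field_simps)
  finally show "measure \<nu> A \<le> (\<integral>t. D t * indicator A t \<partial>\<mu>) + e" by simp
qed

section \<open>Conditional probabilities given a random variable as densities\<close>


context prob_space
begin

lemma closed_rv_support:
  assumes [measurable]: "Y \<in> borel_measurable M"
  shows "closed (rv_support M Y)"
  unfolding closed_def open_dist
proof
  fix t assume "t \<in> - rv_support M Y"
  then obtain d where d: "d > 0" "\<P>(\<omega> in M. Y \<omega> \<in> {t - d..t + d}) = 0"
    by (auto simp: rv_support_def not_less measure_le_0_iff)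
  have "s \<notin> rv_support M Y" if "dist s t < d / 2" for s
  proof
    assume "s \<in> rv_support M Y"
    then have "0 < \<P>(\<omega> in M. Y \<omega> \<in> {s - d / 2..s + d / 2})"
      unfolding rv_support_def using d(1) by (auto dest!: spec[of _ "d / 2"])
    also have "\<dots> \<le> \<P>(\<omega> in M. Y \<omega> \<in> {t - d..t + d})"
    proof -
      have "s - t < d / 2" "t - s < d / 2" using that unfolding dist_real_def by linarith+
      then have "t - d \<le> y \<and> y \<le> t + d" if "y \<in> {s - d / 2..s + d / 2}" for y using that by auto
      then show ?thesis by (intro finite_measure_mono) auto
    qed
    finally show False using d(2) by simp
  qed
  then show "\<exists>e>0. \<forall>s. dist s t < e \<longrightarrow> s \<in> - rv_support M Y"
    using d(1) by (intro exI[of _ "d / 2"]) auto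
qed

lemma measure_distr_restricted:
  assumes [measurable]: "Y \<in> borel_measurable M" "Measurable.pred M P" "A \<in> sets borel"
  shows "measure (distr (density M (indicator {\<omega>\<in>space M. P \<omega>})) borel Y) A = \<P>(\<omega> in M. P \<omega> \<and> Y \<omega> \<in> A)"
proof -
  let ?E = "{\<omega>\<in>space M. P \<omega>}"
  have E: "?E \<in> events" by measurable
  have "measure (distr (density M (indicator ?E)) borel Y) A = measure (density M (indicator ?E)) (Y -` A \<inter> space M)"
    by (subst measure_distr) auto
  also have "\<dots> = measure M (?E \<inter> (Y -` A \<inter> space M))"
    by (rule measure_restricted) (use E in auto)
  also have "?E \<inter> (Y -` A \<inter> space M) = {\<omega> \<in> space M. P \<omega> \<and> Y \<omega> \<in> A}" by auto
  finally show ?thesis .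
qed

text \<open>Outside the support arbitrarily small intervals are null sets, so that the comparison
  applies with the constant 0.\<close>

lemma AE_in_rv_support:
  assumes [measurable]: "Y \<in> borel_measurable M"
  shows "AE \<omega> in M. Y \<omega> \<in> rv_support M Y"
proof -
  have fin: "finite_measure (distr M borel Y)"
    by (intro prob_space.finite_measure prob_space_distr assms)
  have S[measurable]: "rv_support M Y \<in> sets borel"
    by (intro borel_closed closed_rv_support assms)
  have meas: "measure (distr M borel Y) A = \<P>(\<omega> in M. Y \<omega> \<in> A)" if "A \<in> sets borel" for A
    using that by (subst measure_distr) (auto intro!: arg_cong[where f = prob])
  have "measure (distr M borel Y) (- rv_support M Y) \<le> 0 * measure (distr M borel Y) (- rv_support M Y)"
  proof (rule measure_le_of_intervals[OF fin _ fin])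
    fix t e :: real assume "t \<in> - rv_support M Y" "0 < e"
    then obtain d where d: "d > 0" "\<P>(\<omega> in M. Y \<omega> \<in> {t - d..t + d}) = 0"
      by (auto simp: rv_support_def not_less measure_le_0_iff)
    define r where "r = min d (e / 2)"
    have "\<P>(\<omega> in M. Y \<omega> \<in> {t - r..t + r}) \<le> \<P>(\<omega> in M. Y \<omega> \<in> {t - d..t + d})"
      by (intro finite_measure_mono) (auto simp: r_def)
    then have "measure (distr M borel Y) {t - r..t + r} \<le> 0" using d(2) by (simp add: meas)
    then show "\<exists>r. 0 < r \<and> r < e \<and> measure (distr M borel Y) {t - r..t + r} \<le> 0 * measure (distr M borel Y) {t - r..t + r}"
      using d(1) \<open>0 < e\<close> by (intro exI[of _ r]) (auto simp: r_def)
  qed auto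
  then have "\<P>(\<omega> in M. Y \<omega> \<notin> rv_support M Y) = 0" by (simp add: meas measure_le_0_iff)
  then show ?thesis by (simp add: prob_eq_0)
qed

lemma prob_le_integral_conditional:
  fixes D :: "real \<Rightarrow> real"
  assumes Y[measurable]: "Y \<in> borel_measurable M" and P[measurable]: "Measurable.pred M P"
    and D[measurable]: "D \<in> borel_measurable borel" and D01: "\<And>t. 0 \<le> D t" "\<And>t. D t \<le> 1"
    and lim: "\<And>t. t \<in> rv_support M Y \<Longrightarrow>
      ((\<lambda>r. \<P>(\<omega> in M. P \<omega> \<bar> window Y t r \<omega>)) \<longlongrightarrow> D t) (at_right 0)"
    and A[measurable]: "A \<in> sets borel"
  shows "\<P>(\<omega> in M. P \<omega> \<and> Y \<omega> \<in> A) \<le> (\<integral>\<omega>. D (Y \<omega>) * indicator A (Y \<omega>) \<partial>M)"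
proof -
  define S where "S = rv_support M Y"
  define \<mu> where "\<mu> = distr M borel Y"
  define \<nu> where "\<nu> = distr (density M (indicator {\<omega>\<in>space M. P \<omega>})) borel Y"
  have S[measurable]: "S \<in> sets borel"
    unfolding S_def by (intro borel_closed closed_rv_support assms)
  have AES: "AE \<omega> in M. Y \<omega> \<in> S" unfolding S_def by (rule AE_in_rv_support) fact
  have mu: "finite_measure \<mu>" "sets \<mu> = sets borel"
    unfolding \<mu>_def by (auto intro!: prob_space.finite_measure prob_space_distr)
  have nu: "finite_measure \<nu>" "sets \<nu> = sets borel"
    unfolding \<nu>_def by (auto intro!: finite_measure.finite_measure_distr finite_measure_restricted)
  have meas_mu: "measure \<mu> B = \<P>(\<omega> in M. Y \<omega> \<in> B)" if "B \<in> sets borel" for B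
    using that unfolding \<mu>_def by (subst measure_distr) (auto intro!: arg_cong[where f = prob])
  have meas_nu: "measure \<nu> B = \<P>(\<omega> in M. P \<omega> \<and> Y \<omega> \<in> B)" if "B \<in> sets borel" for B
    unfolding \<nu>_def by (rule measure_distr_restricted) (use that in measurable)
  have "\<P>(\<omega> in M. P \<omega> \<and> Y \<omega> \<in> A) = \<P>(\<omega> in M. P \<omega> \<and> Y \<omega> \<in> A \<inter> S)"
    using AES by (intro finite_measure_eq_AE) auto
  also have "\<dots> = measure \<nu> (A \<inter> S)" by (simp add: meas_nu)
  also have "\<dots> \<le> (\<integral>t. D t * indicator (A \<inter> S) t \<partial>\<mu>)"
  proof (rule measure_le_integral_symmetric_derivative[OF nu mu D D01])
    fix t assume t: "t \<in> A \<inter> S"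
    show "0 < measure \<mu> {t - r..t + r}" if "0 < r" for r
      using t that by (simp add: meas_mu S_def rv_support_def)
    have "\<P>(\<omega> in M. P \<omega> \<bar> window Y t r \<omega>) = measure \<nu> {t - r..t + r} / measure \<mu> {t - r..t + r}" for r
      by (simp add: meas_mu meas_nu cond_prob_def window_def)
    then show "((\<lambda>r. measure \<nu> {t - r..t + r} / measure \<mu> {t - r..t + r}) \<longlongrightarrow> D t) (at_right 0)"
      using lim[of t] t by (simp add: S_def)
  qed auto
  also have "\<dots> = (\<integral>\<omega>. D (Y \<omega>) * indicator (A \<inter> S) (Y \<omega>) \<partial>M)"
    unfolding \<mu>_def by (rule integral_distr) measurable
  also have "\<dots> = (\<integral>\<omega>. D (Y \<omega>) * indicator A (Y \<omega>) \<partial>M)"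
    using AES by (intro integral_cong_AE) (auto simp: indicator_def)
  finally show ?thesis .
qed

text \<open>The conditional probabilities given \<open>Y = t\<close>, defined as limits over windows at the points of
  the support only, disintegrate the probability. The inequality for \<open>P\<close> is
  \<open>prob_le_integral_conditional\<close>; the reverse one is the same inequality for the complementary event.\<close>

lemma prob_eq_integral_conditional:
  fixes D :: "real \<Rightarrow> real"
  assumes Y[measurable]: "Y \<in> borel_measurable M" and P[measurable]: "Measurable.pred M P"
    and D[measurable]: "D \<in> borel_measurable borel" and D01: "\<And>t. 0 \<le> D t" "\<And>t. D t \<le> 1"
    and lim: "\<And>t. t \<in> rv_support M Y \<Longrightarrow>
      ((\<lambda>r. \<P>(\<omega> in M. P \<omega> \<bar> window Y t r \<omega>)) \<longlongrightarrow> D t) (at_right 0)"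
    and A[measurable]: "A \<in> sets borel"
  shows "\<P>(\<omega> in M. P \<omega> \<and> Y \<omega> \<in> A) = (\<integral>\<omega>. D (Y \<omega>) * indicator A (Y \<omega>) \<partial>M)"
proof (rule antisym)
  show "\<P>(\<omega> in M. P \<omega> \<and> Y \<omega> \<in> A) \<le> (\<integral>\<omega>. D (Y \<omega>) * indicator A (Y \<omega>) \<partial>M)"
    by (rule prob_le_integral_conditional) (use assms in auto)
  have "\<P>(\<omega> in M. \<not> P \<omega> \<and> Y \<omega> \<in> A) \<le> (\<integral>\<omega>. (1 - D (Y \<omega>)) * indicator A (Y \<omega>) \<partial>M)"
  proof (rule prob_le_integral_conditional[where D = "\<lambda>t. 1 - D t"])
    fix t assume t: "t \<in> rv_support M Y"
    have "\<P>(\<omega> in M. \<not> P \<omega> \<bar> window Y t r \<omega>) = 1 - \<P>(\<omega> in M. P \<omega> \<bar> window Y t r \<omega>)" if "0 < r" for r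
    proof -
      have [measurable]: "Measurable.pred M (window Y t r)" unfolding window_def by measurable
      have "0 < \<P>(\<omega> in M. window Y t r \<omega>)" using t that by (simp add: rv_support_def window_def)
      moreover have "\<P>(\<omega> in M. window Y t r \<omega>) =
          \<P>(\<omega> in M. P \<omega> \<and> window Y t r \<omega>) + \<P>(\<omega> in M. \<not> P \<omega> \<and> window Y t r \<omega>)"
        by (subst finite_measure_Union[symmetric]) (auto intro!: arg_cong[where f = prob])
      ultimately show ?thesis by (simp add: cond_prob_def field_simps)
    qed
    then have "\<forall>\<^sub>F r in at_right 0. 1 - \<P>(\<omega> in M. P \<omega> \<bar> window Y t r \<omega>) = \<P>(\<omega> in M. \<not> P \<omega> \<bar> window Y t r \<omega>)"
      by (auto simp: eventually_at_filter)
    moreover have "((\<lambda>r. 1 - \<P>(\<omega> in M. P \<omega> \<bar> window Y t r \<omega>)) \<longlongrightarrow> 1 - D t) (at_right 0)"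
      by (intro tendsto_intros lim t)
    ultimately show "((\<lambda>r. \<P>(\<omega> in M. \<not> P \<omega> \<bar> window Y t r \<omega>)) \<longlongrightarrow> 1 - D t) (at_right 0)"
      by (rule Lim_transform_eventually[rotated])
  qed (use D01 in auto)
  also have "\<dots> = (\<integral>\<omega>. indicator A (Y \<omega>) - D (Y \<omega>) * indicator A (Y \<omega>) \<partial>M)"
    by (simp add: algebra_simps)
  also have "\<dots> = (\<integral>\<omega>. indicator A (Y \<omega>) \<partial>M) - (\<integral>\<omega>. D (Y \<omega>) * indicator A (Y \<omega>) \<partial>M)"
    using D01 by (intro Bochner_Integration.integral_diff integrable_const_bound[where B=1])
      (auto simp: indicator_def)
  also have "(\<integral>\<omega>. indicator A (Y \<omega>) \<partial>M) = (\<integral>\<omega>. indicator {\<omega>\<in>space M. Y \<omega> \<in> A} \<omega> \<partial>M)"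
    by (intro Bochner_Integration.integral_cong) (auto simp: indicator_def)
  also have "\<dots> = \<P>(\<omega> in M. Y \<omega> \<in> A)" by (simp add: Int_def conj_commute cong: conj_cong)
  also have "\<dots> = \<P>(\<omega> in M. P \<omega> \<and> Y \<omega> \<in> A) + \<P>(\<omega> in M. \<not> P \<omega> \<and> Y \<omega> \<in> A)"
    by (subst finite_measure_Union[symmetric]) (auto intro!: arg_cong[where f = prob])
  finally show "(\<integral>\<omega>. D (Y \<omega>) * indicator A (Y \<omega>) \<partial>M) \<le> \<P>(\<omega> in M. P \<omega> \<and> Y \<omega> \<in> A)" by simp
qed

text \<open>The probability of a window is a difference of two monotone functions of its centre.\<close>

lemma borel_measurable_prob_window:
  assumes [measurable]: "Y \<in> borel_measurable M" "Measurable.pred M P"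
  shows "(\<lambda>t. \<P>(\<omega> in M. P \<omega> \<and> window Y t r \<omega>)) \<in> borel_measurable borel"
proof -
  have "mono (\<lambda>s. \<P>(\<omega> in M. P \<omega> \<and> Y \<omega> \<le> s))" "mono (\<lambda>s. \<P>(\<omega> in M. P \<omega> \<and> Y \<omega> < s))"
    by (auto simp: mono_def intro!: finite_measure_mono)
  note [measurable] = this[THEN borel_measurable_mono]
  have "\<P>(\<omega> in M. P \<omega> \<and> window Y t r \<omega>) = (if 0 \<le> r then
      \<P>(\<omega> in M. P \<omega> \<and> Y \<omega> \<le> t + r) - \<P>(\<omega> in M. P \<omega> \<and> Y \<omega> < t - r) else 0)" for t
  proof (cases "0 \<le> r")
    case True
    then have "{\<omega>\<in>space M. P \<omega> \<and> window Y t r \<omega>} =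
        {\<omega>\<in>space M. P \<omega> \<and> Y \<omega> \<le> t + r} - {\<omega>\<in>space M. P \<omega> \<and> Y \<omega> < t - r}"
      by (auto simp: window_def)
    also have "prob \<dots> = \<P>(\<omega> in M. P \<omega> \<and> Y \<omega> \<le> t + r) - \<P>(\<omega> in M. P \<omega> \<and> Y \<omega> < t - r)"
      using True by (intro finite_measure_Diff) auto
    finally show ?thesis using True by simp
  qed (auto simp: window_def)
  then show ?thesis by simp
qed

text \<open>Where the conditional probability is defined it depends measurably on the value of \<open>Y\<close>.\<close>

lemma borel_measurable_lim_cond_prob:
  fixes D :: "real \<Rightarrow> real"
  assumes Y[measurable]: "Y \<in> borel_measurable M" and P[measurable]: "Measurable.pred M P"
    and def: "\<And>t. t \<in> rv_support M Y \<Longrightarrow> lim_cond_prob_defined M P (window Y t)"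
  defines "D \<equiv> \<lambda>t. indicator (rv_support M Y) t * lim_cond_prob M P (window Y t)"
  shows "D \<in> borel_measurable borel" and "0 \<le> D t" and "D t \<le> 1"
    and "t \<in> rv_support M Y \<Longrightarrow> ((\<lambda>r. \<P>(\<omega> in M. P \<omega> \<bar> window Y t r \<omega>)) \<longlongrightarrow> D t) (at_right 0)"
proof -
  have [measurable]: "rv_support M Y \<in> sets borel"
    by (intro borel_closed closed_rv_support assms)
  have lim: "((\<lambda>r. \<P>(\<omega> in M. P \<omega> \<bar> window Y t r \<omega>)) \<longlongrightarrow> D t) (at_right 0)"
    if "t \<in> rv_support M Y" for t
  proof -
    have "lim_cond_prob_defined M P (window Y t)" using def that by blast
    then obtain l where "((\<lambda>r. \<P>(\<omega> in M. P \<omega> \<bar> window Y t r \<omega>)) \<longlongrightarrow> l) (at_right 0)"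
      unfolding lim_cond_prob_defined_def by blast
    then show ?thesis using that unfolding D_def lim_cond_prob_def by (auto simp: tendsto_Lim[OF trivial_limit_at_right_real])
  qed
  from lim show "t \<in> rv_support M Y \<Longrightarrow> ((\<lambda>r. \<P>(\<omega> in M. P \<omega> \<bar> window Y t r \<omega>)) \<longlongrightarrow> D t) (at_right 0)" .
  have "\<P>(\<omega> in M. P \<omega> \<bar> Q \<omega>) \<ge> 0 \<and> \<P>(\<omega> in M. P \<omega> \<bar> Q \<omega>) \<le> 1"
    if [measurable]: "Measurable.pred M Q" for Q
    unfolding cond_prob_def by (auto intro!: finite_measure_mono simp: divide_le_eq_1 zero_less_measure_iff)
  then have 01: "\<P>(\<omega> in M. P \<omega> \<bar> window Y t r \<omega>) \<in> {0..1}" for t r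
    by (simp add: window_def)
  have "D t \<in> {0..1}" if "t \<in> rv_support M Y" for t
    by (rule Lim_in_closed_set[OF closed_atLeastAtMost _ _ lim[OF that]]) (use 01 in auto)
  then show "0 \<le> D t" "D t \<le> 1"
    by (cases "t \<in> rv_support M Y", auto simp: D_def)+
  have [measurable]: "(\<lambda>t. \<P>(\<omega> in M. window Y t r \<omega>)) \<in> borel_measurable borel" for r
    using borel_measurable_prob_window[OF Y, of "\<lambda>_. True" r] by simp
  note [measurable] = borel_measurable_prob_window[OF Y P]
  show "D \<in> borel_measurable borel"
  proof (rule borel_measurable_LIMSEQ_real)
    fix t
    have seq: "filterlim (\<lambda>i. 1 / real (Suc i)) (at_right 0) sequentially"
      by (rule tendsto_imp_filterlim_at_right[OF LIMSEQ_Suc[OF lim_1_over_n]]) auto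
    show "(\<lambda>i. indicator (rv_support M Y) t * \<P>(\<omega> in M. P \<omega> \<bar> window Y t (1 / real (Suc i)) \<omega>))
        \<longlonglongrightarrow> D t"
      using filterlim_compose[OF lim[of t] seq] by (cases "t \<in> rv_support M Y") (auto simp: D_def)
  qed (auto simp: cond_prob_def)
qed

text \<open>The function \<open>k\<close> is \<open>h\<close> restricted to the support of \<open>\<Theta>\<close>. It is measurable as a limit of
  the normalised conditional tails, and it is bounded because one of these, a probability
  divided by \<open>P[X > x]\<close>, is uniformly comparable to it.\<close>

lemma uniform_conditional_density:
  fixes X \<Theta> :: "'a \<Rightarrow> real" and h :: "real \<Rightarrow> real"
  assumes X[measurable]: "X \<in> borel_measurable M" and \<Theta>[measurable]: "\<Theta> \<in> borel_measurable M"
    and pos: "\<And>x. 0 < \<P>(\<omega> in M. X \<omega> > x)"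
    and nonneg: "AE \<omega> in M. \<Theta> \<omega> \<ge> 0" and h_pos: "\<And>t. t \<ge> 0 \<Longrightarrow> h t > 0"
    and def: "\<forall>\<^sub>F x in at_top. \<forall>t \<in> rv_support M \<Theta>.
        lim_cond_prob_defined M (\<lambda>\<omega>. X \<omega> > x) (window \<Theta> t)"
    and asymp: "unif_asymp_equiv at_top (rv_support M \<Theta>)
        (\<lambda>x t. lim_cond_prob M (\<lambda>\<omega>. X \<omega> > x) (window \<Theta> t))
        (\<lambda>x t. h t * \<P>(\<omega> in M. X \<omega> > x))"
  obtains k C where "k \<in> borel_measurable borel" "\<And>t. 0 \<le> k t" "\<And>t. k t \<le> C"
    "AE \<omega> in M. k (\<Theta> \<omega>) = h (\<Theta> \<omega>)"
    "\<And>e. 0 < e \<Longrightarrow> \<forall>\<^sub>F x in at_top. \<forall>A\<in>sets borel.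
      \<bar>\<P>(\<omega> in M. X \<omega> > x \<and> \<Theta> \<omega> \<in> A) - \<P>(\<omega> in M. X \<omega> > x) * (\<integral>\<omega>. k (\<Theta> \<omega>) * indicator A (\<Theta> \<omega>) \<partial>M)\<bar>
        \<le> e * (\<P>(\<omega> in M. X \<omega> > x) * (\<integral>\<omega>. k (\<Theta> \<omega>) * indicator A (\<Theta> \<omega>) \<partial>M))"
proof -
  define S where "S = rv_support M \<Theta>"
  define G where "G x = \<P>(\<omega> in M. X \<omega> > x)" for x
  define D where "D x = (\<lambda>t. indicator S t * lim_cond_prob M (\<lambda>\<omega>. X \<omega> > x) (window \<Theta> t))" for x
  define k where "k = (\<lambda>t. indicator S t * h t)"
  have Gpos: "G x > 0" for x unfolding G_def by (rule pos)
  have S[measurable]: "S \<in> sets borel"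
    unfolding S_def by (intro borel_closed closed_rv_support \<Theta>)
  have S_nonneg: "0 \<le> t" if "t \<in> S" for t
  proof (rule ccontr)
    assume t: "\<not> 0 \<le> t"
    have "\<P>(\<omega> in M. \<Theta> \<omega> \<in> {t - - t / 2..t + - t / 2}) = 0"
      using nonneg t by (subst prob_eq_0) auto
    then show False using that t unfolding S_def rv_support_def by (auto dest!: spec[of _ "- t / 2"])
  qed
  have hS: "h t > 0" if "t \<in> S" for t using h_pos S_nonneg that by blast
  obtain x1 where x1: "\<And>x t. x \<ge> x1 \<Longrightarrow> t \<in> S \<Longrightarrow> lim_cond_prob_defined M (\<lambda>\<omega>. X \<omega> > x) (window \<Theta> t)"
    using def unfolding eventually_at_top_linorder S_def by auto
  have D[measurable]: "D x \<in> borel_measurable borel" and D01: "0 \<le> D x t" "D x t \<le> 1"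
    and D_lim: "t \<in> S \<Longrightarrow> ((\<lambda>r. \<P>(\<omega> in M. X \<omega> > x \<bar> window \<Theta> t r \<omega>)) \<longlongrightarrow> D x t) (at_right 0)"
    if "x \<ge> x1" for x t
    unfolding D_def S_def
    by (rule borel_measurable_lim_cond_prob; use x1[OF that] in \<open>simp add: S_def\<close>)+
  have close: "\<forall>\<^sub>F x in at_top. \<forall>t. \<bar>D x t - k t * G x\<bar> \<le> e * (k t * G x)" if "e > 0" for e
  proof -
    have "\<forall>\<^sub>F x in at_top. \<forall>t\<in>S. dist (lim_cond_prob M (\<lambda>\<omega>. X \<omega> > x) (window \<Theta> t) / (h t * G x)) 1 < e"
      using asymp that unfolding unif_asymp_equiv_def uniform_limit_iff S_def G_def by blast
    then show ?thesis
    proof eventually_elim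
      case (elim x)
      have "\<bar>D x t - k t * G x\<bar> \<le> e * (k t * G x)" if t: "t \<in> S" for t
      proof -
        let ?d = "lim_cond_prob M (\<lambda>\<omega>. X \<omega> > x) (window \<Theta> t)"
        have hG: "h t * G x > 0" using hS[OF t] Gpos by simp
        have "\<bar>?d / (h t * G x) - 1\<bar> < e" using elim t by (simp add: dist_real_def)
        moreover have "?d / (h t * G x) - 1 = (?d - h t * G x) / (h t * G x)"
          using hS[OF t] Gpos[of x] by (simp add: diff_divide_distrib)
        ultimately have "\<bar>?d - h t * G x\<bar> / (h t * G x) < e"
          using hG by (simp add: abs_divide)
        then have "\<bar>?d - h t * G x\<bar> < e * (h t * G x)" using hG by (simp add: pos_divide_less_eq)
        then show ?thesis using t by (simp add: D_def k_def)
      qed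
      then show ?case by (auto simp: D_def k_def indicator_def)
    qed
  qed
  have k_nonneg: "0 \<le> k t" for t using hS[of t] by (auto simp: k_def indicator_def)
  have AES: "AE \<omega> in M. \<Theta> \<omega> \<in> S" unfolding S_def by (rule AE_in_rv_support) fact
  have k[measurable]: "k \<in> borel_measurable borel"
  proof (rule borel_measurable_LIMSEQ_real)
    show "(\<lambda>t. D (x1 + real i) t / G (x1 + real i)) \<in> borel_measurable borel" for i by measurable
    fix t
    have "((\<lambda>x. D x t / G x) \<longlongrightarrow> k t) at_top"
    proof (rule tendstoI)
      fix e :: real assume e: "e > 0"
      define e' where "e' = e / (k t + 1)"
      have e': "e' > 0" "e' * k t < e"
        using e k_nonneg[of t] by (auto simp: e'_def divide_less_eq add_nonneg_pos intro!: mult_strict_left_mono)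
      show "\<forall>\<^sub>F x in at_top. dist (D x t / G x) (k t) < e"
        using close[OF e'(1)]
      proof eventually_elim
        case (elim x)
        have "D x t / G x - k t = (D x t - k t * G x) / G x" using Gpos[of x] by (simp add: field_simps)
        then have "dist (D x t / G x) (k t) = \<bar>D x t - k t * G x\<bar> / G x"
          using Gpos[of x] by (simp add: dist_real_def abs_divide)
        also have "\<dots> \<le> e' * (k t * G x) / G x" using elim Gpos[of x] by (intro divide_right_mono) auto
        also have "\<dots> = e' * k t" using Gpos[of x] by simp
        finally show ?case using e' by simp
      qed
    qed
    moreover have "filterlim (\<lambda>i. x1 + real i) at_top sequentially"
      by (intro filterlim_tendsto_add_at_top[OF tendsto_const] filterlim_real_sequentially)
    ultimately show "(\<lambda>i. D (x1 + real i) t / G (x1 + real i)) \<longlonglongrightarrow> k t"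
      by (rule filterlim_compose)
  qed
  have "\<forall>\<^sub>F x in at_top. (\<forall>t. \<bar>D x t - k t * G x\<bar> \<le> 1 / 2 * (k t * G x)) \<and> x \<ge> x1"
    using eventually_conj[OF close[of "1/2"] eventually_ge_at_top[of x1]] by simp
  then obtain x2 where x2: "\<And>t. \<bar>D x2 t - k t * G x2\<bar> \<le> 1 / 2 * (k t * G x2)" "x2 \<ge> x1"
    using eventually_happens'[OF trivial_limit_at_top_linorder] by blast
  have k_le: "k t \<le> 2 / G x2" for t
  proof -
    have "k t * G x2 \<le> 2" using x2(1)[of t] D01(2)[OF x2(2), of t] by linarith
    then show ?thesis using Gpos[of x2] by (simp add: pos_le_divide_eq)
  qed
  show thesis
  proof (rule that[OF k k_nonneg k_le])
    show "AE \<omega> in M. k (\<Theta> \<omega>) = h (\<Theta> \<omega>)" using AES by (auto simp: k_def)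
    fix e :: real assume e: "0 < e"
    have int_k: "integrable M (\<lambda>\<omega>. k (\<Theta> \<omega>) * indicator A (\<Theta> \<omega>))" if [measurable]: "A \<in> sets borel" for A
      using k_nonneg k_le Gpos[of x2]
      by (intro integrable_const_bound[where B = "2 / G x2"]) (auto simp: indicator_def)
    show "\<forall>\<^sub>F x in at_top. \<forall>A\<in>sets borel.
      \<bar>\<P>(\<omega> in M. X \<omega> > x \<and> \<Theta> \<omega> \<in> A) - \<P>(\<omega> in M. X \<omega> > x) * (\<integral>\<omega>. k (\<Theta> \<omega>) * indicator A (\<Theta> \<omega>) \<partial>M)\<bar>
        \<le> e * (\<P>(\<omega> in M. X \<omega> > x) * (\<integral>\<omega>. k (\<Theta> \<omega>) * indicator A (\<Theta> \<omega>) \<partial>M))"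
      using close[OF e] eventually_ge_at_top[of x1] unfolding G_def[symmetric]
    proof eventually_elim
      case (elim x)
      show ?case
      proof
        fix A :: "real set" assume A[measurable]: "A \<in> sets borel"
        note [measurable] = D[OF elim(2)]
        have int_D: "integrable M (\<lambda>\<omega>. D x (\<Theta> \<omega>) * indicator A (\<Theta> \<omega>))"
          using D01[OF elim(2)] by (intro integrable_const_bound[where B = 1]) (auto simp: indicator_def)
        have int_kG: "integrable M (\<lambda>\<omega>. c * (k (\<Theta> \<omega>) * indicator A (\<Theta> \<omega>)))" for c
          by (intro integrable_mult_right int_k A)
        have "\<P>(\<omega> in M. X \<omega> > x \<and> \<Theta> \<omega> \<in> A) = (\<integral>\<omega>. D x (\<Theta> \<omega>) * indicator A (\<Theta> \<omega>) \<partial>M)"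
          by (rule prob_eq_integral_conditional) (use D01[OF elim(2)] D_lim[OF elim(2)] in \<open>auto simp: S_def\<close>)
        moreover have "G x * (\<integral>\<omega>. k (\<Theta> \<omega>) * indicator A (\<Theta> \<omega>) \<partial>M) =
            (\<integral>\<omega>. G x * (k (\<Theta> \<omega>) * indicator A (\<Theta> \<omega>)) \<partial>M)" by simp
        ultimately have "\<bar>\<P>(\<omega> in M. X \<omega> > x \<and> \<Theta> \<omega> \<in> A) - G x * (\<integral>\<omega>. k (\<Theta> \<omega>) * indicator A (\<Theta> \<omega>) \<partial>M)\<bar>
            = \<bar>\<integral>\<omega>. D x (\<Theta> \<omega>) * indicator A (\<Theta> \<omega>) - G x * (k (\<Theta> \<omega>) * indicator A (\<Theta> \<omega>)) \<partial>M\<bar>"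
          by (simp only: Bochner_Integration.integral_diff[OF int_D int_kG])
        also have "\<dots> \<le> (\<integral>\<omega>. \<bar>D x (\<Theta> \<omega>) * indicator A (\<Theta> \<omega>) - G x * (k (\<Theta> \<omega>) * indicator A (\<Theta> \<omega>))\<bar> \<partial>M)"
          by (rule integral_abs_bound)
        also have "\<dots> \<le> (\<integral>\<omega>. e * G x * (k (\<Theta> \<omega>) * indicator A (\<Theta> \<omega>)) \<partial>M)"
        proof (rule integral_mono)
          fix \<omega>
          show "\<bar>D x (\<Theta> \<omega>) * indicator A (\<Theta> \<omega>) - G x * (k (\<Theta> \<omega>) * indicator A (\<Theta> \<omega>))\<bar>
              \<le> e * G x * (k (\<Theta> \<omega>) * indicator A (\<Theta> \<omega>))"
            using elim(1)[rule_format, of "\<Theta> \<omega>"] by (auto simp: indicator_def mult_ac)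
        qed (intro integrable_abs Bochner_Integration.integrable_diff int_D int_kG)+
        also have "\<dots> = e * (G x * (\<integral>\<omega>. k (\<Theta> \<omega>) * indicator A (\<Theta> \<omega>) \<partial>M))" by simp
        finally show "\<bar>\<P>(\<omega> in M. X \<omega> > x \<and> \<Theta> \<omega> \<in> A) - G x * (\<integral>\<omega>. k (\<Theta> \<omega>) * indicator A (\<Theta> \<omega>) \<partial>M)\<bar>
          \<le> e * (G x * (\<integral>\<omega>. k (\<Theta> \<omega>) * indicator A (\<Theta> \<omega>) \<partial>M))" .
      qed
    qed
  qed
qed

end

lemma (in prob_space) prob_gt_eq_cdf:
  assumes [measurable]: "X \<in> borel_measurable M"
  shows "\<P>(\<omega> in M. X \<omega> > x) = 1 - cdf (distr M borel X) x"
proof -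
  have "cdf (distr M borel X) x = \<P>(\<omega> in M. X \<omega> \<le> x)"
    by (auto simp: cdf_def measure_distr intro!: arg_cong[where f = prob])
  also have "\<dots> = 1 - \<P>(\<omega> in M. X \<omega> > x)"
    by (subst prob_neg[symmetric]) (auto simp: not_less)
  finally show ?thesis by simp
qed

lemma (in prob_space) tail_cdf_distr:
  assumes "X \<in> borel_measurable M"
  shows "tail (cdf (distr M borel X)) x = \<P>(\<omega> in M. X \<omega> > x)"
  by (simp add: tail_def prob_gt_eq_cdf[OF assms])

section \<open>Products with a bounded weight\<close>

text \<open>The cell of the grid of mesh \<open>1 / m\<close> that contains \<open>t > 0\<close> has the left endpoint
  \<open>k / m\<close> with \<open>k = \<lceil>t * m\<rceil> - 1\<close>. Cells are open on the left, and the lowest one, \<open>k = 0\<close>, is left out.\<close>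

lemma grid_sum:
  fixes t B :: real and q :: "nat \<Rightarrow> real"
  assumes "0 \<le> t" "t \<le> B" "m > 0"
  shows "(\<Sum>k\<in>{1..nat \<lfloor>B * real m\<rfloor>}. indicator {real k / real m<..(real k + 1) / real m} t * q k) =
    (if nat (\<lceil>t * real m\<rceil> - 1) = 0 then 0 else q (nat (\<lceil>t * real m\<rceil> - 1)))"
proof -
  define k0 where "k0 = nat (\<lceil>t * real m\<rceil> - 1)"
  have iff: "t \<in> {real k / real m<..(real k + 1) / real m} \<longleftrightarrow> k = k0" if "k \<ge> 1" for k
  proof -
    have "t \<in> {real k / real m<..(real k + 1) / real m} \<longleftrightarrow> real k < t * real m \<and> t * real m \<le> real k + 1"
      using assms(3) by (auto simp: field_simps)
    also have "\<dots> \<longleftrightarrow> \<lceil>t * real m\<rceil> = int k + 1" unfolding ceiling_eq_iff by simp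
    also have "\<dots> \<longleftrightarrow> k = k0" using that unfolding k0_def by auto
    finally show ?thesis .
  qed
  have "k0 \<le> nat \<lfloor>B * real m\<rfloor>"
  proof -
    have "t * real m \<le> B * real m" using assms by (intro mult_right_mono) auto
    then have "\<lceil>t * real m\<rceil> - 1 \<le> \<lfloor>B * real m\<rfloor>" by linarith
    then show ?thesis unfolding k0_def by (rule nat_mono)
  qed
  moreover have "(\<Sum>k\<in>{1..nat \<lfloor>B * real m\<rfloor>}. indicator {real k / real m<..(real k + 1) / real m} t * q k) =
      (\<Sum>k\<in>{1..nat \<lfloor>B * real m\<rfloor>}. if k = k0 then q k0 else 0)"
    by (rule sum.cong) (use iff in \<open>auto simp: indicator_def\<close>)
  ultimately show ?thesis unfolding k0_def[symmetric] by (simp add: sum.delta)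
qed

lemma grid_below:
  fixes t :: real
  assumes "0 \<le> t"
  shows "(\<lambda>j. real (nat (\<lceil>t * real (Suc j)\<rceil> - 1)) / real (Suc j)) \<longlonglongrightarrow> t"
    and "real (nat (\<lceil>t * real (Suc j)\<rceil> - 1)) / real (Suc j) \<le> t"
    and "0 < t \<Longrightarrow> real (nat (\<lceil>t * real (Suc j)\<rceil> - 1)) / real (Suc j) < t"
proof -
  have lower: "t - 1 / real (Suc j) \<le> real (nat (\<lceil>t * real (Suc j)\<rceil> - 1)) / real (Suc j)" for j
  proof -
    have "t * real (Suc j) - 1 \<le> real (nat (\<lceil>t * real (Suc j)\<rceil> - 1))" by linarith
    then have "(t * real (Suc j) - 1) / real (Suc j) \<le> real (nat (\<lceil>t * real (Suc j)\<rceil> - 1)) / real (Suc j)"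
      by (rule divide_right_mono) simp
    then show ?thesis by (simp add: diff_divide_distrib)
  qed
  have strict: "real (nat (\<lceil>t * real (Suc j)\<rceil> - 1)) / real (Suc j) < t" if "0 < t" for j
  proof -
    have "0 < t * real (Suc j)" using that by simp
    then have "real (nat (\<lceil>t * real (Suc j)\<rceil> - 1)) < t * real (Suc j)" by linarith
    then show ?thesis by (simp add: divide_less_eq)
  qed
  have upper: "real (nat (\<lceil>t * real (Suc j)\<rceil> - 1)) / real (Suc j) \<le> t" for j
    using strict[of j] assms by (cases "t = 0") auto
  show "(\<lambda>j. real (nat (\<lceil>t * real (Suc j)\<rceil> - 1)) / real (Suc j)) \<longlonglongrightarrow> t"
  proof (rule tendsto_sandwich[where h = "\<lambda>_. t"])
    show "(\<lambda>j. t - 1 / real (Suc j)) \<longlonglongrightarrow> t"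
      using tendsto_diff[OF tendsto_const LIMSEQ_Suc[OF lim_1_over_n], of t] by simp
  qed (use lower upper in \<open>blast intro: tendsto_const always_eventually\<close>)+
  show "real (nat (\<lceil>t * real (Suc j)\<rceil> - 1)) / real (Suc j) \<le> t" by (rule upper)
  show "0 < t \<Longrightarrow> real (nat (\<lceil>t * real (Suc j)\<rceil> - 1)) / real (Suc j) < t" by (rule strict)
qed

text \<open>A random variable \<open>X\<close> with a dominatedly varying tail that is positive everywhere, and a weight
  \<open>\<Theta>\<close> with values in \<open>[0, B]\<close>. The function \<open>k\<close> is the limiting density of the law of \<open>\<Theta>\<close> given a
  large value of \<open>X\<close>, with respect to the law of \<open>\<Theta>\<close>; this limiting law is not concentrated at 0.
  The bound \<open>B\<close> is taken to be at least 1 for convenience.\<close>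

locale bounded_weight = prob_space M for M :: "'a measure" +
  fixes X \<Theta> :: "'a \<Rightarrow> real" and k :: "real \<Rightarrow> real" and C B :: real
  assumes X[measurable]: "X \<in> borel_measurable M" and \<Theta>[measurable]: "\<Theta> \<in> borel_measurable M"
    and k[measurable]: "k \<in> borel_measurable borel"
    and k_nonneg: "\<And>t. 0 \<le> k t" and k_le: "\<And>t. k t \<le> C"
    and B: "1 \<le> B" and \<Theta>_range: "AE \<omega> in M. 0 \<le> \<Theta> \<omega> \<and> \<Theta> \<omega> \<le> B"
    and X_pos: "\<And>x. 0 < \<P>(\<omega> in M. X \<omega> > x)"
    and density: "\<And>e. 0 < e \<Longrightarrow> \<forall>\<^sub>F x in at_top. \<forall>A\<in>sets borel.
      \<bar>\<P>(\<omega> in M. X \<omega> > x \<and> \<Theta> \<omega> \<in> A) - \<P>(\<omega> in M. X \<omega> > x) * (\<integral>\<omega>. k (\<Theta> \<omega>) * indicator A (\<Theta> \<omega>) \<partial>M)\<bar>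
        \<le> e * (\<P>(\<omega> in M. X \<omega> > x) * (\<integral>\<omega>. k (\<Theta> \<omega>) * indicator A (\<Theta> \<omega>) \<partial>M))"
    and k_mass: "0 < (\<integral>\<omega>. k (\<Theta> \<omega>) * indicator {0<..} (\<Theta> \<omega>) \<partial>M)"
    and dominated: "\<And>b. 0 < b \<Longrightarrow> b < 1 \<Longrightarrow>
      \<exists>K. \<forall>\<^sub>F x in at_top. \<P>(\<omega> in M. X \<omega> > b * x) \<le> K * \<P>(\<omega> in M. X \<omega> > x)"
begin

text \<open>The tails \<open>G\<close> of \<open>X\<close> and \<open>T\<close> of the product \<open>\<Theta> X\<close>, the limiting law \<open>H\<close> of \<open>\<Theta>\<close> given a large
  value of \<open>X\<close>, and, for thresholds \<open>x \<ge> 0\<close>, the tail \<open>R\<close> that the product would have if the weight had law \<open>H\<close> and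
  were independent of \<open>X\<close>.
  The indicator in \<open>R\<close> removes the weight 0, for which \<open>x / 0 = 0\<close> would give the value \<open>G 0\<close>.\<close>

definition G :: "real \<Rightarrow> real" where "G x = \<P>(\<omega> in M. X \<omega> > x)"
definition T :: "real \<Rightarrow> real" where "T x = \<P>(\<omega> in M. \<Theta> \<omega> * X \<omega> > x)"
definition H :: "real set \<Rightarrow> real" where "H A = (\<integral>\<omega>. k (\<Theta> \<omega>) * indicator A (\<Theta> \<omega>) \<partial>M)"
definition R :: "real \<Rightarrow> real" where
  "R x = (\<integral>\<omega>. k (\<Theta> \<omega>) * (indicator {0<..} (\<Theta> \<omega>) * G (x / \<Theta> \<omega>)) \<partial>M)"

lemma G_pos: "0 < G x" and G_le_1: "G x \<le> 1"
  by (auto simp: G_def X_pos)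

lemma G_antimono: "x \<le> y \<Longrightarrow> G y \<le> G x"
  unfolding G_def by (rule finite_measure_mono) auto

lemma G_eq_cdf: "G x = 1 - cdf (distr M borel X) x"
  unfolding G_def by (rule prob_gt_eq_cdf[OF X])

lemma measurable_G[measurable]: "G \<in> borel_measurable borel"
proof -
  have "mono (\<lambda>x. - G x)" by (auto simp: mono_def G_antimono)
  from borel_measurable_mono[OF this] have "(\<lambda>x. - (- G x)) \<in> borel_measurable borel" by measurable
  then show ?thesis by simp
qed

lemma G_right_continuous: "(G \<longlongrightarrow> G a) (at_right a)"
proof -
  interpret rd: real_distribution "distr M borel X" by (rule real_distribution_distr) (rule X)
  have "(cdf (distr M borel X) \<longlongrightarrow> cdf (distr M borel X) a) (at_right a)"
    using rd.cdf_is_right_cont[of a] by (simp add: continuous_within)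
  then show ?thesis unfolding G_eq_cdf[abs_def] by (intro tendsto_intros)
qed

lemma C_nonneg: "0 \<le> C"
  using k_nonneg[of 0] k_le[of 0] by linarith

lemma integrable_k:
  assumes [measurable]: "f \<in> borel_measurable M" and f: "AE \<omega> in M. \<bar>f \<omega>\<bar> \<le> c"
  shows "integrable M (\<lambda>\<omega>. k (\<Theta> \<omega>) * f \<omega>)"
proof (rule integrable_const_bound[where B = "C * c"])
  show "AE \<omega> in M. norm (k (\<Theta> \<omega>) * f \<omega>) \<le> C * c"
    using f by eventually_elim
      (auto simp: abs_mult k_nonneg k_le intro!: mult_mono C_nonneg)
qed measurable

lemma R_nonneg: "0 \<le> R x"
  unfolding R_def by (rule integral_nonneg_AE) (auto simp: k_nonneg less_imp_le[OF G_pos])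

lemma integrable_R: "integrable M (\<lambda>\<omega>. k (\<Theta> \<omega>) * (indicator A (\<Theta> \<omega>) * G (x / \<Theta> \<omega>)))"
  if [measurable]: "A \<in> sets borel"
  by (rule integrable_k[where c = 1])
    (auto simp: indicator_def abs_mult less_imp_le[OF G_pos] G_le_1)

text \<open>On a cell of the grid the weight is replaced by the left endpoint \<open>i / m\<close>, which turns the
  product event into \<open>X > x * m / i\<close> and lets the density property be applied cell by cell; the
  relative error \<open>e\<close> survives the passage to the limit of vanishing mesh. Every threshold
  \<open>x * m / i\<close> that occurs is at least \<open>x / B\<close>, so one large \<open>x\<close> serves all cells.\<close>

lemma product_tail:
  assumes e: "0 < e"
  shows "\<forall>\<^sub>F x in at_top. \<bar>T x - R x\<bar> \<le> e * R x"
proof -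
  obtain x0 where x0: "\<And>x A. x \<ge> x0 \<Longrightarrow> A \<in> sets borel \<Longrightarrow>
      \<bar>\<P>(\<omega> in M. X \<omega> > x \<and> \<Theta> \<omega> \<in> A) - G x * H A\<bar> \<le> e * (G x * H A)"
    using density[OF e] unfolding eventually_at_top_linorder G_def H_def by blast
  have "\<bar>T x - R x\<bar> \<le> e * R x" if x: "x \<ge> max 1 (B * x0)" for x
  proof -
    have x_pos: "0 < x" using x by simp
    define s where "s j t = real (nat (\<lceil>t * real (Suc j)\<rceil> - 1)) / real (Suc j)" for j and t :: real
    have [measurable]: "s j \<in> borel_measurable borel" for j unfolding s_def by measurable
    define P :: "nat \<Rightarrow> real" where "P j = (\<integral>\<omega>. indicator {x<..} (s j (\<Theta> \<omega>) * X \<omega>) \<partial>M)" for j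
    define Q where "Q j = (\<integral>\<omega>. k (\<Theta> \<omega>) * (indicator {0<..} (s j (\<Theta> \<omega>)) * G (x / s j (\<Theta> \<omega>))) \<partial>M)" for j
    have PQ: "\<bar>P j - Q j\<bar> \<le> e * Q j" for j
    proof -
      define m where "m = Suc j"
      define I where "I i = {real i / real m<..(real i + 1) / real m}" for i :: nat
      define N where "N = nat \<lfloor>B * real m\<rfloor>"
      define y where "y i = x * real m / real i" for i
      have m: "m > 0" by (simp add: m_def)
      have [measurable]: "I i \<in> sets borel" for i by (simp add: I_def)
      have y: "y i \<ge> x0" if "i \<in> {1..N}" for i
      proof -
        have "real i \<le> B * real m" using that unfolding N_def atLeastAtMost_iff by linarith
        then have "x * real m / (B * real m) \<le> y i"
          unfolding y_def using that x_pos m B by (intro divide_left_mono) auto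
        moreover have "x0 \<le> x / B" using x B by (simp add: field_simps)
        ultimately show ?thesis using m by simp
      qed
      have s_eq: "s j t = real (nat (\<lceil>t * real m\<rceil> - 1)) / real m" for t by (simp add: s_def m_def)
      have "P j = (\<integral>\<omega>. (\<Sum>i\<in>{1..N}. indicator {\<omega>\<in>space M. X \<omega> > y i \<and> \<Theta> \<omega> \<in> I i} \<omega>) \<partial>M)"
        unfolding P_def
      proof (rule integral_cong_AE)
        show "AE \<omega> in M. indicator {x<..} (s j (\<Theta> \<omega>) * X \<omega>) =
            (\<Sum>i\<in>{1..N}. indicator {\<omega>\<in>space M. X \<omega> > y i \<and> \<Theta> \<omega> \<in> I i} \<omega> :: real)"
          using \<Theta>_range AE_space
        proof eventually_elim
          case (elim \<omega>)
          let ?q = "\<lambda>i. of_bool (X \<omega> > y i) :: real"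
          let ?k0 = "nat (\<lceil>\<Theta> \<omega> * real m\<rceil> - 1)"
          have "(\<Sum>i\<in>{1..N}. indicator {\<omega>\<in>space M. X \<omega> > y i \<and> \<Theta> \<omega> \<in> I i} \<omega> :: real) =
              (\<Sum>i\<in>{1..N}. indicator (I i) (\<Theta> \<omega>) * ?q i)"
            using elim by (intro sum.cong) (auto simp: indicator_def)
          also have "\<dots> = (if ?k0 = 0 then 0 else ?q ?k0)"
            unfolding N_def I_def using elim m by (intro grid_sum) auto
          also have "\<dots> = indicator {x<..} (s j (\<Theta> \<omega>) * X \<omega>)"
          proof -
            have *: "(if n = 0 then 0 else of_bool (X \<omega> > y n)) = (indicator {x<..} (real n / real m * X \<omega>) :: real)" for n
            proof (cases "n = 0")
              case False
              then have "X \<omega> > y n \<longleftrightarrow> real n / real m * X \<omega> > x"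
                using m by (simp add: y_def field_simps)
              then show ?thesis using False by simp
            qed (use x_pos in simp)
            show ?thesis unfolding s_eq by (rule *)
          qed
          finally show ?case by simp
        qed
      qed measurable
      also have "\<dots> = (\<Sum>i\<in>{1..N}. \<P>(\<omega> in M. X \<omega> > y i \<and> \<Theta> \<omega> \<in> I i))"
        by (subst Bochner_Integration.integral_sum) (auto simp: emeasure_eq_measure)
      finally have P_eq: "P j = (\<Sum>i\<in>{1..N}. \<P>(\<omega> in M. X \<omega> > y i \<and> \<Theta> \<omega> \<in> I i))" .
      have "Q j = (\<integral>\<omega>. (\<Sum>i\<in>{1..N}. G (y i) * (k (\<Theta> \<omega>) * indicator (I i) (\<Theta> \<omega>))) \<partial>M)"
        unfolding Q_def
      proof (rule integral_cong_AE)
        show "AE \<omega> in M. k (\<Theta> \<omega>) * (indicator {0<..} (s j (\<Theta> \<omega>)) * G (x / s j (\<Theta> \<omega>))) =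
            (\<Sum>i\<in>{1..N}. G (y i) * (k (\<Theta> \<omega>) * indicator (I i) (\<Theta> \<omega>)))"
          using \<Theta>_range
        proof eventually_elim
          case (elim \<omega>)
          let ?q = "\<lambda>i. G (y i) * k (\<Theta> \<omega>)"
          let ?k0 = "nat (\<lceil>\<Theta> \<omega> * real m\<rceil> - 1)"
          have "(\<Sum>i\<in>{1..N}. G (y i) * (k (\<Theta> \<omega>) * indicator (I i) (\<Theta> \<omega>))) =
              (\<Sum>i\<in>{1..N}. indicator (I i) (\<Theta> \<omega>) * ?q i)"
            by (intro sum.cong) auto
          also have "\<dots> = (if ?k0 = 0 then 0 else ?q ?k0)"
            unfolding N_def I_def using elim m by (intro grid_sum) auto
          also have "\<dots> = k (\<Theta> \<omega>) * (indicator {0<..} (s j (\<Theta> \<omega>)) * G (x / s j (\<Theta> \<omega>)))"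
            using m x_pos by (auto simp: s_eq y_def)
          finally show ?case by simp
        qed
      qed measurable
      also have "\<dots> = (\<Sum>i\<in>{1..N}. G (y i) * H (I i))"
        unfolding H_def
        by (subst Bochner_Integration.integral_sum)
          (auto intro!: integrable_mult_right integrable_k[where c = 1] simp: indicator_def)
      finally have Q_eq: "Q j = (\<Sum>i\<in>{1..N}. G (y i) * H (I i))" .
      have "\<bar>P j - Q j\<bar> \<le> (\<Sum>i\<in>{1..N}. \<bar>\<P>(\<omega> in M. X \<omega> > y i \<and> \<Theta> \<omega> \<in> I i) - G (y i) * H (I i)\<bar>)"
        unfolding P_eq Q_eq sum_subtractf[symmetric] by (rule sum_abs)
      also have "\<dots> \<le> (\<Sum>i\<in>{1..N}. e * (G (y i) * H (I i)))"
        by (intro sum_mono x0 y) auto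
      also have "\<dots> = e * Q j" by (simp add: Q_eq sum_distrib_left)
      finally show ?thesis .
    qed
    have T_lim: "P \<longlonglongrightarrow> T x"
    proof -
      have "P \<longlonglongrightarrow> (\<integral>\<omega>. indicator {x<..} (\<Theta> \<omega> * X \<omega>) \<partial>M)"
        unfolding P_def
      proof (rule integral_dominated_convergence[where w = "\<lambda>_. 1"])
        show "AE \<omega> in M. (\<lambda>j. indicator {x<..} (s j (\<Theta> \<omega>) * X \<omega>)) \<longlonglongrightarrow>
            (indicator {x<..} (\<Theta> \<omega> * X \<omega>) :: real)"
          using \<Theta>_range
        proof eventually_elim
          case (elim \<omega>)
          show ?case
          proof (cases "\<Theta> \<omega> * X \<omega> > x")
            case True
            have "(\<lambda>j. s j (\<Theta> \<omega>) * X \<omega>) \<longlonglongrightarrow> \<Theta> \<omega> * X \<omega>"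
              unfolding s_def using elim by (intro tendsto_mult grid_below tendsto_const) auto
            from order_tendstoD(1)[OF this True]
            have "\<forall>\<^sub>F j in sequentially. indicator {x<..} (s j (\<Theta> \<omega>) * X \<omega>) = (1 :: real)"
              by eventually_elim auto
            then show ?thesis using True by (simp add: tendsto_eventually)
          next
            case False
            have "s j (\<Theta> \<omega>) * X \<omega> \<le> x" for j
            proof (cases "X \<omega> \<le> 0")
              case True
              then have "s j (\<Theta> \<omega>) * X \<omega> \<le> 0" unfolding s_def by (intro mult_nonneg_nonpos) auto
              then show ?thesis using x_pos by simp
            next
              case X: False
              have "s j (\<Theta> \<omega>) \<le> \<Theta> \<omega>" unfolding s_def using elim by (intro grid_below) auto
              then have "s j (\<Theta> \<omega>) * X \<omega> \<le> \<Theta> \<omega> * X \<omega>" using X by (intro mult_right_mono) auto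
              then show ?thesis using False by simp
            qed
            then have "indicator {x<..} (s j (\<Theta> \<omega>) * X \<omega>) = (0 :: real)" for j
              by (simp add: not_less)
            then show ?thesis using False by simp
          qed
        qed
      qed (auto simp: indicator_def)
      also have "(\<integral>\<omega>. indicator {x<..} (\<Theta> \<omega> * X \<omega>) \<partial>M) = (\<integral>\<omega>. indicator {\<omega>\<in>space M. \<Theta> \<omega> * X \<omega> > x} \<omega> \<partial>M)"
        by (rule Bochner_Integration.integral_cong) (auto simp: indicator_def)
      also have "\<dots> = T x" by (simp add: T_def)
      finally show ?thesis .
    qed
    have R_lim: "Q \<longlonglongrightarrow> R x"
      unfolding Q_def R_def
    proof (rule integral_dominated_convergence[where w = "\<lambda>_. C"])
      show "AE \<omega> in M. (\<lambda>j. k (\<Theta> \<omega>) * (indicator {0<..} (s j (\<Theta> \<omega>)) * G (x / s j (\<Theta> \<omega>)))) \<longlonglongrightarrow>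
          k (\<Theta> \<omega>) * (indicator {0<..} (\<Theta> \<omega>) * G (x / \<Theta> \<omega>))"
        using \<Theta>_range
      proof eventually_elim
        case (elim \<omega>)
        show ?case
        proof (cases "\<Theta> \<omega> = 0")
          case True then show ?thesis by (simp add: s_def)
        next
          case False
          then have pos: "0 < \<Theta> \<omega>" using elim by simp
          have lim: "(\<lambda>j. s j (\<Theta> \<omega>)) \<longlonglongrightarrow> \<Theta> \<omega>"
            unfolding s_def by (rule grid_below(1)[OF less_imp_le[OF pos]])
          have less: "s j (\<Theta> \<omega>) < \<Theta> \<omega>" for j
            unfolding s_def by (rule grid_below(3)[OF less_imp_le[OF pos] pos])
          have ev: "\<forall>\<^sub>F j in sequentially. 0 < s j (\<Theta> \<omega>)" using order_tendstoD(1)[OF lim pos] .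
          have "filterlim (\<lambda>j. x / s j (\<Theta> \<omega>)) (at_right (x / \<Theta> \<omega>)) sequentially"
          proof (rule tendsto_imp_filterlim_at_right)
            show "(\<lambda>j. x / s j (\<Theta> \<omega>)) \<longlonglongrightarrow> x / \<Theta> \<omega>" using pos by (intro tendsto_divide lim) auto
            show "\<forall>\<^sub>F j in sequentially. x / \<Theta> \<omega> < x / s j (\<Theta> \<omega>)"
              using ev
            proof eventually_elim
              case (elim j)
              then show ?case using less[of j] x_pos by (intro divide_strict_left_mono) auto
            qed
          qed
          from filterlim_compose[OF G_right_continuous this]
          have "(\<lambda>j. G (x / s j (\<Theta> \<omega>))) \<longlonglongrightarrow> G (x / \<Theta> \<omega>)" .
          moreover have "(\<lambda>j. indicator {0<..} (s j (\<Theta> \<omega>))) \<longlonglongrightarrow> (1 :: real)"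
            by (rule tendsto_eventually) (use ev in eventually_elim, auto)
          ultimately have "(\<lambda>j. k (\<Theta> \<omega>) * (indicator {0<..} (s j (\<Theta> \<omega>)) * G (x / s j (\<Theta> \<omega>)))) \<longlonglongrightarrow>
              k (\<Theta> \<omega>) * (1 * G (x / \<Theta> \<omega>))" by (intro tendsto_intros)
          then show ?thesis using pos by simp
        qed
      qed
      show "AE \<omega> in M. norm (k (\<Theta> \<omega>) * (indicator {0<..} (s j (\<Theta> \<omega>)) * G (x / s j (\<Theta> \<omega>)))) \<le> C" for j
      proof (rule AE_I2)
        fix \<omega>
        have "k (\<Theta> \<omega>) * G (x / s j (\<Theta> \<omega>)) \<le> C * 1"
          by (intro mult_mono k_le G_le_1 C_nonneg less_imp_le[OF G_pos])
        then show "norm (k (\<Theta> \<omega>) * (indicator {0<..} (s j (\<Theta> \<omega>)) * G (x / s j (\<Theta> \<omega>)))) \<le> C"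
          using k_nonneg[of "\<Theta> \<omega>"] C_nonneg G_pos[of "x / s j (\<Theta> \<omega>)"] by (auto simp: indicator_def abs_mult)
      qed
    qed measurable
    have "(\<lambda>j. \<bar>P j - Q j\<bar>) \<longlonglongrightarrow> \<bar>T x - R x\<bar>" "(\<lambda>j. e * Q j) \<longlonglongrightarrow> e * R x"
      by (intro tendsto_intros T_lim R_lim)+
    then show ?thesis using PQ by (intro LIMSEQ_le) auto
  qed
  then show ?thesis by (rule eventually_mono[OF eventually_ge_at_top])
qed

lemma G_dominated:
  assumes "0 < b"
  obtains K where "0 < K" "\<forall>\<^sub>F x in at_top. G (b * x) \<le> K * G x"
proof (cases "b < 1")
  case True
  then obtain K where K: "\<forall>\<^sub>F x in at_top. G (b * x) \<le> K * G x"
    using dominated[OF assms] unfolding G_def by blast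
  have "\<forall>\<^sub>F x in at_top. G (b * x) \<le> max 1 K * G x"
    using K by eventually_elim (use G_pos less_imp_le in \<open>auto intro: order_trans mult_right_mono\<close>)
  then show thesis by (intro that[of "max 1 K"]) auto
next
  case False
  have "\<forall>\<^sub>F x in at_top. G (b * x) \<le> 1 * G x"
    using eventually_ge_at_top[of 0]
  proof eventually_elim
    case (elim x)
    then have "1 * x \<le> b * x" using False by (intro mult_right_mono) auto
    then show ?case using G_antimono by simp
  qed
  then show thesis by (intro that[of 1]) auto
qed

lemma T_nonneg: "0 \<le> T x"
  by (simp add: T_def)

lemma T_upper: "0 \<le> x \<Longrightarrow> T x \<le> G (x / B)"
  unfolding T_def G_def
proof (rule finite_measure_mono_AE)
  assume x: "0 \<le> x"
  show "AE \<omega> in M. \<omega> \<in> {\<omega> \<in> space M. x < \<Theta> \<omega> * X \<omega>} \<longrightarrow> \<omega> \<in> {\<omega> \<in> space M. x / B < X \<omega>}"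
    using \<Theta>_range
  proof eventually_elim
    case (elim \<omega>)
    have "x / B < X \<omega>" if "x < \<Theta> \<omega> * X \<omega>"
    proof -
      have "X \<omega> > 0" using that x elim by (simp add: zero_less_mult_iff flip: not_le) (smt (verit) mult_nonneg_nonpos)
      then have "\<Theta> \<omega> * X \<omega> \<le> B * X \<omega>" using elim by (intro mult_right_mono) auto
      then show ?thesis using that B by (simp add: field_simps)
    qed
    then show ?case by auto
  qed
qed measurable

lemma small_weights:
  assumes "0 < e"
  obtains c where "0 < c" "c \<le> 1 / 2" "H {0<..c} < e"
proof -
  have "(\<lambda>i. \<integral>\<omega>. k (\<Theta> \<omega>) * indicator {0<..1 / real (i + 2)} (\<Theta> \<omega>) \<partial>M) \<longlonglongrightarrow> (\<integral>\<omega>. 0 \<partial>M)"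
  proof (rule integral_dominated_convergence[where w = "\<lambda>_. C"])
    have "(\<lambda>i. k (\<Theta> \<omega>) * indicator {0<..1 / real (i + 2)} (\<Theta> \<omega>)) \<longlonglongrightarrow> 0" for \<omega>
    proof (cases "\<Theta> \<omega> \<le> 0")
      case False
      have "(\<lambda>i. 1 / real (i + 2)) \<longlonglongrightarrow> 0" by (rule LIMSEQ_ignore_initial_segment[OF lim_1_over_n])
      from order_tendstoD(2)[OF this] have "\<forall>\<^sub>F i in sequentially. 1 / real (i + 2) < \<Theta> \<omega>" using False by simp
      then have "\<forall>\<^sub>F i in sequentially. k (\<Theta> \<omega>) * indicator {0<..1 / real (i + 2)} (\<Theta> \<omega>) = 0"
        by eventually_elim auto
      then show ?thesis by (rule tendsto_eventually)
    qed simp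
    then show "AE \<omega> in M. (\<lambda>i. k (\<Theta> \<omega>) * indicator {0<..1 / real (i + 2)} (\<Theta> \<omega>)) \<longlonglongrightarrow> 0" by simp
    show "AE \<omega> in M. norm (k (\<Theta> \<omega>) * indicator {0<..1 / real (i + 2)} (\<Theta> \<omega>)) \<le> C" for i
      using k_nonneg k_le C_nonneg by (auto simp: indicator_def)
  qed auto
  then have lim: "(\<lambda>i. H {0<..1 / real (i + 2)}) \<longlonglongrightarrow> 0" by (simp add: H_def)
  from order_tendstoD(2)[OF lim assms] obtain i where "H {0<..1 / real (i + 2)} < e"
    using eventually_happens'[OF sequentially_bot] by blast
  then show thesis by (intro that[of "1 / real (i + 2)"]) (auto simp: field_simps)
qed

text \<open>Weights above some \<open>c > 0\<close> have positive mass, and they alone give a tail of the order of \<open>G\<close>.\<close>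

lemma T_lower:
  obtains \<kappa> where "0 < \<kappa>" "\<forall>\<^sub>F x in at_top. \<kappa> * G x \<le> T x"
proof -
  obtain c where c: "0 < c" "c \<le> 1 / 2" "H {0<..c} < H {0<..}"
    using small_weights[of "H {0<..}"] k_mass by (auto simp: H_def)
  have "H {0<..} = H {0<..c} + H {c<..}"
    unfolding H_def using c(1)
    by (subst Bochner_Integration.integral_add[symmetric])
      (auto intro!: integrable_k[where c = 1] Bochner_Integration.integral_cong simp: indicator_def)
  then have Hc: "0 < H {c<..}" using c(3) by simp
  obtain K where K: "0 < K" "\<forall>\<^sub>F x in at_top. G (c * x) \<le> K * G x"
    using G_dominated[OF c(1)] by blast
  have "filterlim (\<lambda>x. x / c) at_top at_top"
    using filterlim_tendsto_pos_mult_at_top[OF tendsto_const, of "1 / c"  "\<lambda>x. x" at_top] c(1)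
    by (simp add: filterlim_ident)
  from eventually_compose_filterlim[OF K(2) this]
  have "\<forall>\<^sub>F x in at_top. G x \<le> K * G (x / c)" using c(1) by simp
  then have "\<forall>\<^sub>F x in at_top. H {c<..} / (2 * K) * G x \<le> T x"
    using product_tail[OF half_gt_zero[OF zero_less_one]] eventually_ge_at_top[of 0]
  proof eventually_elim
    case (elim x)
    have "H {c<..} * G (x / c) = (\<integral>\<omega>. k (\<Theta> \<omega>) * (indicator {c<..} (\<Theta> \<omega>) * G (x / c)) \<partial>M)"
      by (simp add: H_def mult.assoc flip: Bochner_Integration.integral_mult_left_zero)
    also have "\<dots> \<le> R x"
      unfolding R_def
    proof (rule integral_mono_AE)
      show "AE \<omega> in M. k (\<Theta> \<omega>) * (indicator {c<..} (\<Theta> \<omega>) * G (x / c)) \<le>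
          k (\<Theta> \<omega>) * (indicator {0<..} (\<Theta> \<omega>) * G (x / \<Theta> \<omega>))"
      proof (rule AE_I2)
        fix \<omega>
        have "G (x / c) \<le> G (x / \<Theta> \<omega>)" if "c < \<Theta> \<omega>"
          using that c(1) elim by (intro G_antimono divide_left_mono) auto
        then show "k (\<Theta> \<omega>) * (indicator {c<..} (\<Theta> \<omega>) * G (x / c)) \<le>
          k (\<Theta> \<omega>) * (indicator {0<..} (\<Theta> \<omega>) * G (x / \<Theta> \<omega>))"
          using c(1) less_imp_le[OF G_pos] by (intro mult_left_mono k_nonneg) (auto simp: indicator_def)
      qed
      show "integrable M (\<lambda>\<omega>. k (\<Theta> \<omega>) * (indicator {c<..} (\<Theta> \<omega>) * G (x / c)))"
        by (rule integrable_k[where c = 1]) (auto simp: indicator_def less_imp_le[OF G_pos] G_le_1)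
    qed (rule integrable_R, simp)
    also have "R x \<le> 2 * T x" using abs_le_D2[OF elim(2)] by simp
    finally have "H {c<..} * G (x / c) \<le> 2 * T x" .
    moreover have "H {c<..} * G x \<le> K * (H {c<..} * G (x / c))"
      using mult_left_mono[OF elim(1), of "H {c<..}"] Hc by (simp add: mult_ac)
    ultimately have "H {c<..} * G x \<le> K * (2 * T x)"
      using K(1) by (meson mult_left_mono less_imp_le order_trans)
    then show ?case using K(1) by (simp add: field_simps)
  qed
  then show thesis using that[of "H {c<..} / (2 * K)"] Hc K(1) by simp
qed

lemma G_dominated_by_T:
  assumes "0 < b"
  obtains Q where "0 < Q" "\<forall>\<^sub>F x in at_top. G (b * x) \<le> Q * T x"
proof -
  obtain \<kappa> where \<kappa>: "0 < \<kappa>" "\<forall>\<^sub>F x in at_top. \<kappa> * G x \<le> T x" by (rule T_lower)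
  obtain K where K: "0 < K" "\<forall>\<^sub>F x in at_top. G (b * x) \<le> K * G x" by (rule G_dominated[OF assms])
  have "\<forall>\<^sub>F x in at_top. G (b * x) \<le> K / \<kappa> * T x"
    using \<kappa>(2) K(2)
  proof eventually_elim
    case (elim x)
    have "K * G x \<le> K * (T x / \<kappa>)"
      using elim(1) \<kappa>(1) K(1) by (intro mult_left_mono) (auto simp: field_simps)
    with elim(2) show ?case by simp
  qed
  then show thesis using that[of "K / \<kappa>"] \<kappa>(1) K(1) by simp
qed

lemma T_pos: "\<forall>\<^sub>F x in at_top. 0 < T x"
proof -
  obtain \<kappa> where \<kappa>: "0 < \<kappa>" "\<forall>\<^sub>F x in at_top. \<kappa> * G x \<le> T x" by (rule T_lower)
  show ?thesis using \<kappa>(2) by eventually_elim (meson G_pos \<kappa>(1) less_le_trans mult_pos_pos)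
qed

text \<open>Bounds on \<open>G\<close> under a shift of the threshold pass to \<open>T\<close> although they are uniform only for
  weights bounded away from 0: weights below a small \<open>c\<close> contribute at most \<open>H {0<..c} * G x\<close>, which
  is negligible because \<open>T\<close> is of the order of \<open>G\<close>.\<close>

lemma T_shift:
  fixes \<phi> :: "real \<Rightarrow> real"
  assumes half: "\<forall>\<^sub>F x in at_top. x / 2 \<le> \<phi> x"
    and e: "0 < e" "e \<le> 1 / 2"
    and G_shift: "\<And>c. 0 < c \<Longrightarrow>
      \<forall>\<^sub>F x in at_top. \<forall>t. c \<le> t \<and> t \<le> B \<longrightarrow> G (\<phi> x / t) \<le> (1 + e) * G (x / t)"
  shows "\<forall>\<^sub>F x in at_top. T (\<phi> x) \<le> (1 + 9 * e) * T x"
proof -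
  obtain \<kappa> where \<kappa>: "0 < \<kappa>" "\<forall>\<^sub>F x in at_top. \<kappa> * G x \<le> T x" by (rule T_lower)
  obtain c where c: "0 < c" "c \<le> 1 / 2" "H {0<..c} < e * \<kappa>"
    using small_weights[of "e * \<kappa>"] e \<kappa> by auto
  have "filterlim (\<lambda>x. x / 2 :: real) at_top at_top"
    using filterlim_tendsto_pos_mult_at_top[OF tendsto_const, of "1 / 2"  "\<lambda>x. x" at_top]
    by (simp add: filterlim_ident)
  then have \<phi>_top: "filterlim \<phi> at_top at_top"
    using half by (rule filterlim_at_top_mono)
  show ?thesis
    using half G_shift[OF c(1)] \<kappa>(2) product_tail[OF e(1)]
      eventually_compose_filterlim[OF product_tail[OF e(1)] \<phi>_top] eventually_ge_at_top[of 0]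
  proof eventually_elim
    case (elim x)
    have "R (\<phi> x) \<le> (\<integral>\<omega>. k (\<Theta> \<omega>) * (indicator {0<..c} (\<Theta> \<omega>) * G x) +
        (1 + e) * (k (\<Theta> \<omega>) * (indicator {0<..} (\<Theta> \<omega>) * G (x / \<Theta> \<omega>))) \<partial>M)"
      unfolding R_def
    proof (rule integral_mono_AE)
      show "AE \<omega> in M. k (\<Theta> \<omega>) * (indicator {0<..} (\<Theta> \<omega>) * G (\<phi> x / \<Theta> \<omega>)) \<le>
        k (\<Theta> \<omega>) * (indicator {0<..c} (\<Theta> \<omega>) * G x) +
        (1 + e) * (k (\<Theta> \<omega>) * (indicator {0<..} (\<Theta> \<omega>) * G (x / \<Theta> \<omega>)))"
        using \<Theta>_range
      proof eventually_elim
        case t: (elim \<omega>)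
        have "indicator {0<..} (\<Theta> \<omega>) * G (\<phi> x / \<Theta> \<omega>) \<le> indicator {0<..c} (\<Theta> \<omega>) * G x +
            (1 + e) * (indicator {0<..} (\<Theta> \<omega>) * G (x / \<Theta> \<omega>))"
        proof (cases "\<Theta> \<omega> \<le> c")
          case True
          have "G (\<phi> x / \<Theta> \<omega>) \<le> G x" if "0 < \<Theta> \<omega>"
          proof (rule G_antimono)
            have "\<Theta> \<omega> \<le> 1 / 2" using True c(2) by linarith
            then have "x * \<Theta> \<omega> \<le> x * (1 / 2)" using elim by (intro mult_left_mono) auto
            then show "x \<le> \<phi> x / \<Theta> \<omega>" using that elim by (simp add: le_divide_eq)
          qed
          then show ?thesis using True e G_pos[of "x / \<Theta> \<omega>"] by (auto simp: indicator_def intro: add_increasing2)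
        next
          case False
          then show ?thesis using t elim c(1) by (auto simp: indicator_def)
        qed
        from mult_left_mono[OF this k_nonneg[of "\<Theta> \<omega>"]] show ?case by (simp add: algebra_simps)
      qed
      show "integrable M (\<lambda>\<omega>. k (\<Theta> \<omega>) * (indicator {0<..c} (\<Theta> \<omega>) * G x) +
        (1 + e) * (k (\<Theta> \<omega>) * (indicator {0<..} (\<Theta> \<omega>) * G (x / \<Theta> \<omega>))))"
        by (intro Bochner_Integration.integrable_add integrable_mult_right integrable_R integrable_k[where c = 1])
          (auto simp: indicator_def less_imp_le[OF G_pos] G_le_1)
    qed (rule integrable_R, simp)
    also have "\<dots> = H {0<..c} * G x + (1 + e) * R x"
    proof -
      have "(\<integral>\<omega>. k (\<Theta> \<omega>) * (indicator {0<..c} (\<Theta> \<omega>) * G x) \<partial>M) = H {0<..c} * G x"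
        by (simp add: H_def mult.assoc flip: Bochner_Integration.integral_mult_left_zero)
      moreover have "(\<integral>\<omega>. (1 + e) * (k (\<Theta> \<omega>) * (indicator {0<..} (\<Theta> \<omega>) * G (x / \<Theta> \<omega>))) \<partial>M) = (1 + e) * R x"
        unfolding R_def by simp
      moreover have "integrable M (\<lambda>\<omega>. k (\<Theta> \<omega>) * (indicator {0<..c} (\<Theta> \<omega>) * G x))"
        by (rule integrable_k[where c = 1]) (auto simp: indicator_def less_imp_le[OF G_pos] G_le_1)
      moreover have "integrable M (\<lambda>\<omega>. (1 + e) * (k (\<Theta> \<omega>) * (indicator {0<..} (\<Theta> \<omega>) * G (x / \<Theta> \<omega>))))"
        by (intro integrable_mult_right integrable_R) simp
      ultimately show ?thesis by (simp only: Bochner_Integration.integral_add)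
    qed
    also have "H {0<..c} * G x \<le> e * \<kappa> * G x"
      using c(3) G_pos[of x] by (intro mult_right_mono) auto
    also have "\<dots> \<le> e * T x" using elim(3) e(1) by (simp add: mult.assoc)
    finally have R_le: "R (\<phi> x) \<le> e * T x + (1 + e) * R x" by simp
    \<comment> \<open>For \<open>e \<le> 1 / 2\<close> the factor \<open>1 + 2 * e\<close> is an upper bound of \<open>1 / (1 - e)\<close>.\<close>
    have "(1 - e) * R x \<le> T x" using elim(4) by (simp add: algebra_simps)
    then have "(1 + 2 * e) * ((1 - e) * R x) \<le> (1 + 2 * e) * T x"
      using e by (intro mult_left_mono) auto
    moreover have "R x \<le> (1 + 2 * e) * ((1 - e) * R x)"
    proof -
      have "(1 + 2 * e) * (1 - e) - 1 = e * (1 - 2 * e)" by algebra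
      also have "\<dots> \<ge> 0" using e by simp
      finally have "1 * R x \<le> ((1 + 2 * e) * (1 - e)) * R x" by (intro mult_right_mono R_nonneg) simp
      then show ?thesis by (simp add: mult.assoc)
    qed
    ultimately have Rx: "R x \<le> (1 + 2 * e) * T x" by linarith
    have "R (\<phi> x) \<le> e * T x + (1 + e) * ((1 + 2 * e) * T x)"
      using R_le mult_left_mono[OF Rx, of "1 + e"] e by linarith
    also have "\<dots> = (1 + 4 * e + 2 * e * e) * T x" by algebra
    finally have Rphi: "R (\<phi> x) \<le> (1 + 4 * e + 2 * e * e) * T x" .
    have "T (\<phi> x) \<le> (1 + e) * R (\<phi> x)" using elim(5) by (simp add: algebra_simps)
    also have "\<dots> \<le> (1 + e) * ((1 + 4 * e + 2 * e * e) * T x)"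
      using Rphi e by (intro mult_left_mono) auto
    also have "\<dots> = ((1 + e) * (1 + 4 * e + 2 * e * e)) * T x" by simp
    also have "\<dots> \<le> (1 + 9 * e) * T x"
    proof (rule mult_right_mono[OF _ T_nonneg])
      have "e * e \<le> e * (1 / 2)" "e * (e * e) \<le> e * (1 / 2 * (1 / 2))" using e by (intro mult_left_mono mult_mono; simp)+
      moreover have "(1 + e) * (1 + 4 * e + 2 * e * e) = 1 + 5 * e + 6 * (e * e) + 2 * (e * (e * e))" by algebra
      ultimately show "(1 + e) * (1 + 4 * e + 2 * e * e) \<le> 1 + 9 * e" using e(1) by linarith
    qed
    finally show ?case .
  qed
qed

lemma T_long_tailed:
  assumes long: "\<And>a. 0 < a \<Longrightarrow> ((\<lambda>x. G (x - a) / G x) \<longlongrightarrow> 1) at_top"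
    and a: "0 < a" and \<eta>: "0 < \<eta>"
  shows "\<forall>\<^sub>F x in at_top. T (x - a) \<le> (1 + \<eta>) * T x"
proof -
  \<comment> \<open>The constant 9 compensates for the factor in \<open>T_shift\<close>.\<close>
  define e where "e = min (1 / 2) (\<eta> / 9)"
  have e: "0 < e" "e \<le> 1 / 2" "9 * e \<le> \<eta>" using \<eta> by (auto simp: e_def)
  have "\<forall>\<^sub>F x in at_top. T (x - a) \<le> (1 + 9 * e) * T x"
  proof (rule T_shift[OF _ e(1,2)])
    show "\<forall>\<^sub>F x in at_top. x / 2 \<le> x - a"
      using eventually_ge_at_top[of "2 * a"] by eventually_elim auto
    fix c :: real assume c: "0 < c"
    have "\<forall>\<^sub>F x in at_top. G (x - a / c) / G x < 1 + e"
      using order_tendstoD(2)[OF long[of "a / c"]] a c e(1) by simp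
    then obtain z where z: "\<And>x. x \<ge> z \<Longrightarrow> G (x - a / c) / G x < 1 + e"
      unfolding eventually_at_top_linorder by blast
    show "\<forall>\<^sub>F x in at_top. \<forall>t. c \<le> t \<and> t \<le> B \<longrightarrow> G ((x - a) / t) \<le> (1 + e) * G (x / t)"
      using eventually_ge_at_top[of "B * max z 0"]
    proof eventually_elim
      case (elim x)
      show ?case
      proof (intro allI impI)
        fix t assume t: "c \<le> t \<and> t \<le> B"
        then have "t * max z 0 \<le> B * max z 0" by (intro mult_right_mono) auto
        then have "max z 0 \<le> x / t" using elim t c by (simp add: le_divide_eq mult.commute)
        then have "G (x / t - a / c) / G (x / t) < 1 + e" by (intro z) simp
        then have "G (x / t - a / c) \<le> (1 + e) * G (x / t)"
          using G_pos[of "x / t"] by (simp add: divide_less_eq)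
        moreover have "G ((x - a) / t) \<le> G (x / t - a / c)"
        proof (rule G_antimono)
          have "a / t \<le> a / c" using t c a by (intro divide_left_mono) auto
          then show "x / t - a / c \<le> (x - a) / t" by (simp add: diff_divide_distrib)
        qed
        ultimately show "G ((x - a) / t) \<le> (1 + e) * G (x / t)" by linarith
      qed
    qed
  qed
  then show ?thesis
  proof eventually_elim
    case (elim x)
    have "(1 + 9 * e) * T x \<le> (1 + \<eta>) * T x" by (intro mult_right_mono T_nonneg) (use e(3) in simp)
    with elim show ?case by linarith
  qed
qed

lemma T_consistently_varying:
  assumes cons: "\<And>\<eta>. 0 < \<eta> \<Longrightarrow> \<exists>v<1. \<forall>\<^sub>F x in at_top. G (v * x) \<le> (1 + \<eta>) * G x"
    and \<eta>: "0 < \<eta>"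
  obtains v where "v < 1" "1 / 2 \<le> v" "\<forall>\<^sub>F x in at_top. T (v * x) \<le> (1 + \<eta>) * T x"
proof -
  \<comment> \<open>The constant 9 compensates for the factor in \<open>T_shift\<close>.\<close>
  define e where "e = min (1 / 2) (\<eta> / 9)"
  have e: "0 < e" "e \<le> 1 / 2" "9 * e \<le> \<eta>" using \<eta> by (auto simp: e_def)
  obtain v where v: "v < 1" "\<forall>\<^sub>F x in at_top. G (v * x) \<le> (1 + e) * G x" using cons[OF e(1)] by blast
  have G_v: "\<forall>\<^sub>F x in at_top. \<forall>t. c \<le> t \<and> t \<le> B \<longrightarrow> G (max v (1 / 2) * x / t) \<le> (1 + e) * G (x / t)"
    if c: "0 < c" for c
  proof -
    obtain z where z: "\<And>x. x \<ge> z \<Longrightarrow> G (v * x) \<le> (1 + e) * G x"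
      using v(2) unfolding eventually_at_top_linorder by blast
    show ?thesis using eventually_ge_at_top[of "B * max z 0"]
    proof eventually_elim
      case (elim x)
      show ?case
      proof (intro allI impI)
        fix t assume t: "c \<le> t \<and> t \<le> B"
        then have "t * max z 0 \<le> B * max z 0" by (intro mult_right_mono) auto
        then have xt: "max z 0 \<le> x / t" using elim t c by (simp add: le_divide_eq mult.commute)
        have "v * (x / t) \<le> max v (1 / 2) * (x / t)" using xt by (intro mult_right_mono) auto
        then have "G (max v (1 / 2) * x / t) \<le> G (v * (x / t))" by (intro G_antimono) simp
        also have "\<dots> \<le> (1 + e) * G (x / t)" using xt by (intro z) simp
        finally show "G (max v (1 / 2) * x / t) \<le> (1 + e) * G (x / t)" .
      qed
    qed
  qed
  have "\<forall>\<^sub>F x in at_top. T (max v (1 / 2) * x) \<le> (1 + 9 * e) * T x"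
  proof (rule T_shift[OF _ e(1,2) G_v])
    show "\<forall>\<^sub>F x in at_top. x / 2 \<le> max v (1 / 2) * x"
      using eventually_ge_at_top[of 0]
    proof eventually_elim
      case (elim x)
      then have "1 / 2 * x \<le> max v (1 / 2) * x" by (intro mult_right_mono) auto
      then show ?case by simp
    qed
  qed
  then have "\<forall>\<^sub>F x in at_top. T (max v (1 / 2) * x) \<le> (1 + \<eta>) * T x"
  proof eventually_elim
    case (elim x)
    have "(1 + 9 * e) * T x \<le> (1 + \<eta>) * T x" by (intro mult_right_mono T_nonneg) (use e(3) in simp)
    with elim show ?case by linarith
  qed
  then show thesis using v(1) by (intro that[of "max v (1 / 2)"]) auto
qed

lemma product_tail_ratio: "((\<lambda>x. T x / R x) \<longlongrightarrow> 1) at_top"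
proof (rule tendstoI)
  fix e :: real assume e: "0 < e"
  obtain \<kappa> where \<kappa>: "0 < \<kappa>" "\<forall>\<^sub>F x in at_top. \<kappa> * G x \<le> T x" by (rule T_lower)
  have "0 < e / 2" using e by simp
  show "\<forall>\<^sub>F x in at_top. dist (T x / R x) 1 < e"
    using product_tail[OF \<open>0 < e / 2\<close>] \<kappa>(2)
  proof eventually_elim
    case (elim x)
    have "0 < T x" using elim(2) \<kappa>(1) G_pos[of x] by (meson less_le_trans mult_pos_pos)
    then have R: "0 < R x" using elim(1) R_nonneg[of x] by (cases "R x = 0") auto
    have "dist (T x / R x) 1 = \<bar>T x - R x\<bar> / R x"
    proof -
      have "T x / R x - 1 = (T x - R x) / R x" using R by (simp add: field_simps)
      then show ?thesis using R by (simp add: dist_real_def abs_divide)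
    qed
    also have "\<dots> \<le> e / 2 * R x / R x" using elim(1) R by (intro divide_right_mono) auto
    also have "\<dots> < e" using R e by simp
    finally show ?case .
  qed
qed

text \<open>Breiman's theorem for a bounded weight that depends on \<open>X\<close> through the density \<open>k\<close>.\<close>

lemma T_regularly_varying:
  assumes reg: "\<And>b. 0 < b \<Longrightarrow> ((\<lambda>x. G (b * x) / G x) \<longlongrightarrow> b powr (- \<alpha>)) at_top"
  shows "((\<lambda>x. T x / G x) \<longlongrightarrow> (\<integral>\<omega>. \<Theta> \<omega> powr \<alpha> * k (\<Theta> \<omega>) \<partial>M)) at_top"
proof -
  obtain K where K: "0 < K" "\<forall>\<^sub>F x in at_top. G (1 / B * x) \<le> K * G x"
    using G_dominated[of "1 / B"] B by auto
  have "((\<lambda>x. \<integral>\<omega>. k (\<Theta> \<omega>) * (indicator {0<..} (\<Theta> \<omega>) * G (x / \<Theta> \<omega>)) / G x \<partial>M) \<longlongrightarrow>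
      (\<integral>\<omega>. \<Theta> \<omega> powr \<alpha> * k (\<Theta> \<omega>) \<partial>M)) at_top"
  proof (rule integral_dominated_convergence_at_top[where w = "\<lambda>_. C * K"])
    show "AE \<omega> in M. ((\<lambda>x. k (\<Theta> \<omega>) * (indicator {0<..} (\<Theta> \<omega>) * G (x / \<Theta> \<omega>)) / G x) \<longlongrightarrow>
        \<Theta> \<omega> powr \<alpha> * k (\<Theta> \<omega>)) at_top"
      using \<Theta>_range
    proof eventually_elim
      case (elim \<omega>)
      show ?case
      proof (cases "\<Theta> \<omega> = 0")
        case False
        then have pos: "0 < \<Theta> \<omega>" using elim by simp
        have "(1 / \<Theta> \<omega>) powr (- \<alpha>) = \<Theta> \<omega> powr \<alpha>" using pos by (simp add: powr_minus powr_divide)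
        then have "((\<lambda>x. G (1 / \<Theta> \<omega> * x) / G x * k (\<Theta> \<omega>)) \<longlongrightarrow> \<Theta> \<omega> powr \<alpha> * k (\<Theta> \<omega>)) at_top"
          using reg[of "1 / \<Theta> \<omega>"] pos by (intro tendsto_mult_right) simp
        then show ?thesis using pos by (simp add: mult_ac)
      qed simp
    qed
    show "\<forall>\<^sub>F x in at_top. AE \<omega> in M.
        norm (k (\<Theta> \<omega>) * (indicator {0<..} (\<Theta> \<omega>) * G (x / \<Theta> \<omega>)) / G x) \<le> C * K"
      using K(2) eventually_ge_at_top[of 0]
    proof eventually_elim
      case x: (elim x)
      show ?case using \<Theta>_range
      proof eventually_elim
        case (elim \<omega>)
        show ?case
        proof (cases "\<Theta> \<omega> = 0")
          case False
          then have pos: "0 < \<Theta> \<omega>" using elim by simp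
          have "G (x / \<Theta> \<omega>) \<le> G (1 / B * x)"
            using pos elim x B by (intro G_antimono) (auto intro: divide_left_mono)
          also have "\<dots> \<le> K * G x" by (rule x(1))
          finally have "G (x / \<Theta> \<omega>) / G x \<le> K" using G_pos[of x] by (simp add: divide_le_eq)
          then have "k (\<Theta> \<omega>) * (G (x / \<Theta> \<omega>) / G x) \<le> C * K"
            by (intro mult_mono k_le C_nonneg) (auto simp: less_imp_le[OF G_pos])
          then show ?thesis using pos k_nonneg[of "\<Theta> \<omega>"] G_pos[of x] G_pos[of "x / \<Theta> \<omega>"]
            by (simp add: abs_mult)
        qed (use C_nonneg K in simp)
      qed
    qed
  qed auto
  then have "((\<lambda>x. R x / G x) \<longlongrightarrow> (\<integral>\<omega>. \<Theta> \<omega> powr \<alpha> * k (\<Theta> \<omega>) \<partial>M)) at_top"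
    unfolding R_def by simp
  from tendsto_mult[OF product_tail_ratio this]
  have lim: "((\<lambda>x. T x / R x * (R x / G x)) \<longlongrightarrow> (\<integral>\<omega>. \<Theta> \<omega> powr \<alpha> * k (\<Theta> \<omega>) \<partial>M)) at_top" by simp
  have "\<forall>\<^sub>F x in at_top. T x / R x * (R x / G x) = T x / G x"
    using order_tendstoD(1)[OF product_tail_ratio zero_less_one] by eventually_elim auto
  from Lim_transform_eventually[OF lim this] show ?thesis .
qed

end

section \<open>Tails of maximal partial sums\<close>

lemma partial_sums_gt_imp:
  fixes y :: "nat \<Rightarrow> real"
  assumes n: "k \<in> {1..n}" and gt: "(\<Sum>i=1..k. y i) > x" and d: "0 < d" "d \<le> x"
  shows "(\<exists>i\<in>{1..n}. y i > x - d) \<or> (\<exists>j\<in>{1..n}. \<exists>i\<in>{1..n}. i \<noteq> j \<and> \<bar>y i\<bar> > d / n \<and> y j > x / n)"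
proof (rule ccontr)
  assume neg: "\<not> ?thesis"
  have le: "y i \<le> x - d" if "i \<in> {1..n}" for i
    using neg that by (meson not_le)
  have pair: "\<bar>y i\<bar> \<le> d / n" if "i \<in> {1..n}" "j \<in> {1..n}" "i \<noteq> j" "y j > x / n" for i j
    using neg that by (meson not_le)
  have n0: "real n > 0" using n by auto
  have "\<exists>j\<in>{1..k}. y j > x / n"
  proof (rule ccontr)
    assume "\<not> ?thesis"
    then have "(\<Sum>i=1..k. y i) \<le> real (card {1..k}) * (x / n)"
      by (intro sum_bounded_above) (auto simp: not_less)
    also have "\<dots> \<le> real n * (x / n)" using n d n0 by (intro mult_right_mono) auto
    finally show False using gt n0 by simp
  qed
  then obtain j where j: "j \<in> {1..k}" "y j > x / n" by blast
  have "(\<Sum>i=1..k. y i) = y j + (\<Sum>i\<in>{1..k} - {j}. y i)"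
    using j by (simp add: sum.remove)
  also have "(\<Sum>i\<in>{1..k} - {j}. y i) \<le> real (card ({1..k} - {j})) * (d / n)"
  proof (intro sum_bounded_above)
    fix i assume "i \<in> {1..k} - {j}"
    then have "\<bar>y i\<bar> \<le> d / n" using j n by (intro pair[of i j]) auto
    then show "y i \<le> d / n" by linarith
  qed
  also have "\<dots> \<le> real n * (d / n)"
    using j n d n0 by (intro mult_right_mono) auto
  also have "\<dots> = d" using n0 by simp
  also have "y j \<le> x - d" using j n by (intro le) auto
  finally show False using gt by linarith
qed

lemma sum_gt_of_single:
  fixes y :: "nat \<Rightarrow> real"
  assumes j: "j \<in> {1..n}" and gt: "y j > x + d" and d: "0 < d"
    and small: "\<And>i. i \<in> {1..n} \<Longrightarrow> i \<noteq> j \<Longrightarrow> \<bar>y i\<bar> \<le> d / n"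
  shows "(\<Sum>i=1..n. y i) > x"
proof -
  have n0: "real n > 0" using j by auto
  have "(\<Sum>i\<in>{1..n} - {j}. - y i) \<le> real (card ({1..n} - {j})) * (d / n)"
    by (intro sum_bounded_above) (use small in \<open>fastforce simp: abs_le_iff\<close>)
  also have "\<dots> \<le> real n * (d / n)"
    using j d n0 by (intro mult_right_mono) auto
  also have "\<dots> = d" using n0 by simp
  finally have "- d \<le> (\<Sum>i\<in>{1..n} - {j}. y i)" by (simp add: sum_negf)
  moreover have "(\<Sum>i=1..n. y i) = y j + (\<Sum>i\<in>{1..n} - {j}. y i)"
    using j by (simp add: sum.remove)
  ultimately show ?thesis using gt by linarith
qed

text \<open>The principle of a single big jump. The margin \<open>d\<close> may depend on the threshold: the tails
  must be insensitive to a shift by \<open>d x\<close>, and it must be unlikely that one summand exceeds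
  \<open>x / n\<close> while another one exceeds \<open>d x / n\<close> in absolute value.\<close>

lemma (in prob_space) max_partial_sums_tail:
  fixes Y :: "nat \<Rightarrow> 'a \<Rightarrow> real" and n :: nat
  defines "T \<equiv> \<lambda>i x. \<P>(\<omega> in M. Y i \<omega> > x)"
  defines "\<psi> \<equiv> \<lambda>x. \<P>(\<omega> in M. Max ((\<lambda>k. \<Sum>i=1..k. Y i \<omega>) ` {1..n}) > x)"
  assumes n: "n \<ge> 1" and Y: "\<And>i. i \<in> {1..n} \<Longrightarrow> Y i \<in> borel_measurable M"
    and T_pos: "\<And>i. i \<in> {1..n} \<Longrightarrow> \<forall>\<^sub>F x in at_top. T i x > 0"
    and hyp: "\<And>\<eta>. 0 < \<eta> \<Longrightarrow> \<exists>d. (\<forall>\<^sub>F x in at_top. 0 < d x \<and> d x \<le> x) \<and>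
      (\<forall>i\<in>{1..n}. \<forall>\<^sub>F x in at_top. T i (x - d x) \<le> (1 + \<eta>) * T i x \<and> T i x \<le> (1 + \<eta>) * T i (x + d x)) \<and>
      (\<forall>i\<in>{1..n}. \<forall>j\<in>{1..n}. i \<noteq> j \<longrightarrow> (\<forall>\<^sub>F x in at_top.
        \<P>(\<omega> in M. \<bar>Y i \<omega>\<bar> > d x / n \<and> Y j \<omega> > x / n) \<le> \<eta> * (\<Sum>k=1..n. T k x)))"
  shows "\<psi> \<sim>[at_top] (\<lambda>x. \<Sum>i=1..n. T i x)"
proof (rule asymp_equivI', rule tendstoI)
  fix e :: real assume e: "0 < e"
  define \<eta> where "\<eta> = min 1 (e / (2 * (1 + real n ^ 2)))"
  have "0 < 1 + real n ^ 2" by (simp add: add_pos_nonneg)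
  then have \<eta>: "0 < \<eta>" "(1 + real n ^ 2) * \<eta> < e"
  proof -
    assume pos: "0 < 1 + real n ^ 2"
    show "0 < \<eta>" using pos e by (simp add: \<eta>_def)
    have "(1 + real n ^ 2) * \<eta> \<le> (1 + real n ^ 2) * (e / (2 * (1 + real n ^ 2)))"
      using pos by (intro mult_left_mono) (auto simp: \<eta>_def)
    also have "\<dots> = e / 2"
    proof -
      have "c * (e / (2 * c)) = e / 2" if "0 < c" for c :: real using that by simp
      from this[OF pos] show ?thesis .
    qed
    finally show "(1 + real n ^ 2) * \<eta> < e" using e by simp
  qed
  obtain d where d: "\<forall>\<^sub>F x in at_top. 0 < d x \<and> d x \<le> x"
    and shift: "\<forall>i\<in>{1..n}. \<forall>\<^sub>F x in at_top. T i (x - d x) \<le> (1 + \<eta>) * T i x \<and> T i x \<le> (1 + \<eta>) * T i (x + d x)"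
    and joint: "\<forall>i\<in>{1..n}. \<forall>j\<in>{1..n}. i \<noteq> j \<longrightarrow> (\<forall>\<^sub>F x in at_top.
        \<P>(\<omega> in M. \<bar>Y i \<omega>\<bar> > d x / n \<and> Y j \<omega> > x / n) \<le> \<eta> * (\<Sum>k=1..n. T k x))"
    using hyp[OF \<eta>(1)] by (elim exE conjE)
  have shift': "\<forall>\<^sub>F x in at_top. \<forall>i\<in>{1..n}. T i (x - d x) \<le> (1 + \<eta>) * T i x \<and> T i x \<le> (1 + \<eta>) * T i (x + d x)"
    using shift by (intro eventually_ball_finite) auto
  have joint': "\<forall>\<^sub>F x in at_top. \<forall>p\<in>{p\<in>{1..n}\<times>{1..n}. fst p \<noteq> snd p}.
      \<P>(\<omega> in M. \<bar>Y (snd p) \<omega>\<bar> > d x / n \<and> Y (fst p) \<omega> > x / n) \<le> \<eta> * (\<Sum>k=1..n. T k x)"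
    using joint by (intro eventually_ball_finite) auto
  have T_pos': "\<forall>\<^sub>F x in at_top. \<forall>i\<in>{1..n}. T i x > 0"
    using T_pos by (intro eventually_ball_finite) auto
  have T_nonneg: "0 \<le> T i x" for i x by (simp add: T_def)
  show "\<forall>\<^sub>F x in at_top. dist (\<psi> x / (\<Sum>i=1..n. T i x)) 1 < e"
    using d shift' joint' T_pos'
  proof eventually_elim
    case (elim x)
    define S where "S = (\<Sum>i=1..n. T i x)"
    define J where "J i j = {\<omega>\<in>space M. \<bar>Y i \<omega>\<bar> > d x / n \<and> Y j \<omega> > x / n}" for i j
    have S_pos: "0 < S" unfolding S_def using elim n by (intro sum_pos) auto
    have d0: "0 < d x" "d x \<le> x" using elim by auto
    have n0: "real n > 0" using n by simp
    note [measurable] = Y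
    have J: "prob (J i j) \<le> \<eta> * S" "J i j \<in> events" if "i \<in> {1..n}" "j \<in> {1..n}" "i \<noteq> j" for i j
    proof -
      show "prob (J i j) \<le> \<eta> * S" using elim(3) that unfolding J_def S_def by fastforce
      have [measurable]: "Y i \<in> borel_measurable M" "Y j \<in> borel_measurable M" using Y that by auto
      show "J i j \<in> events" unfolding J_def by measurable
    qed
    define JJ where "JJ = (\<Union>j\<in>{1..n}. \<Union>i\<in>{1..n} - {j}. J i j)"
    have JJ_le: "(\<Sum>j\<in>{1..n}. \<Sum>i\<in>{1..n} - {j}. prob (J i j)) \<le> real n ^ 2 * \<eta> * S"
    proof -
      have "(\<Sum>j\<in>{1..n}. \<Sum>i\<in>{1..n} - {j}. prob (J i j)) \<le> (\<Sum>j\<in>{1..n}. \<Sum>i\<in>{1..n} - {j}. \<eta> * S)"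
        by (intro sum_mono J) auto
      also have "\<dots> \<le> (\<Sum>j\<in>{1..n}. \<Sum>i\<in>{1..n}. \<eta> * S)"
        using \<eta> S_pos by (intro sum_mono sum_mono2) auto
      also have "\<dots> = real n ^ 2 * \<eta> * S" by (simp add: power2_eq_square)
      finally show ?thesis .
    qed
    have max_meas[measurable]: "(\<lambda>\<omega>. Max ((\<lambda>k. \<Sum>i=1..k. Y i \<omega>) ` {1..n})) \<in> borel_measurable M"
      using n by (intro borel_measurable_Max) (auto intro!: borel_measurable_sum Y)
    have ev: "{\<omega>\<in>space M. Y i \<omega> > y} \<in> events" if "i \<in> {1..n}" for i y
      using Y[OF that] by measurable
    have upper: "\<psi> x \<le> (1 + (1 + real n ^ 2) * \<eta>) * S"
    proof -
      have "\<psi> x \<le> prob ((\<Union>i\<in>{1..n}. {\<omega>\<in>space M. Y i \<omega> > x - d x}) \<union> JJ)"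
        unfolding \<psi>_def
      proof (rule finite_measure_mono)
        show "(\<Union>i\<in>{1..n}. {\<omega>\<in>space M. Y i \<omega> > x - d x}) \<union> JJ \<in> events"
          unfolding JJ_def by (intro sets.Un sets.finite_UN ev J) auto
        show "{\<omega>\<in>space M. x < Max ((\<lambda>k. \<Sum>i=1..k. Y i \<omega>) ` {1..n})}
            \<subseteq> (\<Union>i\<in>{1..n}. {\<omega>\<in>space M. Y i \<omega> > x - d x}) \<union> JJ"
        proof
          fix \<omega> assume w: "\<omega> \<in> {\<omega>\<in>space M. x < Max ((\<lambda>k. \<Sum>i=1..k. Y i \<omega>) ` {1..n})}"
          then obtain k where "k \<in> {1..n}" "x < (\<Sum>i=1..k. Y i \<omega>)"
            using n by (auto simp: Max_gr_iff)
          from partial_sums_gt_imp[OF this d0] w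
          show "\<omega> \<in> (\<Union>i\<in>{1..n}. {\<omega>\<in>space M. Y i \<omega> > x - d x}) \<union> JJ"
            unfolding JJ_def J_def by blast
        qed
      qed
      also have "\<dots> \<le> prob (\<Union>i\<in>{1..n}. {\<omega>\<in>space M. Y i \<omega> > x - d x}) + prob JJ"
        unfolding JJ_def by (intro measure_Un_le sets.finite_UN ev J) auto
      also have "prob (\<Union>i\<in>{1..n}. {\<omega>\<in>space M. Y i \<omega> > x - d x}) \<le> (\<Sum>i=1..n. T i (x - d x))"
        unfolding T_def by (intro measure_UNION_le ev) auto
      also have "\<dots> \<le> (\<Sum>i=1..n. (1 + \<eta>) * T i x)" using elim(2) by (intro sum_mono) auto
      also have "\<dots> = (1 + \<eta>) * S" by (simp add: S_def sum_distrib_left)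
      also have "prob JJ \<le> (\<Sum>j\<in>{1..n}. prob (\<Union>i\<in>{1..n} - {j}. J i j))"
        unfolding JJ_def by (intro measure_UNION_le sets.finite_UN J) auto
      also have "\<dots> \<le> (\<Sum>j\<in>{1..n}. \<Sum>i\<in>{1..n} - {j}. prob (J i j))"
        by (intro sum_mono measure_UNION_le J) auto
      also note JJ_le
      finally show ?thesis by (simp add: algebra_simps)
    qed
    define E where "E j = {\<omega>\<in>space M. Y j \<omega> > x + d x} - (\<Union>i\<in>{1..n} - {j}. J i j)" for j
    have E: "E j \<in> events" if "j \<in> {1..n}" for j
      unfolding E_def using that by (intro sets.Diff sets.finite_UN ev J) auto
    have xn: "x / n \<le> x" "d x / n \<le> d x" using d0 n by (auto simp: divide_le_eq mult_left_le)
    have E_small: "\<bar>Y i \<omega>\<bar> \<le> d x / n" if "\<omega> \<in> E j" "i \<in> {1..n}" "i \<noteq> j" "j \<in> {1..n}" for i j \<omega>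
      using that xn d0 unfolding E_def J_def by fastforce
    have lower: "(1 - (1 + real n ^ 2) * \<eta>) * S \<le> \<psi> x"
    proof -
      have "(1 - \<eta>) * S - real n ^ 2 * \<eta> * S \<le>
          (\<Sum>j=1..n. T j (x + d x)) - (\<Sum>j\<in>{1..n}. \<Sum>i\<in>{1..n} - {j}. prob (J i j))"
      proof (rule diff_mono[OF _ JJ_le])
        have "(1 - \<eta>) * T j x \<le> T j (x + d x)" if "j \<in> {1..n}" for j
        proof (cases "\<eta> \<le> 1")
          case True
          have "(1 - \<eta>) * T j x \<le> (1 - \<eta>) * ((1 + \<eta>) * T j (x + d x))"
            using elim(2) that True by (intro mult_left_mono) auto
          also have "\<dots> = T j (x + d x) - \<eta> * \<eta> * T j (x + d x)" by (simp add: algebra_simps)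
          also have "\<dots> \<le> T j (x + d x)" using T_nonneg by simp
          finally show ?thesis .
        qed (simp add: \<eta>_def)
        then have "(\<Sum>j=1..n. (1 - \<eta>) * T j x) \<le> (\<Sum>j=1..n. T j (x + d x))" by (intro sum_mono) auto
        then show "(1 - \<eta>) * S \<le> (\<Sum>j=1..n. T j (x + d x))" by (simp add: S_def sum_distrib_left)
      qed
      also have "\<dots> = (\<Sum>j=1..n. T j (x + d x) - (\<Sum>i\<in>{1..n} - {j}. prob (J i j)))"
        by (simp add: sum_subtractf)
      also have "\<dots> \<le> (\<Sum>j=1..n. prob (E j))"
      proof (rule sum_mono)
        fix j assume j: "j \<in> {1..n}"
        let ?A = "{\<omega>\<in>space M. Y j \<omega> > x + d x}" and ?U = "\<Union>i\<in>{1..n} - {j}. J i j"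
        have U: "?U \<in> events" using j by (intro sets.finite_UN J) auto
        have "prob ?A = prob (?A - ?U) + prob (?A \<inter> ?U)"
          using ev[OF j] U by (subst finite_measure_Union[symmetric]) (auto intro!: arg_cong[where f = prob])
        also have "prob (?A \<inter> ?U) \<le> prob ?U" using U by (intro finite_measure_mono) auto
        also have "\<dots> \<le> (\<Sum>i\<in>{1..n} - {j}. prob (J i j))" using j by (intro measure_UNION_le J) auto
        finally show "T j (x + d x) - (\<Sum>i\<in>{1..n} - {j}. prob (J i j)) \<le> prob (E j)"
          by (simp add: T_def E_def)
      qed
      also have "\<dots> = prob (\<Union>j\<in>{1..n}. E j)"
      proof (rule finite_measure_finite_Union[symmetric])
        \<comment> \<open>On \<open>E j\<close> only the summand \<open>j\<close> exceeds \<open>d x / n\<close> in absolute value.\<close>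
        show "disjoint_family_on E {1..n}"
          unfolding disjoint_family_on_def
        proof (intro ballI impI equals0I)
          fix i j \<omega> assume ij: "i \<in> {1..n}" "j \<in> {1..n}" "i \<noteq> j" and w: "\<omega> \<in> E i \<inter> E j"
          have "\<bar>Y i \<omega>\<bar> \<le> d x / n" using w ij by (intro E_small[of \<omega> j i]) auto
          moreover have "Y i \<omega> > x + d x" using w by (simp add: E_def)
          ultimately show False using xn d0 by linarith
        qed
      qed (use E in auto)
      also have "\<dots> \<le> \<psi> x"
        unfolding \<psi>_def
      proof (rule finite_measure_mono)
        show "(\<Union>j\<in>{1..n}. E j) \<subseteq> {\<omega>\<in>space M. x < Max ((\<lambda>k. \<Sum>i=1..k. Y i \<omega>) ` {1..n})}"
        proof
          fix \<omega> assume "\<omega> \<in> (\<Union>j\<in>{1..n}. E j)"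
          then obtain j where j: "j \<in> {1..n}" "\<omega> \<in> E j" by blast
          then have "Y j \<omega> > x + d x" "\<omega> \<in> space M" by (auto simp: E_def)
          then have "(\<Sum>i=1..n. Y i \<omega>) > x"
            using j d0 by (intro sum_gt_of_single[where d = "d x"] E_small) auto
          also have "(\<Sum>i=1..n. Y i \<omega>) \<le> Max ((\<lambda>k. \<Sum>i=1..k. Y i \<omega>) ` {1..n})"
            using n by (intro Max_ge) auto
          finally show "\<omega> \<in> {\<omega>\<in>space M. x < Max ((\<lambda>k. \<Sum>i=1..k. Y i \<omega>) ` {1..n})}"
            using \<open>\<omega> \<in> space M\<close> by simp
        qed
      qed measurable
      finally show ?thesis by (simp add: algebra_simps)
    qed
    have "\<bar>\<psi> x - S\<bar> \<le> (1 + real n ^ 2) * \<eta> * S"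
      using upper lower by (simp add: abs_le_iff algebra_simps)
    then have "\<bar>\<psi> x - S\<bar> / S \<le> (1 + real n ^ 2) * \<eta>" using S_pos by (simp add: divide_le_eq)
    moreover have "\<psi> x / S - 1 = (\<psi> x - S) / S" using S_pos by (simp add: field_simps)
    ultimately show ?case using \<eta>(2) S_pos unfolding S_def[symmetric] by (simp add: dist_real_def abs_divide)
  qed
qed

section \<open>Distribution classes\<close>

lemma class_D_dominated:
  assumes "F \<in> class_D" "\<And>x. 0 < tail F x" "0 < b" "b < 1"
  shows "\<exists>K. \<forall>\<^sub>F x in at_top. tail F (b * x) \<le> K * tail F x"
proof -
  have "Limsup at_top (\<lambda>x. ereal (tail F (b * x) / tail F x)) < \<infinity>"
    using assms unfolding class_D_def by blast
  then obtain K :: nat where "Limsup at_top (\<lambda>x. ereal (tail F (b * x) / tail F x)) < ereal (real K)"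
    using less_PInf_Ex_of_nat by auto
  from Limsup_lessD[OF this] have "\<forall>\<^sub>F x in at_top. tail F (b * x) \<le> real K * tail F x"
    by eventually_elim (use assms(2) in \<open>simp add: divide_less_eq less_imp_le\<close>)
  then show ?thesis by blast
qed

lemma class_C_shift:
  assumes "F \<in> class_C" "\<And>x. 0 < tail F x" "0 < \<eta>"
  shows "\<exists>v<1. \<forall>\<^sub>F x in at_top. tail F (v * x) \<le> (1 + \<eta>) * tail F x"
proof -
  have "((\<lambda>v. Limsup at_top (\<lambda>x. ereal (tail F (v * x) / tail F x))) \<longlongrightarrow> 1) (at_left 1)"
    using assms unfolding class_C_def by blast
  moreover have "1 < ereal (1 + \<eta>)" using assms(3) by simp
  ultimately have "\<forall>\<^sub>F v in at_left 1. Limsup at_top (\<lambda>x. ereal (tail F (v * x) / tail F x)) < ereal (1 + \<eta>)"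
    by (rule order_tendstoD(2))
  moreover have "\<forall>\<^sub>F v in at_left (1::real). v < 1" by (simp add: eventually_at_filter)
  ultimately have "\<forall>\<^sub>F v in at_left 1. v < 1 \<and>
      Limsup at_top (\<lambda>x. ereal (tail F (v * x) / tail F x)) < ereal (1 + \<eta>)"
    by eventually_elim simp
  then have "\<exists>v. v < 1 \<and> Limsup at_top (\<lambda>x. ereal (tail F (v * x) / tail F x)) < ereal (1 + \<eta>)"
    by (rule eventually_happens'[OF trivial_limit_at_left_real])
  then obtain v where v: "v < 1" "Limsup at_top (\<lambda>x. ereal (tail F (v * x) / tail F x)) < ereal (1 + \<eta>)"
    by (elim exE conjE)
  from Limsup_lessD[OF v(2)] have "\<forall>\<^sub>F x in at_top. tail F (v * x) \<le> (1 + \<eta>) * tail F x"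
    by eventually_elim (use assms(2) in \<open>simp add: divide_less_eq less_imp_le\<close>)
  with v(1) show ?thesis by blast
qed

lemma class_R_shift:
  assumes "F \<in> class_R \<alpha>" "\<And>x. 0 < tail F x" "0 < \<eta>"
  shows "\<exists>v<1. \<forall>\<^sub>F x in at_top. tail F (v * x) \<le> (1 + \<eta>) * tail F x"
proof -
  have "((\<lambda>v. v powr (- \<alpha>)) \<longlongrightarrow> 1 powr (- \<alpha>)) (at_left (1::real))"
    by (intro tendsto_intros) auto
  from order_tendstoD(2)[OF this, of "1 + \<eta>"]
  have "\<forall>\<^sub>F v in at_left (1::real). v powr (- \<alpha>) < 1 + \<eta>"
    using assms(3) by simp
  moreover have "\<forall>\<^sub>F v in at_left (1::real). v \<in> {0<..<1}"
    by (rule eventually_at_left_real) simp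
  ultimately have "\<forall>\<^sub>F v in at_left (1::real). v \<in> {0<..<1} \<and> v powr (- \<alpha>) < 1 + \<eta>"
    by eventually_elim simp
  then have "\<exists>v. v \<in> {0<..<1} \<and> v powr (- \<alpha>) < 1 + \<eta>"
    by (rule eventually_happens'[OF trivial_limit_at_left_real])
  then obtain v where v: "0 < v" "v < 1" "v powr (- \<alpha>) < 1 + \<eta>" by auto
  have "((\<lambda>x. tail F (v * x) / tail F x) \<longlongrightarrow> v powr (- \<alpha>)) at_top"
    using assms(1) v(1) unfolding class_R_def by blast
  from order_tendstoD(2)[OF this v(3)] have "\<forall>\<^sub>F x in at_top. tail F (v * x) \<le> (1 + \<eta>) * tail F x"
    by eventually_elim (use assms(2) in \<open>simp add: divide_less_eq less_imp_le\<close>)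
  with v(2) show ?thesis by blast
qed

text \<open>Asymptotic equivalence may be summed because all terms are positive.\<close>

lemma asymp_equiv_sum_of_ratios:
  fixes T G :: "'b \<Rightarrow> real \<Rightarrow> real"
  assumes I: "finite I" "I \<noteq> {}" and pos: "\<And>i x. i \<in> I \<Longrightarrow> 0 < G i x" "\<And>i. i \<in> I \<Longrightarrow> 0 < c i"
    and lim: "\<And>i. i \<in> I \<Longrightarrow> ((\<lambda>x. T i x / G i x) \<longlongrightarrow> c i) at_top"
  shows "(\<lambda>x. \<Sum>i\<in>I. T i x) \<sim>[at_top] (\<lambda>x. \<Sum>i\<in>I. c i * G i x)"
proof (rule asymp_equivI', rule tendstoI)
  fix e :: real assume e: "0 < e"
  have "\<forall>\<^sub>F x in at_top. \<forall>i\<in>I. \<bar>T i x - c i * G i x\<bar> \<le> e / 2 * (c i * G i x)"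
  proof (intro eventually_ball_finite I ballI)
    fix i assume i: "i \<in> I"
    have "\<forall>\<^sub>F x in at_top. dist (T i x / G i x) (c i) < e / 2 * c i"
      using lim[OF i] pos(2)[OF i] e by (intro tendstoD) auto
    then show "\<forall>\<^sub>F x in at_top. \<bar>T i x - c i * G i x\<bar> \<le> e / 2 * (c i * G i x)"
    proof eventually_elim
      case (elim x)
      have "T i x - c i * G i x = (T i x / G i x - c i) * G i x"
        using pos(1)[OF i, of x] by (simp add: field_simps)
      then have "\<bar>T i x - c i * G i x\<bar> = dist (T i x / G i x) (c i) * G i x"
        using pos(1)[OF i, of x] by (simp add: dist_real_def abs_mult)
      also have "\<dots> \<le> e / 2 * c i * G i x"
        using elim pos(1)[OF i, of x] by (intro mult_right_mono) auto
      finally show ?case by (simp add: mult.assoc)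
    qed
  qed
  then show "\<forall>\<^sub>F x in at_top. dist ((\<Sum>i\<in>I. T i x) / (\<Sum>i\<in>I. c i * G i x)) 1 < e"
  proof eventually_elim
    case (elim x)
    define S where "S = (\<Sum>i\<in>I. c i * G i x)"
    have S: "0 < S" unfolding S_def using pos by (intro sum_pos I) auto
    have "(\<Sum>i\<in>I. T i x) / S - 1 = (\<Sum>i\<in>I. T i x - c i * G i x) / S"
      using S by (simp add: sum_subtractf S_def[symmetric] diff_divide_distrib)
    then have "dist ((\<Sum>i\<in>I. T i x) / S) 1 = \<bar>\<Sum>i\<in>I. T i x - c i * G i x\<bar> / S"
      using S by (simp add: dist_real_def abs_divide)
    also have "\<dots> \<le> (\<Sum>i\<in>I. e / 2 * (c i * G i x)) / S"
      using elim S by (intro divide_right_mono order_trans[OF sum_abs] sum_mono) auto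
    also have "(\<Sum>i\<in>I. e / 2 * (c i * G i x)) = e / 2 * S" by (simp only: S_def sum_distrib_left)
    also have "e / 2 * S / S = e / 2" using S by simp
    also have "\<dots> < e" using e by simp
    finally show ?case unfolding S_def .
  qed
qed

section \<open>Risk models\<close>

text \<open>The left-hand side does not depend on \<open>y\<close>, while the right-hand side tends to 0 as \<open>y\<close> tends to
  infinity with \<open>x\<close> fixed. Hence the left-hand side vanishes for large \<open>x\<close>.\<close>

lemma (in prob_space) weights_bounded:
  fixes \<Theta> :: "'a \<Rightarrow> real"
  assumes [measurable]: "\<Theta> \<in> borel_measurable M" "Z \<in> borel_measurable M"
    and small: "(\<lambda>(x, y). \<P>(\<omega> in M. \<Theta> \<omega> > b x)) \<in>
        o[at_top \<times>\<^sub>F at_top](\<lambda>(x::real, y::real). \<P>(\<omega> in M. W \<omega> > x \<and> Z \<omega> > y))"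
  shows "\<exists>B. AE \<omega> in M. \<Theta> \<omega> \<le> B"
proof -
  have "\<forall>\<^sub>F p in at_top \<times>\<^sub>F at_top. norm ((\<lambda>(x, y). \<P>(\<omega> in M. \<Theta> \<omega> > b x)) p) \<le>
      1 * norm ((\<lambda>(x::real, y::real). \<P>(\<omega> in M. W \<omega> > x \<and> Z \<omega> > y)) p)"
    using landau_o.smallD[OF small, of 1] by simp
  then obtain P Q where PQ: "eventually P at_top" "eventually Q at_top"
      "\<And>x y. P x \<Longrightarrow> Q y \<Longrightarrow> \<P>(\<omega> in M. \<Theta> \<omega> > b x) \<le> \<P>(\<omega> in M. W \<omega> > x \<and> Z \<omega> > y)"
    unfolding eventually_prod_filter by auto
  obtain x where x: "P x" using eventually_happens'[OF trivial_limit_at_top_linorder PQ(1)] by (elim exE)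
  have le: "\<P>(\<omega> in M. \<Theta> \<omega> > b x) \<le> \<P>(\<omega> in M. Z \<omega> > y)" if "Q y" for y
    using PQ(3)[OF x that] by (rule order_trans) (intro finite_measure_mono; auto)
  have "((\<lambda>y. \<P>(\<omega> in M. Z \<omega> > y)) \<longlongrightarrow> 0) at_top"
  proof -
    interpret rd: real_distribution "distr M borel Z" by (rule real_distribution_distr) measurable
    have "(\<lambda>y. \<P>(\<omega> in M. Z \<omega> > y)) = (\<lambda>y. 1 - cdf (distr M borel Z) y)"
      by (simp add: prob_gt_eq_cdf)
    moreover have "((\<lambda>y. 1 - cdf (distr M borel Z) y) \<longlongrightarrow> 1 - 1) at_top"
      by (intro tendsto_intros rd.cdf_lim_at_top_prob)
    ultimately show ?thesis by simp
  qed
  moreover have "\<forall>\<^sub>F y in at_top. \<P>(\<omega> in M. \<Theta> \<omega> > b x) \<le> \<P>(\<omega> in M. Z \<omega> > y)"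
    using PQ(2) by eventually_elim (rule le)
  ultimately have "\<P>(\<omega> in M. \<Theta> \<omega> > b x) \<le> 0"
    by (rule tendsto_lowerbound) simp
  then have "\<P>(\<omega> in M. \<Theta> \<omega> > b x) = 0" by (simp add: measure_le_0_iff)
  then have "AE \<omega> in M. \<not> \<Theta> \<omega> > b x" by (subst (asm) prob_eq_0) auto
  then show ?thesis by (intro exI[of _ "b x"]) (auto simp: not_less)
qed

lemma (in prob_space) prob_weighted_pair_le:
  assumes [measurable]: "X1 \<in> borel_measurable M" "X2 \<in> borel_measurable M"
    and B: "0 < B" and Th: "AE \<omega> in M. 0 \<le> \<Theta>1 \<omega> \<and> \<Theta>1 \<omega> \<le> B" "AE \<omega> in M. 0 \<le> \<Theta>2 \<omega> \<and> \<Theta>2 \<omega> \<le> B"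
    and v: "0 \<le> v"
  shows "\<P>(\<omega> in M. \<bar>\<Theta>1 \<omega> * X1 \<omega>\<bar> > u \<and> \<Theta>2 \<omega> * X2 \<omega> > v) \<le>
    \<P>(\<omega> in M. \<bar>X1 \<omega>\<bar> > u / B \<and> X2 \<omega> > v / (B :: real))"
proof (rule finite_measure_mono_AE)
  show "AE \<omega> in M. \<omega> \<in> {\<omega>\<in>space M. \<bar>\<Theta>1 \<omega> * X1 \<omega>\<bar> > u \<and> \<Theta>2 \<omega> * X2 \<omega> > v} \<longrightarrow>
      \<omega> \<in> {\<omega>\<in>space M. \<bar>X1 \<omega>\<bar> > u / B \<and> X2 \<omega> > v / B}"
    using Th
  proof eventually_elim
    case (elim \<omega>)
    show ?case
    proof (intro impI, elim CollectE conjE, intro CollectI conjI)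
      assume u: "\<bar>\<Theta>1 \<omega> * X1 \<omega>\<bar> > u" and v': "\<Theta>2 \<omega> * X2 \<omega> > v"
      have "\<bar>\<Theta>1 \<omega> * X1 \<omega>\<bar> \<le> B * \<bar>X1 \<omega>\<bar>"
        using elim(1) by (auto simp: abs_mult intro: mult_right_mono)
      then have "u < \<bar>X1 \<omega>\<bar> * B" using u by (simp add: mult.commute)
      then show "\<bar>X1 \<omega>\<bar> > u / B" using B by (simp add: divide_less_eq)
      have "X2 \<omega> > 0"
      proof (rule ccontr)
        assume "\<not> X2 \<omega> > 0"
        then have "\<Theta>2 \<omega> * X2 \<omega> \<le> 0" using elim(2) by (intro mult_nonneg_nonpos) auto
        then show False using v v' by linarith
      qed
      then have "\<Theta>2 \<omega> * X2 \<omega> \<le> B * X2 \<omega>" using elim(2) by (intro mult_right_mono) auto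
      then have "v < X2 \<omega> * B" using v' by (simp add: mult.commute)
      then show "X2 \<omega> > v / B" using B by (simp add: divide_less_eq)
    qed
  qed
qed measurable

context prob_space
begin

lemma bounded_weight_exists:
  fixes X \<Theta> :: "'a \<Rightarrow> real" and F h :: "real \<Rightarrow> real"
  assumes X[measurable]: "X \<in> borel_measurable M" and \<Theta>[measurable]: "\<Theta> \<in> borel_measurable M"
    and F: "F = cdf (distr M borel X)" and F_pos: "\<And>x. x \<ge> 0 \<Longrightarrow> tail F x > 0" and F_D: "F \<in> class_D"
    and nonneg: "AE \<omega> in M. \<Theta> \<omega> \<ge> 0" and nondeg: "\<not> (AE \<omega> in M. \<Theta> \<omega> = 0)"
    and le_B: "AE \<omega> in M. \<Theta> \<omega> \<le> B" and B: "1 \<le> B"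
    and h_pos: "\<And>t. t \<ge> 0 \<Longrightarrow> h t > 0"
    and def: "\<forall>\<^sub>F x in at_top. \<forall>t \<in> rv_support M \<Theta>.
        lim_cond_prob_defined M (\<lambda>\<omega>. X \<omega> > x) (window \<Theta> t)"
    and asymp: "unif_asymp_equiv at_top (rv_support M \<Theta>)
        (\<lambda>x t. lim_cond_prob M (\<lambda>\<omega>. X \<omega> > x) (window \<Theta> t))
        (\<lambda>x t. h t * \<P>(\<omega> in M. X \<omega> > x))"
  shows "\<exists>k C. bounded_weight M X \<Theta> k C B \<and> (AE \<omega> in M. k (\<Theta> \<omega>) = h (\<Theta> \<omega>))"
proof -
  have tail: "tail F x = \<P>(\<omega> in M. X \<omega> > x)" for x unfolding F by (rule tail_cdf_distr) fact
  have pos: "0 < \<P>(\<omega> in M. X \<omega> > x)" for x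
  proof -
    have "0 < \<P>(\<omega> in M. X \<omega> > max x 0)" using F_pos[of "max x 0"] by (simp add: tail)
    also have "\<dots> \<le> \<P>(\<omega> in M. X \<omega> > x)" by (intro finite_measure_mono) auto
    finally show ?thesis .
  qed
  obtain k C where k: "k \<in> borel_measurable borel" "\<And>t. 0 \<le> k t" "\<And>t. k t \<le> C"
    and kh: "AE \<omega> in M. k (\<Theta> \<omega>) = h (\<Theta> \<omega>)"
    and dens: "\<And>e. 0 < e \<Longrightarrow> \<forall>\<^sub>F x in at_top. \<forall>A\<in>sets borel.
      \<bar>\<P>(\<omega> in M. X \<omega> > x \<and> \<Theta> \<omega> \<in> A) - \<P>(\<omega> in M. X \<omega> > x) * (\<integral>\<omega>. k (\<Theta> \<omega>) * indicator A (\<Theta> \<omega>) \<partial>M)\<bar>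
        \<le> e * (\<P>(\<omega> in M. X \<omega> > x) * (\<integral>\<omega>. k (\<Theta> \<omega>) * indicator A (\<Theta> \<omega>) \<partial>M))"
    by (rule uniform_conditional_density[OF X \<Theta> pos nonneg h_pos def asymp]) (assumption, rule that)
  note [measurable] = k(1)
  have "bounded_weight M X \<Theta> k C B"
  proof (unfold_locales; (fact X \<Theta> k B pos dens)?)
    show "AE \<omega> in M. 0 \<le> \<Theta> \<omega> \<and> \<Theta> \<omega> \<le> B" using nonneg le_B by eventually_elim auto
    have int: "integrable M (\<lambda>\<omega>. k (\<Theta> \<omega>) * indicator {0<..} (\<Theta> \<omega>))"
      using k(2,3) order_trans[OF k(2) k(3)]
      by (intro integrable_const_bound[where B = C]) (auto simp: indicator_def)
    have nn: "AE \<omega> in M. 0 \<le> k (\<Theta> \<omega>) * indicator {0<..} (\<Theta> \<omega>)" using k(2) by simp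
    have "(\<integral>\<omega>. k (\<Theta> \<omega>) * indicator {0<..} (\<Theta> \<omega>) \<partial>M) \<noteq> 0"
    proof
      assume "(\<integral>\<omega>. k (\<Theta> \<omega>) * indicator {0<..} (\<Theta> \<omega>) \<partial>M) = 0"
      then have "AE \<omega> in M. k (\<Theta> \<omega>) * indicator {0<..} (\<Theta> \<omega>) = 0"
        using integral_nonneg_eq_0_iff_AE[OF int nn] by simp
      then have "AE \<omega> in M. \<Theta> \<omega> = 0"
        using kh nonneg
      proof eventually_elim
        case (elim \<omega>)
        then show ?case using h_pos[of "\<Theta> \<omega>"] by (auto simp: indicator_def split: if_splits)
      qed
      then show False using nondeg by simp
    qed
    then show "0 < (\<integral>\<omega>. k (\<Theta> \<omega>) * indicator {0<..} (\<Theta> \<omega>) \<partial>M)"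
      using integral_nonneg_AE[OF nn] by linarith
    show "\<exists>K. \<forall>\<^sub>F x in at_top. \<P>(\<omega> in M. X \<omega> > b * x) \<le> K * \<P>(\<omega> in M. X \<omega> > x)" if "0 < b" "b < 1" for b
      using class_D_dominated[OF F_D _ that] pos by (simp add: tail)
  qed
  then show ?thesis using kh by blast
qed

text \<open>The bound on \<open>\<bar>\<Theta>1 * X1\<bar>\<close> is a constant \<open>a\<close> here: it has to be large, but it need
  not grow with \<open>x\<close>.\<close>

lemma weighted_pair_small_of_TAI:
  fixes X1 X2 \<Theta>1 \<Theta>2 :: "'a \<Rightarrow> real"
  assumes X1[measurable]: "X1 \<in> borel_measurable M" and bw2: "bounded_weight M X2 \<Theta>2 k2 C2 B"
    and \<Theta>1: "AE \<omega> in M. 0 \<le> \<Theta>1 \<omega> \<and> \<Theta>1 \<omega> \<le> B"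
    and TAI: "((\<lambda>(x, y). \<P>(\<omega> in M. \<bar>X1 \<omega>\<bar> > x \<bar> X2 \<omega> > y)) \<longlongrightarrow> 0) (at_top \<times>\<^sub>F at_top)"
    and c: "0 < c" and \<eta>: "0 < \<eta>"
  obtains N where "\<And>a. a \<ge> N \<Longrightarrow> \<forall>\<^sub>F x in at_top.
    \<P>(\<omega> in M. \<bar>\<Theta>1 \<omega> * X1 \<omega>\<bar> > a \<and> \<Theta>2 \<omega> * X2 \<omega> > c * x) \<le> \<eta> * \<P>(\<omega> in M. \<Theta>2 \<omega> * X2 \<omega> > x)"
proof -
  interpret W: bounded_weight M X2 \<Theta>2 k2 C2 B by fact
  have B: "0 < B" using W.B by simp
  obtain Q where Q: "0 < Q" "\<forall>\<^sub>F x in at_top. W.G (c / B * x) \<le> Q * W.T x"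
    using W.G_dominated_by_T[of "c / B"] c B by auto
  have "\<forall>\<^sub>F p in at_top \<times>\<^sub>F at_top. (\<lambda>(x, y). \<P>(\<omega> in M. \<bar>X1 \<omega>\<bar> > x \<bar> X2 \<omega> > y)) p < \<eta> / Q"
    using order_tendstoD(2)[OF TAI] \<eta> Q(1) by simp
  then obtain P1 P2 where P: "eventually P1 at_top" "eventually P2 at_top"
      "\<And>x y. P1 x \<Longrightarrow> P2 y \<Longrightarrow> \<P>(\<omega> in M. \<bar>X1 \<omega>\<bar> > x \<bar> X2 \<omega> > y) < \<eta> / Q"
    unfolding eventually_prod_filter by auto
  obtain N where N: "\<And>x. x \<ge> N \<Longrightarrow> P1 x" using P(1) unfolding eventually_at_top_linorder by blast
  have "filterlim (\<lambda>x. c / B * x) at_top at_top"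
    using c B by (intro filterlim_tendsto_pos_mult_at_top[OF tendsto_const] filterlim_ident) simp
  from eventually_compose_filterlim[OF P(2) this] have P2: "\<forall>\<^sub>F x in at_top. P2 (c / B * x)" .
  show thesis
  proof (rule that)
    fix a assume a: "B * N \<le> a"
    show "\<forall>\<^sub>F x in at_top. \<P>(\<omega> in M. \<bar>\<Theta>1 \<omega> * X1 \<omega>\<bar> > a \<and> \<Theta>2 \<omega> * X2 \<omega> > c * x)
        \<le> \<eta> * \<P>(\<omega> in M. \<Theta>2 \<omega> * X2 \<omega> > x)"
      using P2 Q(2) eventually_ge_at_top[of 0]
    proof eventually_elim
      case (elim x)
      let ?y = "c / B * x"
      have aN: "P1 (a / B)" using a B by (intro N) (simp add: le_divide_eq mult.commute)
      have "\<P>(\<omega> in M. \<bar>\<Theta>1 \<omega> * X1 \<omega>\<bar> > a \<and> \<Theta>2 \<omega> * X2 \<omega> > c * x)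
          \<le> \<P>(\<omega> in M. \<bar>X1 \<omega>\<bar> > a / B \<and> X2 \<omega> > c * x / B)"
        using elim c B by (intro prob_weighted_pair_le X1 W.X \<Theta>1 W.\<Theta>_range) auto
      also have "\<dots> = \<P>(\<omega> in M. \<bar>X1 \<omega>\<bar> > a / B \<bar> X2 \<omega> > ?y) * W.G ?y"
        using W.G_pos[of ?y] by (simp add: cond_prob_def W.G_def)
      also have "\<dots> \<le> \<eta> / Q * (Q * W.T x)"
        using P(3)[OF aN elim(1)] elim(2) \<eta> Q(1) W.G_pos[of ?y] by (intro mult_mono) auto
      also have "\<dots> = \<eta> * W.T x" using Q(1) by simp
      finally show ?case by (simp add: W.T_def)
    qed
  qed
qed

text \<open>Both thresholds are proportional to \<open>x\<close> here, as the hypothesis concerns equal thresholds; the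
  constants \<open>c1\<close>, \<open>c2\<close> and \<open>1 / B\<close> are absorbed by dominated variation.\<close>

lemma weighted_pair_small_of_QAI:
  fixes X1 X2 \<Theta>1 \<Theta>2 :: "'a \<Rightarrow> real"
  assumes bw1: "bounded_weight M X1 \<Theta>1 k1 C1 B" and bw2: "bounded_weight M X2 \<Theta>2 k2 C2 B"
    and QAI: "((\<lambda>x. \<P>(\<omega> in M. max (X1 \<omega>) 0 > x \<and> max (X2 \<omega>) 0 > x) /
           (\<P>(\<omega> in M. X1 \<omega> > x) + \<P>(\<omega> in M. X2 \<omega> > x))) \<longlongrightarrow> 0) at_top"
      "((\<lambda>x. \<P>(\<omega> in M. - min (X1 \<omega>) 0 > x \<and> X2 \<omega> > x) /
           (\<P>(\<omega> in M. X1 \<omega> > x) + \<P>(\<omega> in M. X2 \<omega> > x))) \<longlongrightarrow> 0) at_top"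
    and c: "0 < c1" "0 < c2" and \<eta>: "0 < \<eta>"
  shows "\<forall>\<^sub>F x in at_top. \<P>(\<omega> in M. \<bar>\<Theta>1 \<omega> * X1 \<omega>\<bar> > c1 * x \<and> \<Theta>2 \<omega> * X2 \<omega> > c2 * x)
    \<le> \<eta> * (\<P>(\<omega> in M. \<Theta>1 \<omega> * X1 \<omega> > x) + \<P>(\<omega> in M. \<Theta>2 \<omega> * X2 \<omega> > x))"
proof -
  interpret W1: bounded_weight M X1 \<Theta>1 k1 C1 B by fact
  interpret W2: bounded_weight M X2 \<Theta>2 k2 C2 B by fact
  note [measurable] = W1.X W2.X
  have B: "0 < B" using W1.B by simp
  define c where "c = min c1 c2 / B"
  have c0: "0 < c" using c B by (simp add: c_def)
  obtain Q1 where Q1: "0 < Q1" "\<forall>\<^sub>F x in at_top. W1.G (c * x) \<le> Q1 * W1.T x"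
    using W1.G_dominated_by_T[OF c0] by blast
  obtain Q2 where Q2: "0 < Q2" "\<forall>\<^sub>F x in at_top. W2.G (c * x) \<le> Q2 * W2.T x"
    using W2.G_dominated_by_T[OF c0] by blast
  define Q where "Q = max Q1 Q2"
  define e where "e = \<eta> / (2 * Q)"
  have Q: "0 < Q" "Q1 \<le> Q" "Q2 \<le> Q" using Q1 by (auto simp: Q_def)
  have e: "0 < e" using \<eta> Q by (simp add: e_def)
  have top: "filterlim (\<lambda>x. c * x) at_top at_top"
    using c0 by (intro filterlim_tendsto_pos_mult_at_top[OF tendsto_const] filterlim_ident) simp
  show ?thesis
    using eventually_compose_filterlim[OF order_tendstoD(2)[OF QAI(1) e] top]
      eventually_compose_filterlim[OF order_tendstoD(2)[OF QAI(2) e] top]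
      Q1(2) Q2(2) eventually_ge_at_top[of 0]
  proof eventually_elim
    case (elim x)
    let ?S = "W1.G (c * x) + W2.G (c * x)"
    have S: "0 < ?S" using W1.G_pos[of "c * x"] W2.G_pos[of "c * x"] by simp
    have ge: "c * x \<le> c1 * x / B" "c * x \<le> c2 * x / B"
      unfolding c_def using elim B by (auto intro!: divide_right_mono mult_right_mono)
    have "\<P>(\<omega> in M. \<bar>\<Theta>1 \<omega> * X1 \<omega>\<bar> > c1 * x \<and> \<Theta>2 \<omega> * X2 \<omega> > c2 * x)
        \<le> \<P>(\<omega> in M. \<bar>X1 \<omega>\<bar> > c1 * x / B \<and> X2 \<omega> > c2 * x / B)"
      using elim c B by (intro prob_weighted_pair_le W1.X W2.X W1.\<Theta>_range W2.\<Theta>_range) auto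
    also have "\<dots> \<le> prob ({\<omega>\<in>space M. max (X1 \<omega>) 0 > c * x \<and> max (X2 \<omega>) 0 > c * x} \<union>
        {\<omega>\<in>space M. - min (X1 \<omega>) 0 > c * x \<and> X2 \<omega> > c * x})"
    proof (rule finite_measure_mono)
      show "{\<omega>\<in>space M. \<bar>X1 \<omega>\<bar> > c1 * x / B \<and> X2 \<omega> > c2 * x / B} \<subseteq>
          {\<omega>\<in>space M. max (X1 \<omega>) 0 > c * x \<and> max (X2 \<omega>) 0 > c * x} \<union>
          {\<omega>\<in>space M. - min (X1 \<omega>) 0 > c * x \<and> X2 \<omega> > c * x}"
      proof
        fix \<omega> assume "\<omega> \<in> {\<omega>\<in>space M. \<bar>X1 \<omega>\<bar> > c1 * x / B \<and> X2 \<omega> > c2 * x / B}"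
        then have "\<omega> \<in> space M" "\<bar>X1 \<omega>\<bar> > c * x" "X2 \<omega> > c * x" using ge by auto
        then show "\<omega> \<in> {\<omega>\<in>space M. max (X1 \<omega>) 0 > c * x \<and> max (X2 \<omega>) 0 > c * x} \<union>
          {\<omega>\<in>space M. - min (X1 \<omega>) 0 > c * x \<and> X2 \<omega> > c * x}"
          by (cases "X1 \<omega> \<ge> 0") auto
      qed
    qed measurable
    also have "\<dots> \<le> \<P>(\<omega> in M. max (X1 \<omega>) 0 > c * x \<and> max (X2 \<omega>) 0 > c * x) +
        \<P>(\<omega> in M. - min (X1 \<omega>) 0 > c * x \<and> X2 \<omega> > c * x)"
      by (rule measure_Un_le) measurable
    also have "\<dots> \<le> e * ?S + e * ?S"
      using elim(1,2) S by (intro add_mono) (auto simp: divide_less_eq W1.G_def W2.G_def intro: less_imp_le)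
    also have "\<dots> = 2 * e * ?S" by simp
    also have "\<dots> \<le> 2 * e * (Q * W1.T x + Q * W2.T x)"
    proof (intro mult_left_mono add_mono)
      show "W1.G (c * x) \<le> Q * W1.T x"
        using elim(3) mult_right_mono[OF Q(2) W1.T_nonneg[of x]] by linarith
      show "W2.G (c * x) \<le> Q * W2.T x"
        using elim(4) mult_right_mono[OF Q(3) W2.T_nonneg[of x]] by linarith
    qed (use e in simp)
    also have "\<dots> = \<eta> * (W1.T x + W2.T x)" using Q(1) by (simp add: e_def distrib_left)
    finally show ?case by (simp add: W1.T_def W2.T_def)
  qed
qed

end

theorem corollary3p2:
  fixes M :: "'a measure" and n :: nat
    and X \<Theta> :: "nat \<Rightarrow> 'a \<Rightarrow> real"
    and F b h :: "nat \<Rightarrow> real \<Rightarrow> real"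
    and g :: "nat \<Rightarrow> nat \<Rightarrow> real \<times> real \<Rightarrow> real"
    and L U :: real
  assumes "prob_space M" and "n \<ge> 2"
    and X_rv: "\<And>i. i \<in> {1..n} \<Longrightarrow> X i \<in> borel_measurable M"
    and F_def: "\<And>i. i \<in> {1..n} \<Longrightarrow> F i = cdf (distr M borel (X i))"
    and F_pos: "\<And>i x. i \<in> {1..n} \<Longrightarrow> x \<ge> 0 \<Longrightarrow> tail (F i) x > 0"
    and F_DL: "\<And>i. i \<in> {1..n} \<Longrightarrow> F i \<in> class_D \<inter> class_L"
    and Theta_rv: "\<And>i. i \<in> {1..n} \<Longrightarrow> \<Theta> i \<in> borel_measurable M"
    and Theta_nonneg: "\<And>i. i \<in> {1..n} \<Longrightarrow> AE \<omega> in M. \<Theta> i \<omega> \<ge> 0"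
    and Theta_nondeg: "\<And>i. i \<in> {1..n} \<Longrightarrow> \<not> (AE \<omega> in M. \<Theta> i \<omega> = 0)"
    \<comment> \<open>condition (i)\<close>
    and b_pos: "\<And>i x. i \<in> {1..n} \<Longrightarrow> x \<ge> 0 \<Longrightarrow> b i x > 0"
    and b_top: "\<And>i. i \<in> {1..n} \<Longrightarrow> filterlim (b i) at_top at_top"
    and b_sublinear: "\<And>i. i \<in> {1..n} \<Longrightarrow> ((\<lambda>x. b i x / x) \<longlongrightarrow> 0) at_top"
    and b_small: "\<And>i j. i \<in> {1..n} \<Longrightarrow> j \<in> {1..n} \<Longrightarrow> i \<noteq> j \<Longrightarrow>
      (\<lambda>(x, y). \<P>(\<omega> in M. \<Theta> i \<omega> > b i x)) \<in>
        o[at_top \<times>\<^sub>F at_top](\<lambda>(x, y). \<P>(\<omega> in M. \<Theta> i \<omega> * X i \<omega> > x \<and> \<Theta> j \<omega> * X j \<omega> > y))"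
    \<comment> \<open>condition (ii)\<close>
    and h_pos: "\<And>i t. i \<in> {1..n} \<Longrightarrow> t \<ge> 0 \<Longrightarrow> h i t > 0"
    and h_defined: "\<And>i. i \<in> {1..n} \<Longrightarrow>
      \<forall>\<^sub>F x in at_top. \<forall>t \<in> rv_support M (\<Theta> i).
        lim_cond_prob_defined M (\<lambda>\<omega>. X i \<omega> > x) (window (\<Theta> i) t)"
    and h_asymp: "\<And>i. i \<in> {1..n} \<Longrightarrow>
      unif_asymp_equiv at_top (rv_support M (\<Theta> i))
        (\<lambda>x t. lim_cond_prob M (\<lambda>\<omega>. X i \<omega> > x) (window (\<Theta> i) t))
        (\<lambda>x t. h i t * \<P>(\<omega> in M. X i \<omega> > x))"
    \<comment> \<open>condition (iii)\<close>
    and L_U: "0 < L" "L \<le> U"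
    and g_meas: "\<And>i j. i \<in> {1..n} \<Longrightarrow> j \<in> {1..n} \<Longrightarrow> i \<noteq> j \<Longrightarrow>
      g i j \<in> borel_measurable (restrict_space borel ({0..} \<times> {0..}))"
    and g_pos: "\<And>i j s t. i \<in> {1..n} \<Longrightarrow> j \<in> {1..n} \<Longrightarrow> i \<noteq> j \<Longrightarrow> s \<ge> 0 \<Longrightarrow> t \<ge> 0 \<Longrightarrow>
      g i j (s, t) > 0"
    and g_defined: "\<And>i j. i \<in> {1..n} \<Longrightarrow> j \<in> {1..n} \<Longrightarrow> i \<noteq> j \<Longrightarrow>
      \<forall>\<^sub>F (x, y) in at_top \<times>\<^sub>F at_top. \<forall>p \<in> rv_support M (\<Theta> i) \<times> rv_support M (\<Theta> j).
        lim_cond_prob_defined M (\<lambda>\<omega>. \<bar>X i \<omega>\<bar> > x \<and> X j \<omega> > y) (window2 (\<Theta> i) (\<Theta> j) p) \<and>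
        lim_cond_prob_defined M (\<lambda>\<omega>. X i \<omega> > x \<and> X j \<omega> > y) (window2 (\<Theta> i) (\<Theta> j) p)"
    and g_asymp: "\<And>i j. i \<in> {1..n} \<Longrightarrow> j \<in> {1..n} \<Longrightarrow> i \<noteq> j \<Longrightarrow>
      unif_asymp_equiv (at_top \<times>\<^sub>F at_top) (rv_support M (\<Theta> i) \<times> rv_support M (\<Theta> j))
        (\<lambda>(x, y) p. lim_cond_prob M (\<lambda>\<omega>. \<bar>X i \<omega>\<bar> > x \<and> X j \<omega> > y) (window2 (\<Theta> i) (\<Theta> j) p))
        (\<lambda>(x, y) p. g i j p * \<P>(\<omega> in M. \<bar>X i \<omega>\<bar> > x \<and> X j \<omega> > y))"
    and g_lower: "\<And>i j. i \<in> {1..n} \<Longrightarrow> j \<in> {1..n} \<Longrightarrow> i \<noteq> j \<Longrightarrow>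
      unif_lesssim (at_top \<times>\<^sub>F at_top) (rv_support M (\<Theta> i) \<times> rv_support M (\<Theta> j))
        (\<lambda>(x, y) p. L * g i j p * \<P>(\<omega> in M. X i \<omega> > x \<and> X j \<omega> > y))
        (\<lambda>(x, y) p. lim_cond_prob M (\<lambda>\<omega>. X i \<omega> > x \<and> X j \<omega> > y) (window2 (\<Theta> i) (\<Theta> j) p))"
    and g_upper: "\<And>i j. i \<in> {1..n} \<Longrightarrow> j \<in> {1..n} \<Longrightarrow> i \<noteq> j \<Longrightarrow>
      unif_lesssim (at_top \<times>\<^sub>F at_top) (rv_support M (\<Theta> i) \<times> rv_support M (\<Theta> j))
        (\<lambda>(x, y) p. lim_cond_prob M (\<lambda>\<omega>. X i \<omega> > x \<and> X j \<omega> > y) (window2 (\<Theta> i) (\<Theta> j) p))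
        (\<lambda>(x, y) p. U * g i j p * \<P>(\<omega> in M. X i \<omega> > x \<and> X j \<omega> > y))"
  shows "(pTAI M {1..n} X \<or> (pQAI M {1..n} X \<and> (\<forall>i\<in>{1..n}. F i \<in> class_C)) \<longrightarrow>
            (\<lambda>x. ruin_prob M \<Theta> X x n) \<sim>[at_top]
              (\<lambda>x. \<Sum>i=1..n. \<P>(\<omega> in M. \<Theta> i \<omega> * X i \<omega> > x))) \<and>
         (\<forall>\<alpha> :: nat \<Rightarrow> real.
            (\<forall>i\<in>{1..n}. \<alpha> i > 0 \<and> F i \<in> class_R (\<alpha> i) \<and>
               (\<exists>\<rho> > \<alpha> i. integrable M (\<lambda>\<omega>. \<Theta> i \<omega> powr \<rho> * h i (\<Theta> i \<omega>)))) \<and>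
            (pTAI M {1..n} X \<or> pQAI M {1..n} X) \<longrightarrow>
            (\<lambda>x. ruin_prob M \<Theta> X x n) \<sim>[at_top]
              (\<lambda>x. \<Sum>i=1..n. (\<integral>\<omega>. \<Theta> i \<omega> powr \<alpha> i * h i (\<Theta> i \<omega>) \<partial>M) * tail (F i) x))"
proof -
  interpret prob_space M by fact
  have Theta_bdd: "\<exists>B. AE \<omega> in M. \<Theta> i \<omega> \<le> B" if i: "i \<in> {1..n}" for i
  proof -
    define j :: nat where "j = (if i = 1 then 2 else 1)"
    have j: "j \<in> {1..n}" "i \<noteq> j" using \<open>n \<ge> 2\<close> by (auto simp: j_def)
    note [measurable] = Theta_rv[OF j(1)] X_rv[OF j(1)]
    show ?thesis
      using b_small[OF i j] by (rule weights_bounded[OF Theta_rv[OF i], rotated]) measurable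
  qed
  then have "\<forall>i\<in>{1..n}. \<exists>B. AE \<omega> in M. \<Theta> i \<omega> \<le> B" by blast
  from bchoice[OF this] obtain B0 where B0: "\<And>i. i \<in> {1..n} \<Longrightarrow> AE \<omega> in M. \<Theta> i \<omega> \<le> B0 i" by blast
  define B where "B = 1 + (\<Sum>i=1..n. \<bar>B0 i\<bar>)"
  have B1: "1 \<le> B" unfolding B_def by (simp add: sum_nonneg)
  have Theta_le: "AE \<omega> in M. \<Theta> i \<omega> \<le> B" if i: "i \<in> {1..n}" for i
  proof -
    have "\<bar>B0 i\<bar> \<le> (\<Sum>i=1..n. \<bar>B0 i\<bar>)" using i by (intro member_le_sum) auto
    then have "B0 i \<le> B" unfolding B_def by linarith
    then show ?thesis using B0[OF i] by (auto elim: eventually_mono)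
  qed
  have "\<exists>k C. bounded_weight M (X i) (\<Theta> i) k C B \<and> (AE \<omega> in M. k (\<Theta> i \<omega>) = h i (\<Theta> i \<omega>))"
    if i: "i \<in> {1..n}" for i
    by (rule bounded_weight_exists[OF X_rv[OF i] Theta_rv[OF i] F_def[OF i] F_pos[OF i] _
          Theta_nonneg[OF i] Theta_nondeg[OF i] Theta_le[OF i] B1 h_pos[OF i] h_defined[OF i] h_asymp[OF i]])
      (use F_DL[OF i] in auto)
  then have "\<forall>i\<in>{1..n}. \<exists>k C. bounded_weight M (X i) (\<Theta> i) k C B \<and> (AE \<omega> in M. k (\<Theta> i \<omega>) = h i (\<Theta> i \<omega>))"
    by blast
  from bchoice[OF this] obtain k where
    "\<forall>i\<in>{1..n}. \<exists>C. bounded_weight M (X i) (\<Theta> i) (k i) C B \<and> (AE \<omega> in M. k i (\<Theta> i \<omega>) = h i (\<Theta> i \<omega>))"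
    by (elim exE)
  from bchoice[OF this] obtain C where
    bw: "\<And>i. i \<in> {1..n} \<Longrightarrow> bounded_weight M (X i) (\<Theta> i) (k i) (C i) B"
    and kh: "\<And>i. i \<in> {1..n} \<Longrightarrow> AE \<omega> in M. k i (\<Theta> i \<omega>) = h i (\<Theta> i \<omega>)"
    by blast
  define T where "T i x = \<P>(\<omega> in M. \<Theta> i \<omega> * X i \<omega> > x)" for i x
  define G where "G i x = \<P>(\<omega> in M. X i \<omega> > x)" for i x
  have tail_F: "tail (F i) = G i" if "i \<in> {1..n}" for i
    using tail_cdf_distr[OF X_rv[OF that]] F_def[OF that] by (auto simp: G_def)
  have WT: "bounded_weight.T M (X i) (\<Theta> i) = T i" "bounded_weight.G M (X i) = G i" if "i \<in> {1..n}" for i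
    using bounded_weight.T_def[OF bw[OF that]] bounded_weight.G_def[OF bw[OF that]]
    by (auto simp: T_def G_def)
  have T_nonneg: "0 \<le> T i x" for i x by (simp add: T_def)
  have T_antimono: "T i y \<le> T i x" if "x \<le> y" "i \<in> {1..n}" for i x y
  proof -
    note [measurable] = X_rv[OF that(2)] Theta_rv[OF that(2)]
    show ?thesis unfolding T_def using that(1) by (intro finite_measure_mono) auto
  qed
  have G_pos: "0 < G i x" if "i \<in> {1..n}" for i x
    using bounded_weight.G_pos[OF bw[OF that]] WT[OF that] by simp
  have T_pos: "\<forall>\<^sub>F x in at_top. 0 < T i x" if "i \<in> {1..n}" for i
    using bounded_weight.T_pos[OF bw[OF that]] WT[OF that] by simp
  have Theta_range: "AE \<omega> in M. 0 \<le> \<Theta> i \<omega> \<and> \<Theta> i \<omega> \<le> B" if "i \<in> {1..n}" for i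
    by (rule bounded_weight.\<Theta>_range[OF bw[OF that]])
  have n1: "n \<ge> 1" "real n > 0" using \<open>n \<ge> 2\<close> by auto
  have T_le_sum: "T i x \<le> (\<Sum>k=1..n. T k x)" if "i \<in> {1..n}" for i x
    using that T_nonneg by (intro member_le_sum) auto
  have ruin: "(\<lambda>x. ruin_prob M \<Theta> X x n) \<sim>[at_top] (\<lambda>x. \<Sum>i=1..n. T i x)"
    if hyp: "\<And>\<eta>. 0 < \<eta> \<Longrightarrow> \<exists>d. (\<forall>\<^sub>F x in at_top. 0 < d x \<and> d x \<le> x) \<and>
      (\<forall>i\<in>{1..n}. \<forall>\<^sub>F x in at_top. T i (x - d x) \<le> (1 + \<eta>) * T i x \<and> T i x \<le> (1 + \<eta>) * T i (x + d x)) \<and>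
      (\<forall>i\<in>{1..n}. \<forall>j\<in>{1..n}. i \<noteq> j \<longrightarrow> (\<forall>\<^sub>F x in at_top.
        \<P>(\<omega> in M. \<bar>\<Theta> i \<omega> * X i \<omega>\<bar> > d x / n \<and> \<Theta> j \<omega> * X j \<omega> > x / n) \<le> \<eta> * (\<Sum>k=1..n. T k x)))"
    unfolding ruin_prob_def T_def
    by (rule max_partial_sums_tail[OF n1(1)])
      (use X_rv Theta_rv T_pos hyp in \<open>auto simp: T_def intro!: borel_measurable_times\<close>)
  have ruin_TAI: "(\<lambda>x. ruin_prob M \<Theta> X x n) \<sim>[at_top] (\<lambda>x. \<Sum>i=1..n. T i x)"
    if TAI: "pTAI M {1..n} X"
  proof (rule ruin)
    fix \<eta> :: real assume \<eta>: "0 < \<eta>"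
    have ex: "\<exists>N. i \<noteq> j \<longrightarrow> (\<forall>a\<ge>N. \<forall>\<^sub>F x in at_top.
        \<P>(\<omega> in M. \<bar>\<Theta> i \<omega> * X i \<omega>\<bar> > a \<and> \<Theta> j \<omega> * X j \<omega> > 1 / n * x) \<le> \<eta> * T j x)"
      if i: "i \<in> {1..n}" and j: "j \<in> {1..n}" for i j
    proof (cases "i = j")
      case False
      have lim: "((\<lambda>(x, y). \<P>(\<omega> in M. \<bar>X i \<omega>\<bar> > x \<bar> X j \<omega> > y)) \<longlongrightarrow> 0) (at_top \<times>\<^sub>F at_top)"
        using TAI i j False unfolding pTAI_def by blast
      obtain N where "\<And>a. a \<ge> N \<Longrightarrow> \<forall>\<^sub>F x in at_top.
          \<P>(\<omega> in M. \<bar>\<Theta> i \<omega> * X i \<omega>\<bar> > a \<and> \<Theta> j \<omega> * X j \<omega> > 1 / n * x) \<le> \<eta> * \<P>(\<omega> in M. \<Theta> j \<omega> * X j \<omega> > x)"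
        by (rule weighted_pair_small_of_TAI[OF X_rv[OF i] bw[OF j] Theta_range[OF i] lim, of "1 / n" \<eta>])
          (use n1 \<eta> in auto)
      then show ?thesis unfolding T_def by blast
    qed simp
    have "\<forall>i\<in>{1..n}. \<exists>N. \<forall>j\<in>{1..n}. i \<noteq> j \<longrightarrow> (\<forall>a\<ge>N j. \<forall>\<^sub>F x in at_top.
        \<P>(\<omega> in M. \<bar>\<Theta> i \<omega> * X i \<omega>\<bar> > a \<and> \<Theta> j \<omega> * X j \<omega> > 1 / n * x) \<le> \<eta> * T j x)"
      by (intro ballI bchoice ex)
    from bchoice[OF this] obtain N where N: "\<And>i j a. i \<in> {1..n} \<Longrightarrow> j \<in> {1..n} \<Longrightarrow> i \<noteq> j \<Longrightarrow> a \<ge> N i j \<Longrightarrow>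
        \<forall>\<^sub>F x in at_top. \<P>(\<omega> in M. \<bar>\<Theta> i \<omega> * X i \<omega>\<bar> > a \<and> \<Theta> j \<omega> * X j \<omega> > 1 / n * x) \<le> \<eta> * T j x"
      by blast
    define a where "a = n * (1 + (\<Sum>i=1..n. \<Sum>j=1..n. \<bar>N i j\<bar>))"
    have a0: "0 < a" unfolding a_def using n1 by (intro mult_pos_pos add_pos_nonneg sum_nonneg) auto
    have aN: "N i j \<le> a / n" if i: "i \<in> {1..n}" and j: "j \<in> {1..n}" for i j
    proof -
      have "N i j \<le> \<bar>N i j\<bar>" by simp
      also have "\<dots> \<le> (\<Sum>j=1..n. \<bar>N i j\<bar>)" using j by (intro member_le_sum) auto
      also have "\<dots> \<le> (\<Sum>i=1..n. \<Sum>j=1..n. \<bar>N i j\<bar>)"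
        using i by (intro member_le_sum[of i _ "\<lambda>i. \<Sum>j=1..n. \<bar>N i j\<bar>"]) (auto intro: sum_nonneg)
      finally show ?thesis using n1 by (simp add: a_def)
    qed
    have shift: "\<forall>\<^sub>F x in at_top. T i (x - a) \<le> (1 + \<eta>) * T i x \<and> T i x \<le> (1 + \<eta>) * T i (x + a)"
      if i: "i \<in> {1..n}" for i
    proof -
      have "((\<lambda>x. G i (x - a) / G i x) \<longlongrightarrow> 1) at_top" if "0 < a" for a
        using F_DL[OF i] that unfolding class_L_def by (simp add: tail_F[OF i])
      then have ev: "\<forall>\<^sub>F x in at_top. T i (x - a) \<le> (1 + \<eta>) * T i x"
        using bounded_weight.T_long_tailed[OF bw[OF i] _ a0 \<eta>] by (simp add: WT[OF i])
      have "filterlim (\<lambda>x. x + a) at_top at_top"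
        using filterlim_tendsto_add_at_top[OF tendsto_const filterlim_ident, of a] by (simp add: add.commute)
      \<comment> \<open>The upward shift at \<open>x\<close> is the downward shift at \<open>x + a\<close>.\<close>
      from ev eventually_compose_filterlim[OF ev this] show ?thesis by eventually_elim simp
    qed
    have joint: "\<forall>\<^sub>F x in at_top. \<P>(\<omega> in M. \<bar>\<Theta> i \<omega> * X i \<omega>\<bar> > a / n \<and> \<Theta> j \<omega> * X j \<omega> > x / n)
        \<le> \<eta> * (\<Sum>k=1..n. T k x)" if i: "i \<in> {1..n}" and j: "j \<in> {1..n}" and ij: "i \<noteq> j" for i j
      using N[OF i j ij aN[OF i j]]
    proof eventually_elim
      case (elim x)
      also have "\<eta> * T j x \<le> \<eta> * (\<Sum>k=1..n. T k x)" using \<eta> T_le_sum[OF j] by simp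
      finally show ?case by simp
    qed
    show "\<exists>d. (\<forall>\<^sub>F x in at_top. 0 < d x \<and> d x \<le> x) \<and>
      (\<forall>i\<in>{1..n}. \<forall>\<^sub>F x in at_top. T i (x - d x) \<le> (1 + \<eta>) * T i x \<and> T i x \<le> (1 + \<eta>) * T i (x + d x)) \<and>
      (\<forall>i\<in>{1..n}. \<forall>j\<in>{1..n}. i \<noteq> j \<longrightarrow> (\<forall>\<^sub>F x in at_top.
        \<P>(\<omega> in M. \<bar>\<Theta> i \<omega> * X i \<omega>\<bar> > d x / n \<and> \<Theta> j \<omega> * X j \<omega> > x / n) \<le> \<eta> * (\<Sum>k=1..n. T k x)))"
    proof (intro exI[of _ "\<lambda>_. a"] conjI ballI impI)
      show "\<forall>\<^sub>F x in at_top. 0 < a \<and> a \<le> x" using eventually_ge_at_top[of a] by eventually_elim (use a0 in simp)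
    qed (use shift joint in auto)
  qed
  have ruin_QAI: "(\<lambda>x. ruin_prob M \<Theta> X x n) \<sim>[at_top] (\<lambda>x. \<Sum>i=1..n. T i x)"
    if QAI: "pQAI M {1..n} X"
      and cons: "\<And>i \<eta>. i \<in> {1..n} \<Longrightarrow> 0 < \<eta> \<Longrightarrow> \<exists>v<1. \<forall>\<^sub>F x in at_top. G i (v * x) \<le> (1 + \<eta>) * G i x"
  proof (rule ruin)
    fix \<eta> :: real assume \<eta>: "0 < \<eta>"
    have "\<exists>v. v < 1 \<and> 1 / 2 \<le> v \<and> (\<forall>\<^sub>F x in at_top. T i (v * x) \<le> (1 + \<eta>) * T i x)"
      if i: "i \<in> {1..n}" for i
    proof -
      have "\<exists>v<1. \<forall>\<^sub>F x in at_top. bounded_weight.G M (X i) (v * x) \<le> (1 + \<eta>') * bounded_weight.G M (X i) x"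
        if "0 < \<eta>'" for \<eta>' using cons[OF i that] by (simp add: WT[OF i])
      then obtain v where "v < 1" "1 / 2 \<le> v"
          "\<forall>\<^sub>F x in at_top. bounded_weight.T M (X i) (\<Theta> i) (v * x) \<le> (1 + \<eta>) * bounded_weight.T M (X i) (\<Theta> i) x"
        by (rule bounded_weight.T_consistently_varying[OF bw[OF i] _ \<eta>])
      then show ?thesis by (auto simp: WT[OF i])
    qed
    then have "\<forall>i\<in>{1..n}. \<exists>v. v < 1 \<and> 1 / 2 \<le> v \<and> (\<forall>\<^sub>F x in at_top. T i (v * x) \<le> (1 + \<eta>) * T i x)"
      by blast
    from bchoice[OF this] obtain v where v: "\<And>i. i \<in> {1..n} \<Longrightarrow> v i < 1" "\<And>i. i \<in> {1..n} \<Longrightarrow> 1 / 2 \<le> v i"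
      "\<And>i. i \<in> {1..n} \<Longrightarrow> \<forall>\<^sub>F x in at_top. T i (v i * x) \<le> (1 + \<eta>) * T i x"
      by blast
    define w where "w = Max (v ` {1..n})"
    have ne: "finite (v ` {1..n})" "v ` {1..n} \<noteq> {}" using n1 by auto
    have w1: "w < 1" unfolding w_def using v(1) by (subst Max_less_iff[OF ne]) auto
    have vw: "v i \<le> w" if "i \<in> {1..n}" for i unfolding w_def using that ne by (intro Max_ge) auto
    have w_half: "1 / 2 \<le> w" using vw[of 1] v(2)[of 1] n1 by auto
    have shift: "\<forall>\<^sub>F x in at_top. T i (x - (1 - w) * x) \<le> (1 + \<eta>) * T i x \<and>
        T i x \<le> (1 + \<eta>) * T i (x + (1 - w) * x)"
      if i: "i \<in> {1..n}" for i
    proof -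
      have ev: "\<forall>\<^sub>F x in at_top. T i (w * x) \<le> (1 + \<eta>) * T i x"
        using v(3)[OF i] eventually_ge_at_top[of 0]
      proof eventually_elim
        case (elim x)
        have "v i * x \<le> w * x" using vw[OF i] elim by (intro mult_right_mono)
        from T_antimono[OF this i] elim show ?case by linarith
      qed
      have "filterlim (\<lambda>x. (2 - w) * x) at_top at_top"
        using w1 by (intro filterlim_tendsto_pos_mult_at_top[OF tendsto_const] filterlim_ident) simp
      from ev eventually_compose_filterlim[OF ev this] eventually_ge_at_top[of 0]
      show ?thesis
      proof eventually_elim
        case (elim x)
        \<comment> \<open>The upward shift is the downward one at \<open>(2 - w) * x\<close>, since \<open>w * (2 - w) \<le> 1\<close>.\<close>
        have "1 - w * (2 - w) = (1 - w) * (1 - w)" by algebra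
        then have "w * (2 - w) \<le> 1" using zero_le_square[of "1 - w"] by linarith
        then have "w * (2 - w) * x \<le> 1 * x" using elim by (intro mult_right_mono)
        then have "T i x \<le> T i (w * ((2 - w) * x))" by (intro T_antimono i) (simp add: mult.assoc)
        moreover have "x - (1 - w) * x = w * x" "x + (1 - w) * x = (2 - w) * x"
          by (simp_all add: algebra_simps)
        ultimately show ?case using elim by simp
      qed
    qed
    have joint: "\<forall>\<^sub>F x in at_top. \<P>(\<omega> in M. \<bar>\<Theta> i \<omega> * X i \<omega>\<bar> > (1 - w) * x / n \<and> \<Theta> j \<omega> * X j \<omega> > x / n)
        \<le> \<eta> * (\<Sum>k=1..n. T k x)" if i: "i \<in> {1..n}" and j: "j \<in> {1..n}" and ij: "i \<noteq> j" for i j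
    proof -
      have lim: "((\<lambda>x. \<P>(\<omega> in M. max (X i \<omega>) 0 > x \<and> max (X j \<omega>) 0 > x) /
           (\<P>(\<omega> in M. X i \<omega> > x) + \<P>(\<omega> in M. X j \<omega> > x))) \<longlongrightarrow> 0) at_top"
        "((\<lambda>x. \<P>(\<omega> in M. - min (X i \<omega>) 0 > x \<and> X j \<omega> > x) /
           (\<P>(\<omega> in M. X i \<omega> > x) + \<P>(\<omega> in M. X j \<omega> > x))) \<longlongrightarrow> 0) at_top"
        using QAI i j ij unfolding pQAI_def by blast+
      have "\<eta> / 2 > 0" "(1 - w) / n > 0" "1 / real n > 0" using \<eta> w1 n1 by auto
      from weighted_pair_small_of_QAI[OF bw[OF i] bw[OF j] lim this(2,3,1)]
      show ?thesis
      proof eventually_elim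
        case (elim x)
        have "\<eta> / 2 * (T i x + T j x) \<le> \<eta> / 2 * ((\<Sum>k=1..n. T k x) + (\<Sum>k=1..n. T k x))"
          using \<eta> T_le_sum[OF i, of x] T_le_sum[OF j, of x] by (intro mult_left_mono) auto
        also have "\<dots> = \<eta> * (\<Sum>k=1..n. T k x)" by simp
        finally show ?case using elim by (simp add: T_def)
      qed
    qed
    show "\<exists>d. (\<forall>\<^sub>F x in at_top. 0 < d x \<and> d x \<le> x) \<and>
      (\<forall>i\<in>{1..n}. \<forall>\<^sub>F x in at_top. T i (x - d x) \<le> (1 + \<eta>) * T i x \<and> T i x \<le> (1 + \<eta>) * T i (x + d x)) \<and>
      (\<forall>i\<in>{1..n}. \<forall>j\<in>{1..n}. i \<noteq> j \<longrightarrow> (\<forall>\<^sub>F x in at_top.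
        \<P>(\<omega> in M. \<bar>\<Theta> i \<omega> * X i \<omega>\<bar> > d x / n \<and> \<Theta> j \<omega> * X j \<omega> > x / n) \<le> \<eta> * (\<Sum>k=1..n. T k x)))"
    proof (intro exI[of _ "\<lambda>x. (1 - w) * x"] conjI ballI impI)
      show "\<forall>\<^sub>F x in at_top. 0 < (1 - w) * x \<and> (1 - w) * x \<le> x"
        using eventually_gt_at_top[of 0]
      proof eventually_elim
        case (elim x)
        have "(1 - w) * x \<le> 1 * x" using elim w_half by (intro mult_right_mono) auto
        then show ?case using elim w1 by simp
      qed
    qed (use shift joint in auto)
  qed
  show ?thesis
  proof (intro conjI allI impI)
    assume "pTAI M {1..n} X \<or> (pQAI M {1..n} X \<and> (\<forall>i\<in>{1..n}. F i \<in> class_C))"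
    then have "(\<lambda>x. ruin_prob M \<Theta> X x n) \<sim>[at_top] (\<lambda>x. \<Sum>i=1..n. T i x)"
    proof (elim disjE conjE)
      assume QAI: "pQAI M {1..n} X" and C: "\<forall>i\<in>{1..n}. F i \<in> class_C"
      show ?thesis
      proof (rule ruin_QAI[OF QAI])
        fix i and \<eta> :: real assume i: "i \<in> {1..n}" and "0 < \<eta>"
        then show "\<exists>v<1. \<forall>\<^sub>F x in at_top. G i (v * x) \<le> (1 + \<eta>) * G i x"
          using class_C_shift[of "F i" \<eta>] C G_pos[OF i] unfolding tail_F[OF i] by blast
      qed
    qed (rule ruin_TAI)
    then show "(\<lambda>x. ruin_prob M \<Theta> X x n) \<sim>[at_top] (\<lambda>x. \<Sum>i=1..n. \<P>(\<omega> in M. \<Theta> i \<omega> * X i \<omega> > x))"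
      by (simp add: T_def)
  next
    fix \<alpha> :: "nat \<Rightarrow> real"
    assume *: "(\<forall>i\<in>{1..n}. \<alpha> i > 0 \<and> F i \<in> class_R (\<alpha> i) \<and>
               (\<exists>\<rho> > \<alpha> i. integrable M (\<lambda>\<omega>. \<Theta> i \<omega> powr \<rho> * h i (\<Theta> i \<omega>)))) \<and>
            (pTAI M {1..n} X \<or> pQAI M {1..n} X)"
    then have R: "\<And>i. i \<in> {1..n} \<Longrightarrow> F i \<in> class_R (\<alpha> i)" by blast
    have "(\<lambda>x. ruin_prob M \<Theta> X x n) \<sim>[at_top] (\<lambda>x. \<Sum>i=1..n. T i x)"
      using conjunct2[OF *]
    proof (elim disjE)
      assume QAI: "pQAI M {1..n} X"
      show ?thesis
      proof (rule ruin_QAI[OF QAI])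
        fix i and \<eta> :: real assume i: "i \<in> {1..n}" and "0 < \<eta>"
        then show "\<exists>v<1. \<forall>\<^sub>F x in at_top. G i (v * x) \<le> (1 + \<eta>) * G i x"
          using class_R_shift[OF R[OF i], of \<eta>] G_pos[OF i] unfolding tail_F[OF i] by blast
      qed
    qed (rule ruin_TAI)
    also define c where "c = (\<lambda>i. \<integral>\<omega>. \<Theta> i \<omega> powr \<alpha> i * h i (\<Theta> i \<omega>) \<partial>M)"
    have c_eq: "c i = (\<integral>\<omega>. \<Theta> i \<omega> powr \<alpha> i * k i (\<Theta> i \<omega>) \<partial>M)" if i: "i \<in> {1..n}" for i
    proof -
      note [measurable] = Theta_rv[OF i] bounded_weight.k[OF bw[OF i]]
      obtain \<rho> where "integrable M (\<lambda>\<omega>. \<Theta> i \<omega> powr \<rho> * h i (\<Theta> i \<omega>))"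
        using * i by blast
      then have [measurable]: "(\<lambda>\<omega>. \<Theta> i \<omega> powr \<rho> * h i (\<Theta> i \<omega>)) \<in> borel_measurable M" by simp
      \<comment> \<open>As \<open>h i\<close> is arbitrary outside the support, the measurability of the integrand comes from that of
        the integrable function with exponent \<open>\<rho>\<close>.\<close>
      have "(\<lambda>\<omega>. \<Theta> i \<omega> powr (\<alpha> i - \<rho>) * (\<Theta> i \<omega> powr \<rho> * h i (\<Theta> i \<omega>))) \<in> borel_measurable M"
        by measurable
      then have [measurable]: "(\<lambda>\<omega>. \<Theta> i \<omega> powr \<alpha> i * h i (\<Theta> i \<omega>)) \<in> borel_measurable M"
        by (simp add: mult.assoc[symmetric] powr_add[symmetric])
      show ?thesis unfolding c_def
      proof (rule integral_cong_AE)
        show "AE \<omega> in M. \<Theta> i \<omega> powr \<alpha> i * h i (\<Theta> i \<omega>) = \<Theta> i \<omega> powr \<alpha> i * k i (\<Theta> i \<omega>)"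
          using kh[OF i] by eventually_elim simp
      qed measurable
    qed
    have lim: "((\<lambda>x. T i x / G i x) \<longlongrightarrow> c i) at_top" if i: "i \<in> {1..n}" for i
    proof -
      have "((\<lambda>x. G i (b * x) / G i x) \<longlongrightarrow> b powr (- \<alpha> i)) at_top" if "0 < b" for b
        using R[OF i] that unfolding class_R_def by (simp add: tail_F[OF i])
      then show ?thesis
        using bounded_weight.T_regularly_varying[OF bw[OF i], of "\<alpha> i"] by (simp add: WT[OF i] c_eq[OF i])
    qed
    have c_pos: "0 < c i" if i: "i \<in> {1..n}" for i
    proof -
      obtain \<kappa> where \<kappa>: "0 < \<kappa>" "\<forall>\<^sub>F x in at_top. \<kappa> * G i x \<le> T i x"
        using bounded_weight.T_lower[OF bw[OF i]] unfolding WT[OF i] by blast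
      have "\<forall>\<^sub>F x in at_top. \<kappa> \<le> T i x / G i x"
        using \<kappa>(2) by eventually_elim (simp add: pos_le_divide_eq[OF G_pos[OF i]])
      from tendsto_lowerbound[OF lim[OF i] this] \<kappa>(1) show ?thesis by simp
    qed
    have "(\<lambda>x. \<Sum>i=1..n. T i x) \<sim>[at_top] (\<lambda>x. \<Sum>i=1..n. c i * G i x)"
      using n1 G_pos c_pos lim by (intro asymp_equiv_sum_of_ratios) auto
    also have "(\<lambda>x. \<Sum>i=1..n. c i * G i x) = (\<lambda>x. \<Sum>i=1..n. c i * tail (F i) x)"
      by (intro ext sum.cong) (auto simp: tail_F)
    finally show "(\<lambda>x. ruin_prob M \<Theta> X x n) \<sim>[at_top]
        (\<lambda>x. \<Sum>i=1..n. (\<integral>\<omega>. \<Theta> i \<omega> powr \<alpha> i * h i (\<Theta> i \<omega>) \<partial>M) * tail (F i) x)"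
      unfolding c_def .
  qed
qed

end
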